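(* Let $r\ge 3$ be an integer and let $\ell\ge 2^r+1$ be odd. Then $p(n;r,C_\ell,d)=n^{-1+1/(\ell-1)}$ for $0\le d\le 1-2^{-r+2}$; $n^{-1}\le p(n;r,C_\ell,d)\le n^{-1+1/(\ell-1)}$ for $1-2^{-r+2}<d\le 1-2^{-r+1}$; $p(n;r,C_\ell,d)=n^{-2}$ for $1-2^{-r+1}<d\le 1-2^{-r}$; and $p(n;r,C_\ell,d)=0$ for $1-2^{-r}<d\le 1$.
   Context: $C_\ell$ is the cycle of length $\ell$. A graph $G$ is $(H,r)$-Ramsey if every colouring of the edges of $G$ with $r$ colours contains a monochromatic copy of $H$. The density of an $n$-vertex graph $G$ is $e(G)/\binom n2$. $G(n,p)$ is the binomial random graph on $[n]$ and $G_n\cup G(n,p)$ the union graph on $[n]$. The perturbed Ramsey threshold $p(n;r,H,d)$ is a function such that: (i) if $p=\omega(p(n;r,H,d))$ then for every sequence $(G_n)$ of $n$-vertex graphs of density at least $d$, $G_n\cup G(n,p)$ is $(H,r)$-Ramsey with high probability; (ii) if $p=o(p(n;r,H,d))$ then for some sequence $(G_n)$ of $n$-vertex graphs of density at least $d$, with high probability $G_n\cup G(n,p)$ is not $(H,r)$-Ramsey. If every sufficiently large graph of density at least $d$ is $(H,r)$-Ramsey, the threshold is $0$. An upper bound $p(n;\cdot)\le f$ means that $p=\omega(f)$ yields (i); a lower bound $p(n;\cdot)\ge g$ means $p=o(g)$ yields (ii). *)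

theory Defs
  imports Complex_Main "HOL-Library.Landau_Symbols"
begin

definition all_edges :: "nat \<Rightarrow> nat set set" where
  "all_edges n = {e. \<exists>a b. a < n \<and> b < n \<and> a \<noteq> b \<and> e = {a, b}}"

definition is_graph :: "nat \<Rightarrow> nat set set \<Rightarrow> bool" where
  "is_graph n G \<longleftrightarrow> G \<subseteq> all_edges n"

definition density :: "nat \<Rightarrow> nat set set \<Rightarrow> real" where
  "density n G = real (card G) / real (n choose 2)"

definition has_cycle :: "nat \<Rightarrow> nat set set \<Rightarrow> bool" where
  "has_cycle l F \<longleftrightarrow>
     (\<exists>f :: nat \<Rightarrow> nat. inj_on f {..<l} \<and> (\<forall>i<l. {f i, f (Suc i mod l)} \<in> F))"

definition cycle_ramsey :: "nat \<Rightarrow> nat \<Rightarrow> nat set set \<Rightarrow> bool" where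
  "cycle_ramsey l r G \<longleftrightarrow>
     (\<forall>c :: nat set \<Rightarrow> nat. (\<forall>e\<in>G. c e < r) \<longrightarrow> (\<exists>k<r. has_cycle l {e\<in>G. c e = k}))"

definition prob_gnp :: "nat \<Rightarrow> real \<Rightarrow> (nat set set \<Rightarrow> bool) \<Rightarrow> real" where
  "prob_gnp n p P = (\<Sum>F\<in>Pow (all_edges n).
      (if P F then p ^ card F * (1 - p) ^ (card (all_edges n) - card F) else 0))"

definition prob_ramsey_union :: "nat \<Rightarrow> nat \<Rightarrow> nat \<Rightarrow> real \<Rightarrow> nat set set \<Rightarrow> real" where
  "prob_ramsey_union l r n p G = prob_gnp n p (\<lambda>F. cycle_ramsey l r (G \<union> F))"

text \<open>Upper bound p(n; r, C_l, d) \<le> f: if p = \<omega>(f) then for every sequence (G_n) of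
  n-vertex graphs of density at least d, G_n \<union> G(n,p) is Ramsey w.h.p.\<close>
definition pert_upper :: "nat \<Rightarrow> nat \<Rightarrow> real \<Rightarrow> (nat \<Rightarrow> real) \<Rightarrow> bool" where
  "pert_upper l r d f \<longleftrightarrow>
     (\<forall>(p :: nat \<Rightarrow> real) (G :: nat \<Rightarrow> nat set set).
        (\<forall>n. 0 \<le> p n \<and> p n \<le> 1) \<longrightarrow> f \<in> o(p) \<longrightarrow>
        (\<forall>n. is_graph n (G n)) \<longrightarrow> (\<forall>n\<ge>2. density n (G n) \<ge> d) \<longrightarrow>
        ((\<lambda>n. prob_ramsey_union l r n (p n) (G n)) \<longlongrightarrow> 1) at_top)"

text \<open>Lower bound p(n; r, C_l, d) \<ge> g: if p = o(g) then some sequence (G_n) of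
  n-vertex graphs of density at least d has G_n \<union> G(n,p) not Ramsey w.h.p.\<close>
definition pert_lower :: "nat \<Rightarrow> nat \<Rightarrow> real \<Rightarrow> (nat \<Rightarrow> real) \<Rightarrow> bool" where
  "pert_lower l r d g \<longleftrightarrow>
     (\<forall>p :: nat \<Rightarrow> real. (\<forall>n. 0 \<le> p n \<and> p n \<le> 1) \<longrightarrow> p \<in> o(g) \<longrightarrow>
        (\<exists>G :: nat \<Rightarrow> nat set set. (\<forall>n. is_graph n (G n)) \<and> (\<forall>n\<ge>2. density n (G n) \<ge> d) \<and>
           ((\<lambda>n. prob_ramsey_union l r n (p n) (G n)) \<longlongrightarrow> 0) at_top))"

text \<open>Threshold 0: every sufficiently large graph of density at least d is Ramsey.\<close>
definition pert_zero :: "nat \<Rightarrow> nat \<Rightarrow> real \<Rightarrow> bool" where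
  "pert_zero l r d \<longleftrightarrow>
     (\<exists>N. \<forall>n\<ge>N. \<forall>G. is_graph n G \<and> density n G \<ge> d \<longrightarrow> cycle_ramsey l r G)"

end

theory Submission
  imports Defs "HOL-Library.Ramsey"
begin

text \<open>
  The 1-statement at \<open>n powr (-1 + 1/(l-1))\<close> ignores \<open>G\<^sub>n\<close>.  The complete graph on \<open>2^r + 1\<close>
  vertices is not a union of \<open>r\<close> bipartite graphs, so each of its \<open>r\<close>-colourings has a
  monochromatic odd cycle; in a large blow-up this cycle can be lengthened to \<open>C\<^sub>l\<close>, hence \<open>r\<close>
  edge sets each spanning few copies of \<open>C\<^sub>l\<close> miss a positive proportion of all pairs.  Hypergraph
  containers for the copies of \<open>C\<^sub>l\<close> and a union bound over \<open>r\<close>-tuples of fingerprints conclude.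

  If \<open>d > 1 - 2^-r\<close>, then \<open>G\<^sub>n\<close> contains such a blow-up.  If only \<open>d > 1 - 2^-(r-1)\<close>, it contains
  a positive proportion of all blow-ups of the complete graph on \<open>2^(r-1) + 1\<close> vertices, and
  \<open>\<omega>(1)\<close> random edges put a perfect matching into every class of one of them.  Splitting each
  class along its matching gives a blow-up of the complete graph on \<open>2^r + 2\<close> vertices in which some
  complete bipartite pairs are replaced by matchings, and this still suffices.

  For the 0-statements \<open>G\<^sub>n\<close> is the balanced complete \<open>2^k\<close>-partite graph, a union of \<open>k\<close> bipartite
  graphs, which can be coloured with \<open>k\<close> colours that do not meet the random edges.  The latter
  have to be coloured with the remaining \<open>r - k\<close> colours.  For \<open>k = r\<close> there are no random
  edges, for \<open>k = r - 1\<close> they contain no \<open>C\<^sub>l\<close>, and for \<open>k = r - 2\<close> the copies of \<open>C\<^sub>l\<close> fall into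
  edge-disjoint clusters of logarithmic size, by comparison with a subcritical branching process.  Such
  clusters are sparse enough to be 4-colourable, thus unions of two bipartite graphs.
\<close>

section \<open>Random subsets of a finite set\<close>

text \<open>Going back and forth lengthens a monochromatic odd cycle by an even amount only. Such a
  cycle has at most \<open>2 ^ r + 1\<close> vertices, so an odd \<open>l\<close> of at least this
  size can be reached.

  The exponent \<open>-1 + 1 / (l - 1)\<close> makes \<open>n ^ (l - 2) * p ^ (l - 1)\<close>, the
  order of the expected number of random paths that complete a given pair to a copy of the cycle,
  equal to 1. Its reciprocal \<open>x\<close> is the container parameter: \<open>j\<close> edges lie
  in at most a constant times \<open>x ^ (l - j)\<close> copies, so fingerprints have
  \<open>O(n^2 / x)\<close> edges. The union bound closes because a fingerprint must itself lie in
  the random graph and contributes \<open>p\<close> to the power of its size; the choice of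
  \<open>r\<close> fingerprints then costs less than the gain from the pairs that all containers
  miss.

  Below the threshold the expected number of copies attached to an edge is only a small constant and
  does not tend to 0. So clusters are logarithmic rather than bounded, and the constant has to beat
  the factor 2 that each exploration step loses.

  Asymptotic relations are replaced by estimates with constants that are uniform in \<open>G\<close>
  and \<open>p\<close>.\<close>

definition pr :: "'a set \<Rightarrow> real \<Rightarrow> ('a set \<Rightarrow> bool) \<Rightarrow> real" where
  "pr E p P = (\<Sum>F\<in>Pow E. if P F then p ^ card F * (1 - p) ^ (card E - card F) else 0)"

lemma prob_gnp_eq_pr: "prob_gnp n p P = pr (all_edges n) p P"
  by (simp add: prob_gnp_def pr_def)

lemma pr_empty [simp]: "pr {} p P = (if P {} then 1 else 0)"
  by (simp add: pr_def)

text \<open>Condition on whether \<open>a\<close> is selected. The ground set is arbitrary so that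
  exact formulas follow by induction on it and so that a part of it can be exposed first.\<close>

lemma pr_insert:
  assumes "finite E" "a \<notin> E"
  shows "pr (insert a E) p P = (1 - p) * pr E p P + p * pr E p (\<lambda>F. P (insert a F))"
proof -
  let ?w = "\<lambda>F. p ^ card F * (1 - p) ^ (card (insert a E) - card F)"
  have fin: "finite F" if "F \<in> Pow E" for F
    using that assms finite_subset by blast
  have le: "card F \<le> card E" if "F \<in> Pow E" for F
    using that assms by (simp add: card_mono)
  have "pr (insert a E) p P =
      (\<Sum>F\<in>Pow E. if P F then ?w F else 0) + (\<Sum>F\<in>insert a ` Pow E. if P F then ?w F else 0)"
    unfolding pr_def Pow_insert
    by (rule sum.union_disjoint) (use assms in auto)
  also have "(\<Sum>F\<in>insert a ` Pow E. if P F then ?w F else 0)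
      = (\<Sum>F\<in>Pow E. if P (insert a F) then ?w (insert a F) else 0)"
    by (subst sum.reindex) (use assms in \<open>auto simp: inj_on_def intro!: sum.cong\<close>)
  also have "\<dots> = p * pr E p (\<lambda>F. P (insert a F))"
    unfolding pr_def sum_distrib_left
  proof (rule sum.cong [OF refl])
    fix F assume F: "F \<in> Pow E"
    then have "a \<notin> F" using assms by auto
    then show "(if P (insert a F) then ?w (insert a F) else 0) =
        p * (if P (insert a F) then p ^ card F * (1 - p) ^ (card E - card F) else 0)"
      using fin [OF F] assms by simp
  qed
  also have "(\<Sum>F\<in>Pow E. if P F then ?w F else 0) = (1 - p) * pr E p P"
    unfolding pr_def sum_distrib_left
  proof (rule sum.cong [OF refl])
    fix F assume F: "F \<in> Pow E"
    have "card (insert a E) - card F = Suc (card E - card F)"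
      using le [OF F] assms by simp
    then show "(if P F then ?w F else 0) =
        (1 - p) * (if P F then p ^ card F * (1 - p) ^ (card E - card F) else 0)"
      by simp
  qed
  finally show ?thesis .
qed

lemma pr_cong: "(\<And>F. F \<subseteq> E \<Longrightarrow> P F \<longleftrightarrow> Q F) \<Longrightarrow> pr E p P = pr E p Q"
  unfolding pr_def by (rule sum.cong) auto

text \<open>Intersecting \<open>S\<close> and \<open>R\<close> with \<open>E\<close> keeps the
  statement meaningful when the induction takes elements out of \<open>E\<close>.\<close>

lemma pr_subset_avoid:
  assumes "finite E" "S \<inter> R = {}"
  shows "pr E p (\<lambda>F. S \<inter> E \<subseteq> F \<and> F \<inter> R = {}) = p ^ card (S \<inter> E) * (1 - p) ^ card (R \<inter> E)"
  using assms
proof (induction E rule: finite_induct)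
  case empty
  then show ?case by simp
next
  case (insert a E)
  have IH: "pr E p (\<lambda>F. S \<inter> E \<subseteq> F \<and> F \<inter> R = {}) = p ^ card (S \<inter> E) * (1 - p) ^ card (R \<inter> E)"
    using insert by simp
  have F0: "pr E p (\<lambda>F. False) = 0" by (simp add: pr_def)
  consider "a \<in> S" "a \<notin> R" | "a \<in> R" "a \<notin> S" | "a \<notin> S" "a \<notin> R"
    using insert.prems by auto
  then show ?case
  proof cases
    case 1
    have "pr E p (\<lambda>F. S \<inter> insert a E \<subseteq> F \<and> F \<inter> R = {}) = pr E p (\<lambda>F. False)"
      by (rule pr_cong) (use 1 insert in auto)
    moreover have "pr E p (\<lambda>F. S \<inter> insert a E \<subseteq> insert a F \<and> insert a F \<inter> R = {})
        = pr E p (\<lambda>F. S \<inter> E \<subseteq> F \<and> F \<inter> R = {})"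
      by (rule pr_cong) (use 1 insert in auto)
    moreover have "card (S \<inter> insert a E) = Suc (card (S \<inter> E))"
      using 1 insert.hyps by simp
    moreover have "R \<inter> insert a E = R \<inter> E" using 1 by simp
    ultimately show ?thesis using insert.hyps by (simp add: pr_insert F0 IH)
  next
    case 2
    have "pr E p (\<lambda>F. S \<inter> insert a E \<subseteq> insert a F \<and> insert a F \<inter> R = {}) = pr E p (\<lambda>F. False)"
      by (rule pr_cong) (use 2 insert in auto)
    moreover have "pr E p (\<lambda>F. S \<inter> insert a E \<subseteq> F \<and> F \<inter> R = {})
        = pr E p (\<lambda>F. S \<inter> E \<subseteq> F \<and> F \<inter> R = {})"
      by (rule pr_cong) (use 2 insert in auto)
    moreover have "card (R \<inter> insert a E) = Suc (card (R \<inter> E))"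
      using 2 insert.hyps by simp
    moreover have "S \<inter> insert a E = S \<inter> E" using 2 by simp
    ultimately show ?thesis using insert.hyps by (simp add: pr_insert F0 IH)
  next
    case 3
    have "pr E p (\<lambda>F. S \<inter> insert a E \<subseteq> insert a F \<and> insert a F \<inter> R = {})
        = pr E p (\<lambda>F. S \<inter> E \<subseteq> F \<and> F \<inter> R = {})"
      by (rule pr_cong) (use 3 insert in auto)
    moreover have "pr E p (\<lambda>F. S \<inter> insert a E \<subseteq> F \<and> F \<inter> R = {})
        = pr E p (\<lambda>F. S \<inter> E \<subseteq> F \<and> F \<inter> R = {})"
      by (rule pr_cong) (use 3 insert in auto)
    moreover have "R \<inter> insert a E = R \<inter> E" "S \<inter> insert a E = S \<inter> E" using 3 by simp_all
    ultimately show ?thesis using insert.hyps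
      by (simp add: pr_insert IH) (simp add: algebra_simps)
  qed
qed

lemma pr_True: "finite E \<Longrightarrow> pr E p (\<lambda>_. True) = 1"
  using pr_subset_avoid [of E "{}" "{}" p] by simp

lemma pr_subset: "finite E \<Longrightarrow> S \<subseteq> E \<Longrightarrow> pr E p (\<lambda>F. S \<subseteq> F) = p ^ card S"
  using pr_subset_avoid [of E S "{}" p] by (simp add: Int_absorb2)

lemma pr_contain_avoid:
  assumes "finite E" "S \<subseteq> E" "R \<subseteq> E" "S \<inter> R = {}"
  shows "pr E p (\<lambda>F. S \<subseteq> F \<and> F \<inter> R = {}) = p ^ card S * (1 - p) ^ card R"
  using pr_subset_avoid [of E S R p] assms by (simp add: Int_absorb2)

lemma pr_mono:
  assumes "0 \<le> p" "p \<le> 1" "\<And>F. F \<subseteq> E \<Longrightarrow> P F \<Longrightarrow> Q F"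
  shows "pr E p P \<le> pr E p Q"
  unfolding pr_def by (rule sum_mono) (use assms in auto)

lemma pr_nonneg: "0 \<le> p \<Longrightarrow> p \<le> 1 \<Longrightarrow> 0 \<le> pr E p P"
  unfolding pr_def by (rule sum_nonneg) auto

lemma pr_le_1: "finite E \<Longrightarrow> 0 \<le> p \<Longrightarrow> p \<le> 1 \<Longrightarrow> pr E p P \<le> 1"
  using pr_mono [of p E P "\<lambda>_. True"] pr_True [of E p] by simp

lemma pr_compl:
  assumes "finite E"
  shows "pr E p (\<lambda>F. \<not> P F) = 1 - pr E p P"
proof -
  have "pr E p P + pr E p (\<lambda>F. \<not> P F) = pr E p (\<lambda>_. True)"
    unfolding pr_def sum.distrib [symmetric] by (rule sum.cong) auto
  then show ?thesis using pr_True [OF assms] by simp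
qed

lemma pr_disj:
  assumes "0 \<le> p" "p \<le> 1"
  shows "pr E p (\<lambda>F. P F \<or> Q F) \<le> pr E p P + pr E p Q"
  unfolding pr_def sum.distrib [symmetric] by (rule sum_mono) (use assms in auto)

lemma pr_Bex:
  assumes "0 \<le> p" "p \<le> 1" "finite X"
  shows "pr E p (\<lambda>F. \<exists>x\<in>X. P x F) \<le> (\<Sum>x\<in>X. pr E p (P x))"
  using assms(3)
proof (induction X rule: finite_induct)
  case empty
  then show ?case by (simp add: pr_def)
next
  case (insert x X)
  have "pr E p (\<lambda>F. \<exists>x\<in>insert x X. P x F) \<le> pr E p (P x) + pr E p (\<lambda>F. \<exists>x\<in>X. P x F)"
    using pr_disj [OF assms(1,2)] by simp
  with insert show ?case by simp
qed

text \<open>Two-round exposure: reveal the random set on \<open>A\<close>, and for each outcome use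
  the independent randomness on \<open>B\<close>.\<close>

lemma pr_Un:
  assumes "finite A" "finite B" "A \<inter> B = {}"
  shows "pr (A \<union> B) p P =
    (\<Sum>F\<in>Pow A. p ^ card F * (1 - p) ^ (card A - card F) * pr B p (\<lambda>F'. P (F \<union> F')))"
  using assms(1,3)
proof (induction A arbitrary: P rule: finite_induct)
  case empty
  then show ?case by simp
next
  case (insert a A)
  let ?w = "\<lambda>A F. p ^ card F * (1 - p) ^ (card A - card F)"
  have "pr (insert a A \<union> B) p P =
      (1 - p) * (\<Sum>F\<in>Pow A. ?w A F * pr B p (\<lambda>F'. P (F \<union> F'))) +
      p * (\<Sum>F\<in>Pow A. ?w A F * pr B p (\<lambda>F'. P (insert a (F \<union> F'))))"
    using insert assms(2) by (simp add: pr_insert)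
  also have "(1 - p) * (\<Sum>F\<in>Pow A. ?w A F * pr B p (\<lambda>F'. P (F \<union> F'))) =
      (\<Sum>F\<in>Pow A. ?w (insert a A) F * pr B p (\<lambda>F'. P (F \<union> F')))"
    unfolding sum_distrib_left
  proof (rule sum.cong [OF refl])
    fix F assume F: "F \<in> Pow A"
    have "card (insert a A) - card F = Suc (card A - card F)"
      using F insert.hyps card_mono [of A F] by (simp add: Suc_diff_le)
    then show "(1 - p) * (?w A F * pr B p (\<lambda>F'. P (F \<union> F'))) =
        ?w (insert a A) F * pr B p (\<lambda>F'. P (F \<union> F'))" by simp
  qed
  also have "p * (\<Sum>F\<in>Pow A. ?w A F * pr B p (\<lambda>F'. P (insert a (F \<union> F')))) =
      (\<Sum>F\<in>insert a ` Pow A. ?w (insert a A) F * pr B p (\<lambda>F'. P (F \<union> F')))"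
  proof -
    have inj: "inj_on (insert a) (Pow A)"
      using insert.hyps by (auto simp: inj_on_def)
    show ?thesis
      unfolding sum_distrib_left sum.reindex [OF inj]
    proof (rule sum.cong [OF refl])
      fix F assume F: "F \<in> Pow A"
      then have "a \<notin> F" "finite F" using insert.hyps finite_subset by auto
      then show "p * (?w A F * pr B p (\<lambda>F'. P (insert a (F \<union> F')))) =
        ((\<lambda>F. ?w (insert a A) F * pr B p (\<lambda>F'. P (F \<union> F'))) \<circ> insert a) F"
        using insert.hyps by simp
    qed
  qed
  also have "(\<Sum>F\<in>Pow A. ?w (insert a A) F * pr B p (\<lambda>F'. P (F \<union> F'))) +
      (\<Sum>F\<in>insert a ` Pow A. ?w (insert a A) F * pr B p (\<lambda>F'. P (F \<union> F'))) =
      (\<Sum>F\<in>Pow (insert a A). ?w (insert a A) F * pr B p (\<lambda>F'. P (F \<union> F')))"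
    unfolding Pow_insert
    by (rule sum.union_disjoint [symmetric]) (use insert.hyps in auto)
  finally show ?case .
qed

section \<open>Edge sets, and monotonicity of the Ramsey property\<close>

lemma finite_all_edges [simp]: "finite (all_edges n)"
proof -
  have "all_edges n \<subseteq> Pow {..<n}" by (auto simp: all_edges_def)
  then show ?thesis using finite_subset by blast
qed

lemma all_edges_eq: "all_edges n = {e. e \<subseteq> {..<n} \<and> card e = 2}"
  by (auto simp: all_edges_def card_2_iff)

lemma card_all_edges: "card (all_edges n) = n choose 2"
  unfolding all_edges_eq using n_subsets [of "{..<n}" 2] by simp

lemma card_all_edges_le: "real (card (all_edges n)) \<le> real n ^ 2 / 2"
proof -
  have "2 * (n choose 2) = n * (n - 1)" 
    using choose_two [of n] by (metis dvd_mult_div_cancel even_mult_iff even_diff_nat mult.commute odd_pos parity_cases even_Suc Suc_pred' dvd_0_right)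
  then have "2 * (n choose 2) \<le> n ^ 2" by (simp add: power2_eq_square)
  then have "real (2 * (n choose 2)) \<le> real (n ^ 2)" by (rule of_nat_mono)
  then show ?thesis by (simp add: card_all_edges)
qed

lemma has_cycle_mono: "has_cycle l F \<Longrightarrow> F \<subseteq> F' \<Longrightarrow> has_cycle l F'"
  unfolding has_cycle_def by blast

lemma cycle_ramsey_mono: "cycle_ramsey l r G \<Longrightarrow> G \<subseteq> G' \<Longrightarrow> cycle_ramsey l r G'"
  unfolding cycle_ramsey_def
proof (intro allI impI)
  fix c :: "nat set \<Rightarrow> nat"
  assume *: "\<forall>c. (\<forall>e\<in>G. c e < r) \<longrightarrow> (\<exists>k<r. has_cycle l {e \<in> G. c e = k})" "G \<subseteq> G'" "\<forall>e\<in>G'. c e < r"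
  then obtain k where k: "k < r" "has_cycle l {e \<in> G. c e = k}" by blast
  have "has_cycle l {e \<in> G'. c e = k}"
    by (rule has_cycle_mono [OF k(2)]) (use * in auto)
  with k(1) show "\<exists>k<r. has_cycle l {e \<in> G'. c e = k}" by blast
qed

section \<open>Ramsey properties of blow-ups of complete graphs\<close>

lemma sym_relpow:
  assumes "sym R" "(x, y) \<in> R ^^ k"
  shows "(y, x) \<in> R ^^ k"
  using assms(2)
proof (induction k arbitrary: y)
  case (Suc k)
  then obtain z where z: "(x, z) \<in> R ^^ k" "(z, y) \<in> R" by auto
  then have "(y, z) \<in> R" "(z, x) \<in> R ^^ k" using Suc assms(1) by (auto dest: symD)
  then show ?case by (rule relpow_Suc_I2)
qed simp

text \<open>Two-colour each component by the parity of walks from a root. An edge with equal colours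
  at its ends closes two walks from the root to an odd closed walk.\<close>

lemma bipartite_or_odd_closed_walk:
  assumes "sym R"
  shows "(\<exists>x k. odd k \<and> (x, x) \<in> R ^^ k) \<or> (\<exists>s::'a \<Rightarrow> bool. \<forall>x y. (x, y) \<in> R \<longrightarrow> s x \<noteq> s y)"
proof (rule disjCI)
  assume "\<not> (\<exists>s::'a \<Rightarrow> bool. \<forall>x y. (x, y) \<in> R \<longrightarrow> s x \<noteq> s y)"
  \<comment> \<open>The choice depends only on the set of vertices reachable from \<open>x\<close>,
    so adjacent vertices get the same root.\<close>
  define root where "root = (\<lambda>x. SOME z. (x, z) \<in> R\<^sup>*)"
  define s where "s = (\<lambda>x. \<exists>k. even k \<and> (root x, x) \<in> R ^^ k)"
  obtain x y where xy: "(x, y) \<in> R" "s x = s y"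
    using \<open>\<not> _\<close> by blast
  have yx: "(y, x) \<in> R" using xy assms by (auto dest: symD)
  have "(x, z) \<in> R\<^sup>* \<longleftrightarrow> (y, z) \<in> R\<^sup>*" for z
    using xy yx by (meson converse_rtrancl_into_rtrancl)
  then have root: "root x = root y" by (simp add: root_def)
  have "(x, root x) \<in> R\<^sup>*" unfolding root_def by (rule someI [of _ x]) simp
  then obtain k where "(x, root x) \<in> R ^^ k" using rtrancl_imp_relpow by blast
  then have k: "(root x, x) \<in> R ^^ k" by (rule sym_relpow [OF assms])
  then have k': "(root y, y) \<in> R ^^ Suc k" using xy root by auto
  have walk: "\<exists>x k. odd k \<and> (x, x) \<in> R ^^ k"
    if "(root x, x) \<in> R ^^ i" "(root x, y) \<in> R ^^ j" "even i \<longleftrightarrow> even j" for i j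
  proof -
    have "(x, y) \<in> R ^^ (i + j)"
      using relpow_trans [OF sym_relpow [OF assms that(1)] that(2)] .
    then have "(x, x) \<in> R ^^ Suc (i + j)" using yx by auto
    moreover have "odd (Suc (i + j))" using that(3) by auto
    ultimately show ?thesis by blast
  qed
  show "\<exists>x k. odd k \<and> (x, x) \<in> R ^^ k"
  proof (cases "s x")
    case True
    then obtain i j where "even i" "(root x, x) \<in> R ^^ i" "even j" "(root y, y) \<in> R ^^ j"
      using xy(2) unfolding s_def by blast
    then show ?thesis using walk root by metis
  next
    case False
    \<comment> \<open>The walk to \<open>x\<close> and its extension to \<open>y\<close> have
      consecutive lengths; if neither vertex is reached evenly, both lengths would be odd.\<close>
    then have "odd k" "odd (Suc k)" using k k' xy(2) unfolding s_def by blast+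
    then show ?thesis by simp
  qed
qed

text \<open>A shortest odd closed walk repeats no vertex: a repetition splits it into two shorter
  closed walks, one of which is odd. Irreflexivity excludes length 1.\<close>

lemma odd_closed_walk_imp_odd_cycle:
  assumes irr: "\<And>x. (x, x) \<notin> R" and walk: "\<exists>x k. odd k \<and> (x, x) \<in> R ^^ k"
  obtains k f where "odd k" "3 \<le> k" "inj_on f {..<k}" "\<And>i. i < k \<Longrightarrow> (f i, f (Suc i mod k)) \<in> R"
proof -
  define P where "P = (\<lambda>k. odd k \<and> (\<exists>x. (x, x) \<in> R ^^ k))"
  define k where "k = (LEAST k. P k)"
  have "P k" unfolding k_def by (rule LeastI_ex) (use walk in \<open>auto simp: P_def\<close>)
  then obtain x where k: "odd k" "(x, x) \<in> R ^^ k" by (auto simp: P_def)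
  have min: "\<not> P j" if "j < k" for j using that not_less_Least unfolding k_def by blast
  obtain f where f: "f 0 = x" "f k = x" "\<And>i. i < k \<Longrightarrow> (f i, f (Suc i)) \<in> R"
    using k(2) by (auto simp: relpow_fun_conv)
  have seg: "(f i, f (i + m)) \<in> R ^^ m" if "i + m \<le> k" for i m
    unfolding relpow_fun_conv
    by (rule exI [of _ "\<lambda>j. f (i + j)"]) (use that f in auto)
  have neq: "f i \<noteq> f j" if "i < j" "j < k" for i j
  proof
    assume eq: "f i = f j"
    have "(f i, f i) \<in> R ^^ (j - i)" using seg [of i "j - i"] that eq by simp
    moreover have "(x, x) \<in> R ^^ (i + (k - j))"
      using relpow_trans [of x "f i" i R x "k - j"] seg [of 0 i] seg [of j "k - j"] that f eq by simp
    moreover have "odd (j - i) \<or> odd (i + (k - j))"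
    proof (rule ccontr)
      assume "\<not> ?thesis"
      then have "even (j - i)" "even (i + (k - j))" by blast+
      then have "even ((j - i) + (i + (k - j)))" by (rule dvd_add)
      moreover have "(j - i) + (i + (k - j)) = k" using that by simp
      ultimately show False using k(1) by simp
    qed
    ultimately have "P (j - i) \<or> P (i + (k - j))" unfolding P_def by blast
    moreover have "j - i < k" "i + (k - j) < k" using that by simp_all
    ultimately show False using min by blast
  qed
  have inj: "inj_on f {..<k}"
    by (rule inj_onI) (metis lessThan_iff linorder_neqE_nat neq)
  have step: "(f i, f (Suc i mod k)) \<in> R" if "i < k" for i
    using f(3) [OF that] f(1,2) that by (cases "Suc i = k") auto
  have "k \<noteq> 1" using k(2) irr by auto
  then have "3 \<le> k" using k(1) by presburger
  then show ?thesis using that k(1) inj step by blast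
qed

text \<open>If every colour class had a bipartition \<open>s c\<close>, then the set of colours
  \<open>c\<close> with \<open>s c u\<close> would determine the vertex \<open>u\<close>, because
  the colour of an edge separates its ends. This allows only \<open>2 ^ r\<close> vertices.\<close>

lemma complete_graph_mono_odd_cycle:
  fixes \<kappa> :: "nat \<Rightarrow> nat \<Rightarrow> nat"
  assumes M: "2 ^ r < M" and sym: "\<And>u v. \<kappa> u v = \<kappa> v u"
    and col: "\<And>u v. u < M \<Longrightarrow> v < M \<Longrightarrow> u \<noteq> v \<Longrightarrow> \<kappa> u v < r"
  obtains c k f where "c < r" "odd k" "3 \<le> k" "k \<le> M" "inj_on f {..<k}"
    "\<And>i. i < k \<Longrightarrow> f i < M" "\<And>i. i < k \<Longrightarrow> \<kappa> (f i) (f (Suc i mod k)) = c"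
proof -
  define R where "R = (\<lambda>c. {(u, v). u < M \<and> v < M \<and> u \<noteq> v \<and> \<kappa> u v = c})"
  have symR: "sym (R c)" for c unfolding R_def by (rule symI) (auto simp: sym)
  have "\<exists>c<r. \<exists>x k. odd k \<and> (x, x) \<in> R c ^^ k"
  proof (rule ccontr)
    assume *: "\<not> ?thesis"
    have "\<exists>s::nat \<Rightarrow> bool. \<forall>x y. (x, y) \<in> R c \<longrightarrow> s x \<noteq> s y" if "c < r" for c
      using bipartite_or_odd_closed_walk [OF symR [of c]] * that by blast
    then obtain s :: "nat \<Rightarrow> nat \<Rightarrow> bool"
      where s: "\<And>c x y. c < r \<Longrightarrow> (x, y) \<in> R c \<Longrightarrow> s c x \<noteq> s c y" by metis
    have "inj_on (\<lambda>u. {c\<in>{..<r}. s c u}) {..<M}"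
    proof (rule inj_onI, rule ccontr)
      fix u v assume uv: "u \<in> {..<M}" "v \<in> {..<M}" "{c \<in> {..<r}. s c u} = {c \<in> {..<r}. s c v}" "u \<noteq> v"
      then have "(u, v) \<in> R (\<kappa> u v)" "\<kappa> u v < r" using col by (auto simp: R_def)
      then show False using s [of "\<kappa> u v" u v] uv(3) by auto
    qed
    then have "card {..<M} \<le> card (Pow {..<r})"
      by (rule card_inj_on_le) auto
    then show False using M by (simp add: card_Pow)
  qed
  then obtain c where c: "c < r" "\<exists>x k. odd k \<and> (x, x) \<in> R c ^^ k" by blast
  obtain k f where kf: "odd k" "3 \<le> k" "inj_on f {..<k}" "\<And>i. i < k \<Longrightarrow> (f i, f (Suc i mod k)) \<in> R c"
    using odd_closed_walk_imp_odd_cycle [of "R c"] c(2) by (auto simp: R_def)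
  have fM: "f i < M" if "i < k" for i using kf(4) [OF that] by (auto simp: R_def)
  have "card {..<k} \<le> card {..<M}"
    by (rule card_inj_on_le [OF kf(3)]) (use fM in auto)
  then have "k \<le> M" by simp
  moreover have "\<kappa> (f i) (f (Suc i mod k)) = c" if "i < k" for i
    using kf(4) [OF that] by (auto simp: R_def)
  ultimately show ?thesis using that c(1) kf fM by blast
qed

text \<open>The vertices of the blow-up are pairs \<open>(u, i)\<close> of a vertex \<open>u < M\<close> and an index \<open>i\<close>.  Two
  vertices with the same value of \<open>g\<close> are joined by a matching, all others by complete bipartite
  graphs.  Along the indices \<open>\<epsilon>\<close> the colour of an edge depends only on its two vertices and, in the
  bipartite case, on the order of the two indices.\<close>

definition homogeneous :: "(nat \<Rightarrow> nat) \<Rightarrow> ((nat \<times> nat) set \<Rightarrow> nat) \<Rightarrow> nat \<Rightarrow> nat \<Rightarrow> nat \<Rightarrow>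
    (nat \<Rightarrow> nat) \<Rightarrow> (nat \<Rightarrow> nat \<Rightarrow> nat) \<Rightarrow> bool" where
  "homogeneous g \<chi> M L t \<epsilon> \<kappa> \<longleftrightarrow>
     (\<forall>i<L. \<epsilon> i < t) \<and> (\<forall>i j. i < j \<longrightarrow> j < L \<longrightarrow> \<epsilon> i < (\<epsilon> j :: nat)) \<and>
     (\<forall>u<M. \<forall>v<M. \<forall>i j. i < j \<longrightarrow> j < L \<longrightarrow>
        (if g u = g v then \<chi> {(u, \<epsilon> i), (v, \<epsilon> i)} else \<chi> {(u, \<epsilon> i), (v, \<epsilon> j)}) = \<kappa> u v)"

text \<open>Ramsey's theorem for pairs of indices: a pair \<open>a < b\<close> receives as its
  colour the whole finite table \<open>code a b\<close> of values of \<open>\<chi>\<close> between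
  the copies with index \<open>a\<close> and those with index \<open>b\<close>. A homogeneous index
  set has one table for all pairs.\<close>

lemma homogeneous_indices:
  fixes g :: "nat \<Rightarrow> nat" and L :: nat
  shows "\<exists>t. \<forall>\<chi>::(nat \<times> nat) set \<Rightarrow> nat. (\<forall>e. \<chi> e < r) \<longrightarrow>
    (\<exists>\<epsilon> \<kappa>. homogeneous g \<chi> M L t \<epsilon> \<kappa>)"
proof -
  define \<Phi> where "\<Phi> = ({..<M} \<times> {..<M}) \<rightarrow>\<^sub>E {..<r}"
  have "finite \<Phi>" unfolding \<Phi>_def by (intro finite_PiE) auto
  then obtain h where h: "bij_betw h \<Phi> {0..<card \<Phi>}" using ex_bij_betw_finite_nat by blast
  obtain N :: nat where N: "partn_lst {..<N} (replicate (card \<Phi>) L) 2" using ramsey_full by blast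
  show ?thesis
  proof (rule exI [of _ N], intro allI impI)
    fix \<chi> :: "(nat \<times> nat) set \<Rightarrow> nat" assume \<chi>: "\<forall>e. \<chi> e < r"
    define code where "code = (\<lambda>a b. restrict (\<lambda>(u, v). if g u = g v then \<chi> {(u, a), (v, a)}
        else \<chi> {(u, a), (v, b)}) ({..<M} \<times> {..<M}))"
    have code: "code a b \<in> \<Phi>" for a b using \<chi> by (auto simp: code_def \<Phi>_def PiE_iff)
    define F where "F = (\<lambda>e. h (code (Min e) (Max e)))"
    have "F \<in> nsets {..<N} 2 \<rightarrow> {..<card \<Phi>}"
      using bij_betw_apply [OF h code] by (auto simp: F_def)
    then obtain k H where k: "k < card \<Phi>" and H: "H \<in> nsets {..<N} L"
      and FH: "F ` nsets H 2 \<subseteq> {k}"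
      using N unfolding partn_lst_def monochromatic_def by fastforce
    have finH: "finite H" "card H = L" "H \<subseteq> {..<N}" using H by (auto simp: nsets_def)
    define \<epsilon> where "\<epsilon> = (\<lambda>i. sorted_list_of_set H ! i)"
    have len: "length (sorted_list_of_set H) = L" using finH by simp
    have mem: "\<epsilon> i \<in> H" if "i < L" for i
      using nth_mem [of i "sorted_list_of_set H"] that len finH by (simp add: \<epsilon>_def)
    have less: "\<epsilon> i < \<epsilon> j" if "i < j" "j < L" for i j
      using strict_sorted_list_of_set [of H] that len unfolding \<epsilon>_def
      by (meson sorted_wrt_nth_less)
    have key: "code (\<epsilon> i) (\<epsilon> j) = inv_into \<Phi> h k" if "i < j" "j < L" for i j
    proof -
      have "{\<epsilon> i, \<epsilon> j} \<in> nsets H 2" using mem [of i] mem [of j] less [of i j] that by auto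
      then have "F {\<epsilon> i, \<epsilon> j} = k" using FH by blast
      then have "h (code (\<epsilon> i) (\<epsilon> j)) = k" using less [OF that] by (simp add: F_def)
      then show ?thesis using h code by (metis bij_betw_inv_into_left)
    qed
    show "\<exists>\<epsilon> \<kappa>. homogeneous g \<chi> M L N \<epsilon> \<kappa>"
      unfolding homogeneous_def
    proof (rule exI [of _ \<epsilon>], rule exI [of _ "\<lambda>u v. inv_into \<Phi> h k (u, v)"], intro conjI allI impI)
      fix u v i j assume *: "u < M" "v < M" "i < j" "j < L"
      have "code (\<epsilon> i) (\<epsilon> j) (u, v) = inv_into \<Phi> h k (u, v)" using key * by simp
      then show "(if g u = g v then \<chi> {(u, \<epsilon> i), (v, \<epsilon> i)} else \<chi> {(u, \<epsilon> i), (v, \<epsilon> j)}) = inv_into \<Phi> h k (u, v)"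
        using * by (simp add: code_def)
    qed (use less mem finH in auto)
  qed
qed

text \<open>The hypothesis \<open>grp\<close> says that at most two vertices share a value of
  \<open>g\<close>. Hence among three consecutive vertices of the odd cycle some consecutive pair is
  complete bipartite, which is where the cycle can be lengthened.\<close>

lemma blowup_ramsey:
  fixes g :: "nat \<Rightarrow> nat"
  assumes l: "odd l" "2 ^ r + 1 \<le> l" and M: "M = 2 ^ r + 1"
    and gM: "\<And>u. u < M \<Longrightarrow> g u < M"
    and grp: "\<And>u v w. \<lbrakk>u < M; v < M; w < M; u \<noteq> v; v \<noteq> w; u \<noteq> w\<rbrakk> \<Longrightarrow> \<not> (g u = g v \<and> g v = g w)"
  shows "\<exists>t. \<forall>\<chi>::(nat \<times> nat) set \<Rightarrow> nat. (\<forall>e. \<chi> e < r) \<longrightarrow>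
    (\<exists>c<r. \<exists>\<tau> \<alpha>. inj_on (\<lambda>j. (\<tau> j, \<alpha> j)) {..<l} \<and>
      (\<forall>j<l. \<tau> j < M \<and> \<alpha> j < t \<and> \<tau> j \<noteq> \<tau> (Suc j mod l) \<and>
         (g (\<tau> j) = g (\<tau> (Suc j mod l)) \<longrightarrow> \<alpha> j = \<alpha> (Suc j mod l)) \<and>
         \<chi> {(\<tau> j, \<alpha> j), (\<tau> (Suc j mod l), \<alpha> (Suc j mod l))} = c))"
proof -
  \<comment> \<open>One block of \<open>l\<close> indices for each value of \<open>g\<close>; the
    extra index \<open>M * l\<close> is the larger partner needed to read off the colour of a
    matching edge in \<open>eqK\<close>.\<close>
  obtain t where t: "\<And>\<chi>. (\<forall>e. \<chi> e < r) \<Longrightarrow> \<exists>\<epsilon> \<kappa>. homogeneous g \<chi> M (Suc (M * l)) t \<epsilon> \<kappa>"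
    using homogeneous_indices by blast
  show ?thesis
  proof (rule exI [of _ t], intro allI impI)
    fix \<chi> :: "(nat \<times> nat) set \<Rightarrow> nat" assume \<chi>: "\<forall>e. \<chi> e < r"
    obtain \<epsilon> \<kappa> where hom: "homogeneous g \<chi> M (Suc (M * l)) t \<epsilon> \<kappa>"
      using t [OF \<chi>] by blast
    have \<epsilon>: "\<epsilon> i < t" if "i < Suc (M * l)" for i
      using hom that by (simp add: homogeneous_def)
    have mono: "\<epsilon> i < \<epsilon> j" if "i < j" "j < Suc (M * l)" for i j
      using hom that by (simp add: homogeneous_def)
    have \<kappa>: "(if g u = g v then \<chi> {(u, \<epsilon> i), (v, \<epsilon> i)} else \<chi> {(u, \<epsilon> i), (v, \<epsilon> j)}) = \<kappa> u v"
      if "u < M" "v < M" "i < j" "j < Suc (M * l)" for u v i j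
      using hom that by (simp add: homogeneous_def)
    define K where "K = (\<lambda>u v. if u < M \<and> v < M then if g u \<le> g v then \<kappa> u v else \<kappa> v u else 0)"
    \<comment> \<open>Disjoint blocks of indices, ordered like the values of \<open>g\<close>: this removes the dependence on
      the order of the indices.\<close>
    define pos where "pos = (\<lambda>u i. g u * l + i)"
    have pos: "pos u i < M * l" if "u < M" "i < l" for u i
    proof -
      have "g u * l + i < Suc (g u) * l" using that by simp
      also have "\<dots> \<le> M * l" using gM [OF that(1)] by (intro mult_le_mono1) simp
      finally show ?thesis by (simp add: pos_def)
    qed
    have l0: "0 < l" using l by (cases l) auto
    have eqK: "\<chi> {(u, \<epsilon> (pos u i)), (v, \<epsilon> (pos v i))} = \<kappa> u v"
      if "u < M" "v < M" "g u = g v" "i < l" for u v i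
      using \<kappa> [of u v "pos u i" "M * l"] that pos [of u i] by (simp add: pos_def)
    have symK: "K u v = K v u" for u v
    proof (cases "u < M \<and> v < M \<and> g u = g v")
      case True
      then have "\<kappa> u v = \<kappa> v u"
        using eqK [of u v 0] eqK [of v u 0] l0 by (simp add: insert_commute)
      then show ?thesis by (simp add: K_def)
    qed (auto simp: K_def)
    have colK': "\<chi> {(u, \<epsilon> (pos u i)), (v, \<epsilon> (pos v j))} = K u v"
      if "u < M" "v < M" "g u < g v" "i < l" "j < l" for u v i j
    proof -
      have "pos u i < Suc (g u) * l" using that by (simp add: pos_def)
      also have "\<dots> \<le> g v * l" using that by (intro mult_le_mono1) simp
      finally have "pos u i < pos v j" by (simp add: pos_def)
      then show ?thesis using \<kappa> [of u v "pos u i" "pos v j"] that pos [of v j] by (simp add: K_def)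
    qed
    have colK: "\<chi> {(u, \<epsilon> (pos u i)), (v, \<epsilon> (pos v j))} = K u v"
      if "u < M" "v < M" "g u = g v \<longrightarrow> i = j" "i < l" "j < l" for u v i j
    proof (cases "g u" "g v" rule: linorder_cases)
      case equal
      then show ?thesis using eqK [of u v i] that by (simp add: K_def)
    next
      case less
      then show ?thesis using colK' that by simp
    next
      case greater
      then show ?thesis using colK' [of v u j i] that symK [of u v] by (simp add: insert_commute)
    qed
    have Kr: "K u v < r" if "u < M" "v < M" "u \<noteq> v" for u v
    proof -
      have "K u v = \<chi> {(u, \<epsilon> (pos u 0)), (v, \<epsilon> (pos v 0))}" using colK that l0 by simp
      then show ?thesis using \<chi> by simp
    qed
    have "2 ^ r < M" using M by simp
    from complete_graph_mono_odd_cycle [of r M K, OF this symK Kr]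
    obtain c k f where c: "c < r" and k: "odd k" "3 \<le> k" "k \<le> M" and f: "inj_on f {..<k}"
      "\<And>i. i < k \<Longrightarrow> f i < M" "\<And>i. i < k \<Longrightarrow> K (f i) (f (Suc i mod k)) = c"
      by blast
    have kl: "k \<le> l" using k l M by simp
    have finj: "f i = f j \<longleftrightarrow> i = j" if "i < k" "j < k" for i j
      using f(1) that by (auto simp: inj_on_def)
    \<comment> \<open>Going back and forth across a complete bipartite pair of the odd cycle lengthens it to \<open>l\<close>.\<close>
    obtain p where p: "p < 2" "g (f p) \<noteq> g (f (Suc p))"
    proof (rule ccontr)
      assume *: "\<not> thesis"
      then have "g (f 0) = g (f 1)" "g (f 1) = g (f 2)"
        using that [of 0] that [of 1] by (auto simp: numeral_2_eq_2)
      moreover have "0 < k" "1 < k" "2 < k" using k by auto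
      ultimately show False using grp [of "f 0" "f 1" "f 2"] f(2) finj by auto
    qed
    \<comment> \<open>Rotate the cycle so that the complete bipartite pair occupies its last two
      positions \<open>k - 2\<close> and \<open>k - 1\<close>.\<close>
    define F where "F = (\<lambda>i. f ((i + (p + 2)) mod k))"
    have k0: "0 < k" using k by simp
    have Fne: "F i \<noteq> F j" if "i < j" "j < k" for i j
    proof
      assume "F i = F j"
      then have "(j + (p + 2)) mod k = (i + (p + 2)) mod k"
        unfolding F_def using finj k0 by simp
      then have "k dvd (j + (p + 2)) - (i + (p + 2))"
        using that by (subst (asm) mod_eq_dvd_iff_nat) auto
      then have "k dvd j - i" by simp
      then show False using that by (auto dest!: dvd_imp_le)
    qed
    have Finj: "F i = F j \<longleftrightarrow> i = j" if "i < k" "j < k" for i j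
      using Fne [of i j] Fne [of j i] that by (metis linorder_neqE_nat)
    have FM: "F i < M" for i unfolding F_def using f(2) k0 by simp
    have FK: "K (F i) (F (Suc i mod k)) = c" for i
    proof -
      have "Suc ((i + (p + 2)) mod k) mod k = (Suc i mod k + (p + 2)) mod k"
        by (metis add_Suc mod_Suc_eq mod_add_left_eq)
      then show ?thesis unfolding F_def using f(3) [of "(i + (p + 2)) mod k"] k0 by simp
    qed
    have Fend: "F (k - 2) = f p" "F (k - 1) = f (Suc p)"
    proof -
      have "k - 2 + (p + 2) = p + k" "k - 1 + (p + 2) = Suc p + k" using k by simp_all
      then have "F (k - 2) = f ((p + k) mod k)" "F (k - 1) = f ((Suc p + k) mod k)"
        unfolding F_def by (simp_all only:)
      moreover have "Suc p < k" using p k by simp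
      ultimately show "F (k - 2) = f p" "F (k - 1) = f (Suc p)" by (simp_all only: mod_add_self2 mod_less Suc_lessD)
    qed
    define A where "A = F (k - 1)"
    define B where "B = F (k - 2)"
    have gAB: "g A \<noteq> g B" using p Fend by (simp add: A_def B_def)
    have AB: "K A B = c" "K B A = c"
    proof -
      have "Suc (k - 2) mod k = k - 1" using k by simp
      then show "K B A = c" using FK [of "k - 2"] by (simp add: A_def B_def)
      then show "K A B = c" using symK by simp
    qed
    define \<tau> where "\<tau> = (\<lambda>j. if j < k - 1 then F j else if even (j - (k - 1)) then A else B)"
    \<comment> \<open>Fresh indices keep the repeated visits to \<open>A\<close> and
      \<open>B\<close> distinct. The last position returns to index 0, because the closing edge to
      \<open>F 0\<close> may be a matching edge and then needs equal indices. That the last position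
      is \<open>A\<close> uses that \<open>l - k\<close> is even.\<close>
    define \<iota> where "\<iota> = (\<lambda>j. if j < k - 1 \<or> j = l - 1 then 0 else (j - (k - 1)) div 2 + 1)"
    have \<iota>l: "\<iota> j < l" if "j < l" for j
      using that k kl by (auto simp: \<iota>_def)
    have \<tau>M: "\<tau> j < M" for j by (auto simp: \<tau>_def A_def B_def FM)
    have last: "\<tau> (l - 1) = A"
    proof -
      have "l - 1 - (k - 1) = l - k" using k by simp
      then show ?thesis using k l(1) kl by (auto simp: \<tau>_def)
    qed
    have \<tau>F: "\<tau> j = F j" if "j \<le> k - 1" for j
      using that by (auto simp: \<tau>_def A_def le_less)
    have edge: "\<tau> j \<noteq> \<tau> (Suc j mod l) \<and> K (\<tau> j) (\<tau> (Suc j mod l)) = c \<and>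
        (g (\<tau> j) = g (\<tau> (Suc j mod l)) \<longrightarrow> \<iota> j = \<iota> (Suc j mod l))" if "j < l" for j
    proof -
      consider "j < k - 2" | "j = k - 2" | "k - 2 < j" "j < l - 1" | "j = l - 1" "k - 2 < j"
        using \<open>j < l\<close> by linarith
      then show ?thesis
      proof cases
        case 1
        then have *: "Suc j mod l = Suc j" "Suc j mod k = Suc j" "\<tau> j = F j" "\<tau> (Suc j) = F (Suc j)"
          using kl \<tau>F by auto
        moreover have "\<iota> j = 0" "\<iota> (Suc j) = 0" using 1 by (auto simp: \<iota>_def)
        ultimately show ?thesis using FK [of j] Finj [of j "Suc j"] 1 by simp
      next
        case 2
        then have "Suc j mod l = Suc j mod l" "\<tau> j = B" using \<tau>F [of j] k by (auto simp: B_def)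
        moreover have "\<tau> (Suc j mod l) = A"
        proof -
          have "Suc j = k - 1" using 2 k by simp
          then have "Suc j mod l = k - 1" using kl k by simp
          then show ?thesis using \<tau>F by (simp add: A_def)
        qed
        ultimately show ?thesis using gAB AB by auto
      next
        case 3
        then have "Suc j mod l = Suc j" by simp
        moreover have "Suc j - (k - 1) = Suc (j - (k - 1))" using 3 by simp
        ultimately have "\<tau> j = A \<and> \<tau> (Suc j mod l) = B \<or> \<tau> j = B \<and> \<tau> (Suc j mod l) = A"
          using 3 by (auto simp: \<tau>_def)
        then show ?thesis using gAB AB by auto
      next
        case 4
        then have "Suc j mod l = 0" "\<tau> j = F (k - 1)" "\<tau> 0 = F 0" "\<iota> j = 0" "\<iota> 0 = 0"
          using l0 last \<tau>F [of 0] k by (auto simp: A_def \<iota>_def)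
        moreover have "Suc (k - 1) mod k = 0" using k0 by simp
        ultimately show ?thesis using FK [of "k - 1"] Finj [of "k - 1" 0] k by simp
      qed
    qed
    have inj: "inj_on (\<lambda>j. (\<tau> j, \<iota> j)) {..<l}"
    proof -
      have ne: "(\<tau> i, \<iota> i) \<noteq> (\<tau> j, \<iota> j)" if "i < j" "j < l" for i j
      proof
        assume eq: "(\<tau> i, \<iota> i) = (\<tau> j, \<iota> j)"
        consider "j < k - 1" | "j = l - 1" "i < k - 1" "k - 1 \<le> j" | "k - 1 \<le> j" "j < l - 1" "i < k - 1"
          | "j = l - 1" "k - 1 \<le> i" | "k - 1 \<le> i" "j < l - 1"
          using \<open>j < l\<close> by linarith
        then show False
        proof cases
          case 1
          then show ?thesis using eq \<tau>F [of i] \<tau>F [of j] Finj [of i j] that by simp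
        next
          case 2
          then have "\<tau> i = F i" "\<tau> j = F (k - 1)" using \<tau>F [of i] last by (simp_all add: A_def)
          then show ?thesis using eq Fne [of i "k - 1"] 2 k0 by simp
        next
          case 3
          then show ?thesis using eq by (simp add: \<iota>_def)
        next
          case 4
          then show ?thesis using eq that by (simp add: \<iota>_def)
        next
          case 5
          have "A \<noteq> B" using gAB by auto
          then have par: "even (i - (k - 1)) \<longleftrightarrow> even (j - (k - 1))"
            using eq 5 that by (auto simp: \<tau>_def split: if_splits)
          have "(i - (k - 1)) div 2 = (j - (k - 1)) div 2" using eq 5 that by (simp add: \<iota>_def)
          then have "i - (k - 1) = j - (k - 1)"
            using par by (metis even_two_times_div_two odd_two_times_div_two_succ)
          then show ?thesis using 5 that by simp
        qed
      qed
      show ?thesis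
        by (rule inj_onI) (metis lessThan_iff linorder_neqE_nat ne)
    qed
    define \<alpha> where "\<alpha> = (\<lambda>j. \<epsilon> (pos (\<tau> j) (\<iota> j)))"
    have \<epsilon>inj: "\<epsilon> i = \<epsilon> j \<longleftrightarrow> i = j" if "i < M * l" "j < M * l" for i j
      using mono [of i j] mono [of j i] that by (metis less_SucI less_irrefl linorder_neqE_nat)
    have \<alpha>inj: "inj_on (\<lambda>j. (\<tau> j, \<alpha> j)) {..<l}"
    proof (rule inj_onI)
      fix i j assume *: "i \<in> {..<l}" "j \<in> {..<l}" "(\<tau> i, \<alpha> i) = (\<tau> j, \<alpha> j)"
      then have "pos (\<tau> i) (\<iota> i) = pos (\<tau> j) (\<iota> j)" "\<tau> i = \<tau> j"
        using \<epsilon>inj pos \<tau>M \<iota>l by (auto simp: \<alpha>_def)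
      then have "(\<tau> i, \<iota> i) = (\<tau> j, \<iota> j)" by (simp add: pos_def)
      then show "i = j" using inj * by (auto simp: inj_on_def)
    qed
    have \<alpha>t: "\<alpha> j < t" if "j < l" for j
      unfolding \<alpha>_def by (rule \<epsilon>) (use pos [OF \<tau>M \<iota>l [OF that]] less_SucI in blast)
    have \<alpha>g: "g (\<tau> j) = g (\<tau> (Suc j mod l)) \<longrightarrow> \<alpha> j = \<alpha> (Suc j mod l)" if "j < l" for j
      using edge [OF that] unfolding \<alpha>_def pos_def by metis
    have \<alpha>c: "\<chi> {(\<tau> j, \<alpha> j), (\<tau> (Suc j mod l), \<alpha> (Suc j mod l))} = c" if "j < l" for j
    proof -
      have "\<iota> j < l" "\<iota> (Suc j mod l) < l" using \<iota>l l0 that by simp_all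
      then have "\<chi> {(\<tau> j, \<alpha> j), (\<tau> (Suc j mod l), \<alpha> (Suc j mod l))} = K (\<tau> j) (\<tau> (Suc j mod l))"
        unfolding \<alpha>_def using edge [OF that] by (intro colK \<tau>M) blast+
      then show ?thesis using edge [OF that] by blast
    qed
    show "\<exists>c<r. \<exists>\<tau> \<alpha>. inj_on (\<lambda>j. (\<tau> j, \<alpha> j)) {..<l} \<and>
      (\<forall>j<l. \<tau> j < M \<and> \<alpha> j < t \<and> \<tau> j \<noteq> \<tau> (Suc j mod l) \<and>
         (g (\<tau> j) = g (\<tau> (Suc j mod l)) \<longrightarrow> \<alpha> j = \<alpha> (Suc j mod l)) \<and>
         \<chi> {(\<tau> j, \<alpha> j), (\<tau> (Suc j mod l), \<alpha> (Suc j mod l))} = c)"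
      by (rule exI [of _ c], rule conjI [OF c], rule exI [of _ \<tau>], rule exI [of _ \<alpha>], rule conjI [OF \<alpha>inj])
        (use \<tau>M \<alpha>t \<alpha>g \<alpha>c edge in simp)
  qed
qed

text \<open>Pull the colouring of \<open>G\<close> back along the embedding \<open>\<phi>\<close>
  and push the cycle forward. The index bound \<open>t\<close> depends on neither the graph nor the
  embedding.\<close>

lemma blowup_cycle_ramsey:
  fixes g :: "nat \<Rightarrow> nat"
  assumes l: "odd l" "2 ^ r + 1 \<le> l" and M: "M = 2 ^ r + 1" and r: "0 < r"
    and gM: "\<And>u. u < M \<Longrightarrow> g u < M"
    and grp: "\<And>u v w. \<lbrakk>u < M; v < M; w < M; u \<noteq> v; v \<noteq> w; u \<noteq> w\<rbrakk> \<Longrightarrow> \<not> (g u = g v \<and> g v = g w)"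
  shows "\<exists>t::nat. \<forall>G \<phi>. inj_on \<phi> ({..<M} \<times> {..<t}) \<longrightarrow>
    (\<forall>u v a b. u < M \<longrightarrow> v < M \<longrightarrow> a < t \<longrightarrow> b < t \<longrightarrow> u \<noteq> v \<longrightarrow> (g u = g v \<longrightarrow> a = b) \<longrightarrow>
      {\<phi> (u, a), \<phi> (v, b)} \<in> G) \<longrightarrow> cycle_ramsey l r G"
proof -
  obtain t where t: "\<And>\<chi>::(nat \<times> nat) set \<Rightarrow> nat. (\<forall>e. \<chi> e < r) \<Longrightarrow>
    (\<exists>c<r. \<exists>\<tau> \<alpha>. inj_on (\<lambda>j. (\<tau> j, \<alpha> j)) {..<l} \<and>
      (\<forall>j<l. \<tau> j < M \<and> \<alpha> j < t \<and> \<tau> j \<noteq> \<tau> (Suc j mod l) \<and>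
         (g (\<tau> j) = g (\<tau> (Suc j mod l)) \<longrightarrow> \<alpha> j = \<alpha> (Suc j mod l)) \<and>
         \<chi> {(\<tau> j, \<alpha> j), (\<tau> (Suc j mod l), \<alpha> (Suc j mod l))} = c))"
    using blowup_ramsey [of l r M g, OF l M gM grp] by blast
  show ?thesis
  proof (rule exI [of _ t], intro allI impI)
    fix G and \<phi> :: "nat \<times> nat \<Rightarrow> nat"
    assume inj: "inj_on \<phi> ({..<M} \<times> {..<t})"
      and G: "\<forall>u v a b. u < M \<longrightarrow> v < M \<longrightarrow> a < t \<longrightarrow> b < t \<longrightarrow> u \<noteq> v \<longrightarrow> (g u = g v \<longrightarrow> a = b) \<longrightarrow>
        {\<phi> (u, a), \<phi> (v, b)} \<in> G"
    show "cycle_ramsey l r G"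
      unfolding cycle_ramsey_def
    proof (intro allI impI)
      fix col :: "nat set \<Rightarrow> nat" assume col: "\<forall>e\<in>G. col e < r"
      \<comment> \<open>Pairs that are not mapped to edges of \<open>G\<close> get the dummy colour
        0, so that \<open>\<chi>\<close> is a total colouring with \<open>r\<close> colours; the
        cycle found below uses only edges of \<open>G\<close>.\<close>
      define \<chi> where "\<chi> = (\<lambda>e. if \<phi> ` e \<in> G then col (\<phi> ` e) else 0)"
      have "\<forall>e. \<chi> e < r" using col r by (auto simp: \<chi>_def)
      from t [OF this] obtain c \<tau> \<alpha> where c: "c < r" and
        \<tau>inj: "inj_on (\<lambda>j. (\<tau> j, \<alpha> j)) {..<l}" and
        E: "\<And>j. j < l \<Longrightarrow> \<tau> j < M \<and> \<alpha> j < t \<and> \<tau> j \<noteq> \<tau> (Suc j mod l) \<and>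
         (g (\<tau> j) = g (\<tau> (Suc j mod l)) \<longrightarrow> \<alpha> j = \<alpha> (Suc j mod l)) \<and>
         \<chi> {(\<tau> j, \<alpha> j), (\<tau> (Suc j mod l), \<alpha> (Suc j mod l))} = c" by blast
      define f where "f = (\<lambda>j. \<phi> (\<tau> j, \<alpha> j))"
      have bd: "\<tau> j < M \<and> \<alpha> j < t" if "j < l" for j using E [OF that] by blast
      have "inj_on f {..<l}"
      proof (rule inj_onI)
        fix i j assume *: "i \<in> {..<l}" "j \<in> {..<l}" "f i = f j"
        have "\<phi> (\<tau> i, \<alpha> i) = \<phi> (\<tau> j, \<alpha> j)" using *(3) by (simp only: f_def)
        moreover have "(\<tau> i, \<alpha> i) \<in> {..<M} \<times> {..<t}" "(\<tau> j, \<alpha> j) \<in> {..<M} \<times> {..<t}"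
          using bd *(1,2) by blast+
        ultimately have "(\<tau> i, \<alpha> i) = (\<tau> j, \<alpha> j)" by (rule inj_onD [OF inj])
        then show "i = j" by (intro inj_onD [OF \<tau>inj _ *(1,2)]) simp
      qed
      moreover have "{f j, f (Suc j mod l)} \<in> {e\<in>G. col e = c}" if "j < l" for j
      proof -
        have "Suc j mod l < l" using that by simp
        then have "{f j, f (Suc j mod l)} \<in> G"
          unfolding f_def using G [THEN spec, of "\<tau> j", THEN spec, of "\<tau> (Suc j mod l)",
              THEN spec, of "\<alpha> j", THEN spec, of "\<alpha> (Suc j mod l)"] E [OF that] bd [of "Suc j mod l"] by blast
        moreover have "\<chi> {(\<tau> j, \<alpha> j), (\<tau> (Suc j mod l), \<alpha> (Suc j mod l))} = c"
          using E [OF that] by blast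
        ultimately show ?thesis unfolding \<chi>_def f_def image_insert image_empty by (simp split: if_splits)
      qed
      ultimately show "\<exists>k<r. has_cycle l {e \<in> G. col e = k}"
        using c unfolding has_cycle_def by blast
    qed
  qed
qed

text \<open>With the identity as \<open>g\<close> all pairs of classes are complete bipartite; the
  pairs \<open>(u, a)\<close> are encoded as numbers \<open>u * t + a\<close>.\<close>

lemma complete_graph_cycle_ramsey:
  assumes "odd l" "2 ^ r + 1 \<le> l" "0 < r"
  shows "\<exists>N. cycle_ramsey l r (all_edges N)"
proof -
  define M :: nat where "M = 2 ^ r + 1"
  obtain t :: nat where t: "\<forall>G \<phi>. inj_on \<phi> ({..<M} \<times> {..<t}) \<longrightarrow>
    (\<forall>u v a b. u < M \<longrightarrow> v < M \<longrightarrow> a < t \<longrightarrow> b < t \<longrightarrow> u \<noteq> v \<longrightarrow> (u = v \<longrightarrow> a = b) \<longrightarrow>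
      {\<phi> (u, a), \<phi> (v, b)} \<in> G) \<longrightarrow> cycle_ramsey l r G"
    using blowup_cycle_ramsey [OF assms(1,2) M_def assms(3), of "\<lambda>u. u"] by blast
  have code: "u * t + a < M * t" if "u < M" "a < t" for u a
  proof -
    have "u * t + a < Suc u * t" using that by simp
    also have "\<dots> \<le> M * t" using that by (intro mult_le_mono1) simp
    finally show ?thesis .
  qed
  have inj: "u = v \<and> a = b" if "u * t + a = v * t + b" "a < t" "b < t" for u v a b
  proof -
    have "u = (u * t + a) div t" using that(2) by simp
    also have "\<dots> = (v * t + b) div t" using that(1) by simp
    also have "\<dots> = v" using that(3) by simp
    finally have "u = v" .
    then show ?thesis using that(1) by (simp only: add_left_cancel simp_thms)
  qed
  have "cycle_ramsey l r (all_edges (M * t))"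
  proof (rule t [THEN spec, of "all_edges (M * t)", THEN spec, of "\<lambda>x. fst x * t + snd x", THEN mp, THEN mp])
    show "inj_on (\<lambda>x. fst x * t + snd x) ({..<M} \<times> {..<t})"
      by (rule inj_onI) (metis inj lessThan_iff mem_Times_iff prod.collapse)
    show "\<forall>u v a b. u < M \<longrightarrow> v < M \<longrightarrow> a < t \<longrightarrow> b < t \<longrightarrow> u \<noteq> v \<longrightarrow> (u = v \<longrightarrow> a = b) \<longrightarrow>
        {fst (u, a) * t + snd (u, a), fst (v, b) * t + snd (v, b)} \<in> all_edges (M * t)"
    proof (intro allI impI)
      fix u v a b assume *: "u < M" "v < M" "a < t" "b < t" "u \<noteq> v"
      then have "u * t + a \<noteq> v * t + b" using inj by blast
      then show "{fst (u, a) * t + snd (u, a), fst (v, b) * t + snd (v, b)} \<in> all_edges (M * t)"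
        using code [of u a] code [of v b] * unfolding all_edges_def by auto
    qed
  qed
  then show ?thesis by blast
qed

section \<open>Blow-ups in dense graphs\<close>

text \<open>Take \<open>U\<close> maximizing the degree sum minus
  \<open>a * card U * (card U + 1)\<close>. Removing \<open>x\<close> changes the first term by
  twice the degree of \<open>x\<close> and the second by \<open>2 * a * card U\<close>, so
  maximality gives the minimum degree. The value at \<open>V\<close> bounds the size of
  \<open>U\<close> from below.\<close>

lemma dense_core:
  fixes adj :: "'a \<Rightarrow> 'a \<Rightarrow> bool" and a \<gamma> :: real
  defines "d \<equiv> \<lambda>U x. real (card {y\<in>U. adj x y})"
  assumes fin: "finite V" and sym: "\<And>x y. adj x y \<longleftrightarrow> adj y x" and irr: "\<And>x. \<not> adj x x"
    and dens: "a * card V * (card V + 1) + \<gamma> * card V ^ 2 \<le> (\<Sum>x\<in>V. d V x)"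
    and a: "0 \<le> a"
  obtains U where "U \<subseteq> V" "\<gamma> * card V ^ 2 \<le> real (card U) ^ 2" "\<And>x. x \<in> U \<Longrightarrow> a * card U \<le> d U x"
proof -
  define \<phi> where "\<phi> = (\<lambda>U. (\<Sum>x\<in>U. d U x) - a * card U * (card U + 1))"
  have "finite (\<phi> ` Pow V)" "\<phi> ` Pow V \<noteq> {}" using fin by auto
  then have "Max (\<phi> ` Pow V) \<in> \<phi> ` Pow V" by (rule Max_in)
  then obtain U where U: "U \<subseteq> V" "\<phi> U = Max (\<phi> ` Pow V)" by auto
  have max: "\<phi> W \<le> \<phi> U" if "W \<subseteq> V" for W
    unfolding U(2) using that fin by (intro Max_ge) auto
  have finU: "finite U" using U fin finite_subset by blast
  have dU: "d U x \<le> card U" for x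
    unfolding d_def by (simp add: card_mono finU)
  have "\<gamma> * card V ^ 2 \<le> \<phi> V" using dens by (simp add: \<phi>_def)
  also have "\<phi> V \<le> \<phi> U" by (rule max) simp
  also have "\<phi> U \<le> (\<Sum>x\<in>U. d U x)" using a by (simp add: \<phi>_def)
  also have "\<dots> \<le> (\<Sum>x\<in>U. real (card U))" by (intro sum_mono dU)
  also have "\<dots> = real (card U) ^ 2" by (simp add: power2_eq_square)
  finally have size: "\<gamma> * card V ^ 2 \<le> real (card U) ^ 2" .
  have "a * card U \<le> d U x" if x: "x \<in> U" for x
  proof -
    have card: "real (card U) = real (card (U - {x})) + 1"
      using x finU card_gt_0_iff [of U] by (auto simp: card_Diff_singleton of_nat_diff Suc_leI)
    have "d U y = d (U - {x}) y + (if adj x y then 1 else 0)" if "y \<in> U - {x}" for y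
    proof -
      have "{z\<in>U. adj y z} = (if adj x y then insert x {z\<in>U - {x}. adj y z} else {z\<in>U - {x}. adj y z})"
        using x sym by auto
      then show ?thesis using finU by (auto simp: d_def)
    qed
    then have "(\<Sum>y\<in>U - {x}. d U y) = (\<Sum>y\<in>U - {x}. d (U - {x}) y + (if adj x y then 1 else 0))"
      by (rule sum.cong [OF refl])
    also have "\<dots> = (\<Sum>y\<in>U - {x}. d (U - {x}) y) + card {y\<in>U - {x}. adj x y}"
      using finU by (simp add: sum.distrib sum.If_cases Int_def)
    also have "{y\<in>U - {x}. adj x y} = {y\<in>U. adj x y}" using irr by auto
    finally have "(\<Sum>y\<in>U. d U y) = (\<Sum>y\<in>U - {x}. d (U - {x}) y) + 2 * d U x"
      using sum.remove [OF finU x, of "d U"] by (simp add: d_def)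
    moreover have "\<phi> (U - {x}) \<le> \<phi> U" by (rule max) (use U in auto)
    ultimately have "a * (card U * (card U + 1)) - a * ((real (card U) - 1) * card U) \<le> 2 * d U x"
      by (simp add: \<phi>_def card algebra_simps)
    then have "2 * (a * card U) \<le> 2 * d U x" by (simp add: algebra_simps)
    then show ?thesis by simp
  qed
  then show ?thesis using that U size by blast
qed

definition clique_lists :: "('a \<Rightarrow> 'a \<Rightarrow> bool) \<Rightarrow> 'a set \<Rightarrow> nat \<Rightarrow> 'a list set" where
  "clique_lists adj U k = {xs. length xs = k \<and> set xs \<subseteq> U \<and> sorted_wrt adj xs}"

lemma finite_clique_lists: "finite U \<Longrightarrow> finite (clique_lists adj U k)"
  unfolding clique_lists_def
  by (rule finite_subset [OF _ finite_lists_length_eq [of U k]]) auto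

text \<open>Greedy extension: each of the at most \<open>k\<close> vertices chosen so far excludes
  at most \<open>(1 - a) * card U\<close> candidates, which leaves at least
  \<open>\<beta> * card U\<close>.\<close>

lemma clique_lists_count:
  fixes a \<beta> :: real
  assumes fin: "finite U" and deg: "\<And>x. x \<in> U \<Longrightarrow> a * card U \<le> card {y\<in>U. adj x y}"
    and sym: "\<And>x y. adj x y \<longleftrightarrow> adj y x"
    and \<beta>: "0 \<le> \<beta>" "k * (1 - a) \<le> 1 - \<beta>" "a \<le> 1" and "j \<le> Suc k"
  shows "(\<beta> * card U) ^ j \<le> card (clique_lists adj U j)"
  using \<open>j \<le> Suc k\<close>
proof (induction j)
  case 0
  have "clique_lists adj U 0 = {[]}" by (auto simp: clique_lists_def)
  then show ?case by simp
next
  case (Suc j)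
  define E where "E = (\<lambda>xs. {x\<in>U. \<forall>y\<in>set xs. adj x y})"
  have ext: "\<beta> * card U \<le> card (E xs)" if xs: "xs \<in> clique_lists adj U j" for xs
  proof -
    have sub: "set xs \<subseteq> U" "length xs = j" using xs by (auto simp: clique_lists_def)
    have "U - E xs \<subseteq> (\<Union>y\<in>set xs. {x\<in>U. \<not> adj y x})" using sym by (auto simp: E_def)
    then have "card (U - E xs) \<le> card (\<Union>y\<in>set xs. {x\<in>U. \<not> adj y x})"
      using fin by (intro card_mono) auto
    also have "\<dots> \<le> (\<Sum>y\<in>set xs. card {x\<in>U. \<not> adj y x})"
      by (rule card_UN_le) simp
    finally have "real (card (U - E xs)) \<le> (\<Sum>y\<in>set xs. real (card {x\<in>U. \<not> adj y x}))"
      by (metis of_nat_mono of_nat_sum)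
    also have "\<dots> \<le> (\<Sum>y\<in>set xs. (1 - a) * card U)"
    proof (rule sum_mono)
      fix y assume "y \<in> set xs"
      then have "a * card U \<le> card {x\<in>U. adj y x}" using deg sub by blast
      moreover have "card U = card {x\<in>U. adj y x} + card {x\<in>U. \<not> adj y x}"
        using fin by (subst card_Un_disjoint [symmetric]) (auto intro!: arg_cong [of _ _ card])
      ultimately show "real (card {x\<in>U. \<not> adj y x}) \<le> (1 - a) * card U"
        by (simp add: algebra_simps)
    qed
    also have "\<dots> = real (card (set xs)) * ((1 - a) * card U)" by simp
    also have "\<dots> \<le> real k * ((1 - a) * card U)"
      using card_length [of xs] sub Suc.prems \<beta> by (intro mult_right_mono) auto
    also have "\<dots> = (real k * (1 - a)) * card U" by simp
    also have "\<dots> \<le> (1 - \<beta>) * card U" using \<beta> by (intro mult_right_mono) auto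
    finally have "real (card (U - E xs)) \<le> (1 - \<beta>) * card U" .
    moreover have "card (U - E xs) = card U - card (E xs)" "card (E xs) \<le> card U"
      using fin by (auto simp: E_def intro!: card_Diff_subset card_mono)
    ultimately show ?thesis by (simp add: algebra_simps of_nat_diff)
  qed
  have eq: "clique_lists adj U (Suc j) = (\<Union>xs\<in>clique_lists adj U j. (\<lambda>x. x # xs) ` E xs)"
  proof (intro set_eqI iffI)
    fix zs assume "zs \<in> clique_lists adj U (Suc j)"
    then show "zs \<in> (\<Union>xs\<in>clique_lists adj U j. (\<lambda>x. x # xs) ` E xs)"
      by (cases zs) (auto simp: clique_lists_def E_def)
  qed (auto simp: clique_lists_def E_def)
  have "(\<beta> * card U) ^ Suc j = (\<beta> * card U) ^ j * (\<beta> * card U)" by simp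
  also have "\<dots> \<le> card (clique_lists adj U j) * (\<beta> * card U)"
    using Suc \<beta> by (intro mult_right_mono) auto
  also have "\<dots> = (\<Sum>xs\<in>clique_lists adj U j. \<beta> * card U)" by simp
  also have "\<dots> \<le> (\<Sum>xs\<in>clique_lists adj U j. real (card (E xs)))" by (intro sum_mono ext)
  also have "\<dots> = real (\<Sum>xs\<in>clique_lists adj U j. card ((\<lambda>x. x # xs) ` E xs))"
    by (simp add: card_image inj_on_def)
  also have "(\<Sum>xs\<in>clique_lists adj U j. card ((\<lambda>x. x # xs) ` E xs)) = card (clique_lists adj U (Suc j))"
    unfolding eq
    by (rule card_UN_disjoint [symmetric]) (use fin in \<open>auto simp: finite_clique_lists E_def\<close>)
  finally show ?case .
qed

text \<open>The tangent of the convex function \<open>x ^ s\<close> at \<open>a\<close> lies below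
  it; the induction multiplies the inequality by \<open>x\<close>.\<close>

lemma power_tangent_le:
  fixes x a :: real
  assumes "0 \<le> x" "0 \<le> a"
  shows "a ^ s + s * a ^ (s - 1) * (x - a) \<le> x ^ s"
proof (induction s)
  case (Suc s)
  show ?case
  proof (cases s)
    case (Suc m)
    have "0 \<le> real s * a ^ m * (x - a) ^ 2" using assms by simp
    then have "a ^ Suc s + Suc s * a ^ s * (x - a) \<le> x * (a ^ s + s * a ^ (s - 1) * (x - a))"
      by (simp add: Suc algebra_simps power2_eq_square)
    also have "\<dots> \<le> x * x ^ s" using Suc.IH assms by (intro mult_left_mono)
    finally show ?thesis by simp
  qed simp
qed simp

text \<open>Jensen's inequality: in the sum of the tangents at the mean the linear terms
  cancel.\<close>

lemma power_mean_le:
  fixes f :: "'a \<Rightarrow> real"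
  assumes "finite A" "\<And>x. x \<in> A \<Longrightarrow> 0 \<le> f x"
  shows "card A * ((\<Sum>x\<in>A. f x) / card A) ^ s \<le> (\<Sum>x\<in>A. f x ^ s)"
proof (cases "A = {}")
  case False
  define a where "a = (\<Sum>x\<in>A. f x) / card A"
  have "0 \<le> a" using assms by (simp add: a_def sum_nonneg)
  have cA: "card A > 0" using assms False by (simp add: card_gt_0_iff)
  have "card A * a ^ s = (\<Sum>x\<in>A. a ^ s + s * a ^ (s - 1) * (f x - a))"
  proof -
    have "(\<Sum>x\<in>A. f x - a) = 0" using cA by (simp add: sum_subtractf a_def)
    then have "(\<Sum>x\<in>A. s * a ^ (s - 1) * (f x - a)) = 0"
      by (simp add: sum_distrib_left [symmetric])
    then show ?thesis by (simp add: sum.distrib)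
  qed
  also have "\<dots> \<le> (\<Sum>x\<in>A. f x ^ s)"
    by (intro sum_mono power_tangent_le assms \<open>0 \<le> a\<close>)
  finally show ?thesis by (simp add: a_def)
qed simp

section \<open>From many cliques to many blow-ups\<close>

definition lists_of :: "'a set \<Rightarrow> nat \<Rightarrow> 'a list set" where
  "lists_of V m = {xs. length xs = m \<and> set xs \<subseteq> V}"

lemma finite_lists_of [simp]: "finite V \<Longrightarrow> finite (lists_of V m)"
  using finite_lists_length_eq [of V m] by (simp add: lists_of_def conj_commute)

lemma card_lists_of: "finite V \<Longrightarrow> card (lists_of V m) = card V ^ m"
  using card_lists_length_eq [of V m] by (simp add: lists_of_def conj_commute)

text \<open>An element of \<open>blow V s m S\<close> consists of \<open>m\<close> blocks of length \<open>s\<close> such that every choice of one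
  entry from each block lies in \<open>S\<close>.\<close>

primrec blow :: "'a set \<Rightarrow> nat \<Rightarrow> nat \<Rightarrow> 'a list set \<Rightarrow> 'a list set" where
  "blow V s 0 S = S \<inter> {[]}"
| "blow V s (Suc m) S = (\<Union>w\<in>lists_of V s. (\<lambda>z. w @ z) ` blow V s m {y\<in>lists_of V m. \<forall>x\<in>set w. x # y \<in> S})"

lemma blow_subset: "blow V s m S \<subseteq> lists_of V (m * s)"
  by (induction m arbitrary: S) (fastforce simp: lists_of_def)+

lemma blow_select:
  assumes "z \<in> blow V s m S" "\<And>i. i < m \<Longrightarrow> sel i < s"
  shows "map (\<lambda>i. z ! (i * s + sel i)) [0..<m] \<in> S"
  using assms
proof (induction m arbitrary: S z sel)
  case (Suc m)
  then obtain w z' where w: "w \<in> lists_of V s" "z = w @ z'"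
    "z' \<in> blow V s m {y\<in>lists_of V m. \<forall>x\<in>set w. x # y \<in> S}" by auto
  have "map (\<lambda>i. z' ! (i * s + sel (Suc i))) [0..<m] \<in> {y\<in>lists_of V m. \<forall>x\<in>set w. x # y \<in> S}"
    using Suc.IH [OF w(3)] Suc.prems(2) by simp
  moreover have "w ! sel 0 \<in> set w" using w Suc.prems(2) [of 0] by (simp add: lists_of_def)
  ultimately have "w ! sel 0 # map (\<lambda>i. z' ! (i * s + sel (Suc i))) [0..<m] \<in> S" by blast
  moreover have "map (\<lambda>i. z ! (i * s + sel i)) [0..<Suc m] =
      w ! sel 0 # map (\<lambda>i. z' ! (i * s + sel (Suc i))) [0..<m]"
  proof -
    have "[0..<Suc m] = 0 # map Suc [0..<m]" by (simp add: upt_conv_Cons map_Suc_upt)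
    moreover have "length w = s" using w by (simp add: lists_of_def)
    ultimately show ?thesis using w Suc.prems(2) [of 0] by (simp add: nth_append)
  qed
  ultimately show ?case by simp
qed simp

text \<open>Erdos' counting of complete partite subhypergraphs. Peel off the first coordinate and
  use convexity twice: a random block \<open>w\<close> has a common link of mean density at least
  \<open>\<delta> ^ s\<close>, and the induction hypothesis raises link densities to the power
  \<open>s ^ m\<close>, which is again convex. The exponents multiply to
  \<open>s ^ Suc m\<close>.\<close>

lemma card_blow_ge:
  assumes fin: "finite V" and V: "V \<noteq> {}" and "S \<subseteq> lists_of V m"
  shows "(card S / real (card V) ^ m) ^ (s ^ m) * real (card V) ^ (m * s) \<le> card (blow V s m S)"
  using \<open>S \<subseteq> lists_of V m\<close>
proof (induction m arbitrary: S)
  case 0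
  then have "S = {} \<or> S = {[]}" by (auto simp: lists_of_def)
  then show ?case by auto
next
  case (Suc m)
  define N where "N = real (card V)"
  have N: "N > 0" using fin V by (simp add: N_def card_gt_0_iff)
  define T where "T = (\<lambda>w. {y\<in>lists_of V m. \<forall>x\<in>set w. x # y \<in> S})"
  define d where "d = (\<lambda>y. card {x\<in>V. x # y \<in> S})"
  define \<delta> where "\<delta> = card S / N ^ Suc m"
  have cS: "card S = (\<Sum>y\<in>lists_of V m. d y)"
  proof -
    have "S = (\<Union>y\<in>lists_of V m. (\<lambda>x. x # y) ` {x\<in>V. x # y \<in> S})"
    proof (intro set_eqI iffI)
      fix zs assume "zs \<in> S"
      then show "zs \<in> (\<Union>y\<in>lists_of V m. (\<lambda>x. x # y) ` {x\<in>V. x # y \<in> S})"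
      proof (cases zs)
        case Nil
        then show ?thesis using Suc.prems \<open>zs \<in> S\<close> by (auto simp: lists_of_def)
      next
        case (Cons x y)
        then have "x # y \<in> S" "x # y \<in> lists_of V (Suc m)" using Suc.prems \<open>zs \<in> S\<close> by blast+
        then show ?thesis using Cons by (intro UN_I [of y]) (auto simp: lists_of_def)
      qed
    qed auto
    then have "card S = card (\<Union>y\<in>lists_of V m. (\<lambda>x. x # y) ` {x\<in>V. x # y \<in> S})" by simp
    also have "\<dots> = (\<Sum>y\<in>lists_of V m. card ((\<lambda>x. x # y) ` {x\<in>V. x # y \<in> S}))"
      by (rule card_UN_disjoint) (use fin in auto)
    finally show ?thesis by (simp add: d_def card_image inj_on_def)
  qed
  \<comment> \<open>Count pairs of a block \<open>w\<close> and a list \<open>y\<close> that extends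
    every entry of \<open>w\<close>; for fixed \<open>y\<close> there are \<open>d y ^ s\<close>
    such blocks.\<close>
  have "(\<Sum>w\<in>lists_of V s. real (card (T w))) = (\<Sum>w\<in>lists_of V s. \<Sum>y\<in>lists_of V m. if \<forall>x\<in>set w. x # y \<in> S then 1 else 0)"
    using fin by (simp add: T_def sum.If_cases Int_def)
  also have "\<dots> = (\<Sum>y\<in>lists_of V m. \<Sum>w\<in>lists_of V s. if \<forall>x\<in>set w. x # y \<in> S then 1 else 0)"
    by (rule sum.swap)
  also have "\<dots> = (\<Sum>y\<in>lists_of V m. real (d y) ^ s)"
  proof (rule sum.cong [OF refl])
    fix y
    have "{w \<in> lists_of V s. \<forall>x\<in>set w. x # y \<in> S} = lists_of {x\<in>V. x # y \<in> S} s"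
      by (auto simp: lists_of_def)
    then show "(\<Sum>w\<in>lists_of V s. if \<forall>x\<in>set w. x # y \<in> S then 1 else 0) = real (d y) ^ s"
      using fin by (simp add: sum.If_cases Int_def card_lists_of d_def)
  qed
  also have "\<dots> \<ge> card (lists_of V m) * ((\<Sum>y\<in>lists_of V m. real (d y)) / card (lists_of V m)) ^ s"
    by (rule power_mean_le) (use fin in auto)
  finally have "N ^ m * (card S / N ^ m) ^ s \<le> (\<Sum>w\<in>lists_of V s. real (card (T w)))"
    using fin cS by (simp add: card_lists_of N_def)
  then have sumT: "N ^ m * (\<delta> * N) ^ s \<le> (\<Sum>w\<in>lists_of V s. real (card (T w)))"
    using N by (simp add: \<delta>_def)
  have "\<delta> ^ s \<le> (\<Sum>w\<in>lists_of V s. real (card (T w)) / N ^ m) / card (lists_of V s)"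
    using sumT N fin by (simp add: sum_divide_distrib [symmetric] card_lists_of N_def [symmetric]
        pos_le_divide_eq power_mult_distrib mult_ac)
  moreover have "0 \<le> \<delta>" using N by (simp add: \<delta>_def)
  ultimately have "(\<delta> ^ s) ^ (s ^ m) \<le> ((\<Sum>w\<in>lists_of V s. real (card (T w)) / N ^ m) / card (lists_of V s)) ^ (s ^ m)"
    by (intro power_mono) auto
  then have "card (lists_of V s) * (\<delta> ^ s) ^ (s ^ m) \<le>
      card (lists_of V s) * ((\<Sum>w\<in>lists_of V s. real (card (T w)) / N ^ m) / card (lists_of V s)) ^ (s ^ m)"
    by (intro mult_left_mono) auto
  also have "\<dots> \<le> (\<Sum>w\<in>lists_of V s. (real (card (T w)) / N ^ m) ^ (s ^ m))"
    by (rule power_mean_le) (use fin N in auto)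
  finally have "N ^ s * (\<delta> ^ s) ^ (s ^ m) * N ^ (m * s) \<le>
      (\<Sum>w\<in>lists_of V s. (real (card (T w)) / N ^ m) ^ (s ^ m)) * N ^ (m * s)"
    using fin N by (intro mult_right_mono) (auto simp: card_lists_of N_def)
  also have "\<dots> \<le> (\<Sum>w\<in>lists_of V s. real (card (blow V s m (T w))))"
    unfolding sum_distrib_right
  proof (rule sum_mono)
    fix w
    show "(real (card (T w)) / N ^ m) ^ s ^ m * N ^ (m * s) \<le> real (card (blow V s m (T w)))"
      using Suc.IH [of "T w"] by (auto simp: N_def T_def)
  qed
  also have "\<dots> = real (card (blow V s (Suc m) S))"
  proof -
    have finb: "finite (blow V s m X)" for X
      by (rule finite_subset [OF blow_subset]) (use fin in simp)
    have eq: "blow V s (Suc m) S = (\<Union>w\<in>lists_of V s. (\<lambda>z. w @ z) ` blow V s m (T w))"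
      by (simp add: T_def)
    have "card (blow V s (Suc m) S) = (\<Sum>w\<in>lists_of V s. card ((\<lambda>z. w @ z) ` blow V s m (T w)))"
      unfolding eq
    proof (rule card_UN_disjoint)
      show "\<forall>i\<in>lists_of V s. \<forall>j\<in>lists_of V s. i \<noteq> j \<longrightarrow>
        (@) i ` blow V s m (T i) \<inter> (@) j ` blow V s m (T j) = {}"
        by (auto simp: lists_of_def)
    qed (use fin finb in auto)
    then show ?thesis by (simp add: card_image inj_on_def)
  qed
  finally show ?case
    by (simp add: \<delta>_def N_def power_add mult_ac flip: power_mult)
qed

lemma card_distinct_lists_ge:
  fixes n M :: nat
  assumes "M \<le> n" "0 < n"
  shows "real n ^ M * (1 - M ^ 2 / n) \<le> card {xs. length xs = M \<and> distinct xs \<and> set xs \<subseteq> {..<n}}"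
proof -
  have "card {xs. length xs = M \<and> distinct xs \<and> set xs \<subseteq> {..<n}} = \<Prod>{n - M + 1..n}"
    using card_lists_distinct_length_eq [of "{..<n}" M] assms by simp
  moreover have "(n - M) ^ M \<le> \<Prod>{n - M + 1..n}"
  proof -
    have "(n - M) ^ M = (\<Prod>i\<in>{n - M + 1..n}. n - M)" using assms by simp
    also have "\<dots> \<le> (\<Prod>i\<in>{n - M + 1..n}. i)" by (rule prod_mono) auto
    finally show ?thesis by simp
  qed
  ultimately have "real ((n - M) ^ M) \<le> card {xs. length xs = M \<and> distinct xs \<and> set xs \<subseteq> {..<n}}"
    by (metis of_nat_mono)
  moreover have "real ((n - M) ^ M) = real n ^ M * (1 - M / n) ^ M"
  proof -
    have "real (n - M) = n * (1 - M / n)" using assms by (simp add: of_nat_diff field_simps)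
    then show ?thesis by (simp add: power_mult_distrib)
  qed
  moreover have "1 - M ^ 2 / n \<le> (1 - real M / n) ^ M"
  proof -
    have "-1 \<le> - (real M / n)" using assms by (simp add: field_simps)
    then have "1 + M * (- (real M / n)) \<le> (1 + - (real M / n)) ^ M" by (rule Bernoulli_inequality)
    then show ?thesis by (simp add: power2_eq_square)
  qed
  ultimately show ?thesis using assms by (smt (verit) mult_left_mono of_nat_0_le_iff zero_le_power)
qed

lemma sum_degrees:
  assumes "is_graph n G"
  shows "(\<Sum>x<n. card {y\<in>{..<n}. {x, y} \<in> G}) = 2 * card G"
proof -
  have G: "G \<subseteq> all_edges n" "finite G" using assms finite_subset [OF _ finite_all_edges] by (auto simp: is_graph_def)
  have "card {y\<in>{..<n}. {x, y} \<in> G} = card {e\<in>G. x \<in> e}" if "x < n" for x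
  proof (rule bij_betw_same_card [of "\<lambda>y. {x, y}"], rule bij_betw_imageI)
    show "inj_on (\<lambda>y. {x, y}) {y \<in> {..<n}. {x, y} \<in> G}" by (auto simp: inj_on_def doubleton_eq_iff)
    have "e \<in> (\<lambda>y. {x, y}) ` {y \<in> {..<n}. {x, y} \<in> G}" if "e \<in> G" "x \<in> e" for e
    proof -
      have "e \<in> all_edges n" using that G by blast
      then obtain a b where "a < n" "b < n" "e = {a, b}" by (auto simp: all_edges_def)
      then show ?thesis using that by (auto simp: insert_commute)
    qed
    then show "(\<lambda>y. {x, y}) ` {y \<in> {..<n}. {x, y} \<in> G} = {e \<in> G. x \<in> e}" by auto
  qed
  then have "(\<Sum>x<n. card {y\<in>{..<n}. {x, y} \<in> G}) = (\<Sum>x<n. card {e\<in>G. x \<in> e})" by simp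
  also have "\<dots> = (\<Sum>x<n. \<Sum>e\<in>G. if x \<in> e then 1 else 0)"
    using G by (simp add: sum.If_cases Int_def)
  also have "\<dots> = (\<Sum>e\<in>G. \<Sum>x<n. if x \<in> e then 1 else 0)" by (rule sum.swap)
  also have "\<dots> = (\<Sum>e\<in>G. 2)"
  proof (rule sum.cong [OF refl])
    fix e assume "e \<in> G"
    then have "e \<subseteq> {..<n}" "card e = 2" using G by (auto simp: all_edges_eq)
    then show "(\<Sum>x<n. if x \<in> e then 1 else 0) = (2::nat)"
      by (simp add: sum.If_cases Int_absorb1)
  qed
  finally show ?thesis by simp
qed

text \<open>Labelled copies are counted, so that the count compares with \<open>n ^ (m * s)\<close>:
  position \<open>i * s + a\<close> holds vertex \<open>a\<close> of class \<open>i\<close>. Nothing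
  is required inside a class.\<close>

definition blowups :: "nat \<Rightarrow> nat set set \<Rightarrow> nat \<Rightarrow> nat \<Rightarrow> nat list set" where
  "blowups n G m s = {zs. length zs = m * s \<and> set zs \<subseteq> {..<n} \<and> distinct zs \<and>
    (\<forall>i j a b. i < m \<longrightarrow> j < m \<longrightarrow> i \<noteq> j \<longrightarrow> a < s \<longrightarrow> b < s \<longrightarrow> {zs ! (i * s + a), zs ! (j * s + b)} \<in> G)}"

text \<open>Pass to a core of linear size and large minimum degree, count its ordered cliques
  greedily, blow them up by convexity, and discard the few lists with repeated vertices.\<close>

lemma blowups_count:
  fixes \<eta> :: real
  assumes k: "1 \<le> k" and \<eta>: "0 < \<eta>" "\<eta> \<le> 1"
  shows "\<exists>\<gamma>::real. 0 < \<gamma> \<and> (\<exists>n0. \<forall>n\<ge>n0. \<forall>G. is_graph n G \<longrightarrow> 1 - 1 / k + \<eta> \<le> density n G \<longrightarrow>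
    \<gamma> * n ^ (Suc k * s) \<le> card (blowups n G (Suc k) s))"
proof -
  \<comment> \<open>The surplus \<open>\<eta>\<close> is split in three: one third goes to the
    minimum degree of the core, one to its size, and the last absorbs lower-order terms once
    \<open>n \<ge> 12 / \<eta>\<close>.\<close>
  define \<gamma>1 where "\<gamma>1 = \<eta> / 3"
  define \<beta> where "\<beta> = \<eta> / 3"
  define c where "c = \<beta> * sqrt \<gamma>1"
  define \<gamma> where "\<gamma> = (c ^ Suc k) ^ (s ^ Suc k)"
  define M where "M = Suc k * s"
  have c: "0 < c" using \<eta> by (simp add: c_def \<beta>_def \<gamma>1_def)
  then have \<gamma>: "0 < \<gamma>" by (simp add: \<gamma>_def)
  define n0 where "n0 = Suc (max (nat \<lceil>12 / \<eta>\<rceil>) (max M (nat \<lceil>2 * M ^ 2 / \<gamma>\<rceil>)))"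
  have "\<gamma> / 2 * real (n ^ (Suc k * s)) \<le> real (card (blowups n G (Suc k) s))"
    if n: "n0 \<le> n" and G: "is_graph n G" and dens: "1 - 1 / k + \<eta> \<le> density n G" for n G
  proof -
    have n12: "12 / \<eta> \<le> n" and nM: "M \<le> n" and nM2: "2 * M ^ 2 / \<gamma> \<le> n" and n2: "2 \<le> n"
    proof -
      have *: "nat \<lceil>12 / \<eta>\<rceil> < n" "nat \<lceil>2 * M ^ 2 / \<gamma>\<rceil> < n" "M \<le> n" using n by (auto simp: n0_def)
      show "12 / \<eta> \<le> n" using *(1) by linarith
      then have "12 \<le> n * \<eta>" using \<eta> by (simp add: field_simps)
      moreover have "real n * \<eta> \<le> real n * 1" using \<eta> by (intro mult_left_mono) auto
      ultimately have "12 \<le> real n" by linarith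
      then show "2 \<le> n" by simp
      show "2 * M ^ 2 / \<gamma> \<le> n" using *(2) by linarith
      show "M \<le> n" by fact
    qed
    define adj where "adj = (\<lambda>x y. {x, y} \<in> G)"
    have sym: "adj x y \<longleftrightarrow> adj y x" for x y by (simp add: adj_def insert_commute)
    have irr: "\<not> adj x x" for x using G by (auto simp: adj_def is_graph_def all_edges_def)
    define a where "a = 1 - 1 / real k + \<eta> / 3"
    have k1: "1 / real k \<le> 1" using k by simp
    have "real (card G) = density n G * real (n choose 2)" using n2 by (simp add: density_def)
    then have "2 * real (card G) = density n G * (real n * (real n - 1))"
      using n2 choose_two [of n] by (simp add: real_of_nat_div of_nat_diff)
    moreover have "(1 - 1 / k + \<eta>) * (real n * (real n - 1)) \<le> density n G * (real n * (real n - 1))"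
      using dens n2 by (intro mult_right_mono) auto
    ultimately have dG: "(1 - 1 / k + \<eta>) * (real n * (real n - 1)) \<le> 2 * card G" by linarith
    have "a * n * (n + 1) + \<gamma>1 * n ^ 2 \<le> (1 - 1 / k + \<eta>) * (real n * (real n - 1))"
    proof -
      have "0 \<le> n * \<eta> / 3 - 4" using n12 \<eta> by (simp add: field_simps)
      also have "\<dots> \<le> (1 - 1 / k + \<eta>) * (real n - 1) - a * (n + 1) - \<gamma>1 * n"
      proof -
        define x where "x = 1 / real k"
        have "(1 - x + \<eta>) * (real n - 1) - (1 - x + \<eta> / 3) * (n + 1) - \<eta> / 3 * n = n * \<eta> / 3 - 2 + 2 * x - 4 * \<eta> / 3"
          by (simp add: field_simps)
        moreover have "0 \<le> x" by (simp add: x_def)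
        ultimately show ?thesis unfolding a_def \<gamma>1_def x_def [symmetric] using \<eta> by linarith
      qed
      finally have "0 \<le> n * ((1 - 1 / k + \<eta>) * (real n - 1) - a * (n + 1) - \<gamma>1 * n)" by simp
      moreover have "n * (B * (real n - 1) - a * (n + 1) - \<gamma>1 * n) = B * (real n * (real n - 1)) - (a * n * (n + 1) + \<gamma>1 * n ^ 2)"
        for B by (simp add: algebra_simps power2_eq_square)
      ultimately show ?thesis by (metis diff_ge_0_iff_ge)
    qed
    also have "\<dots> \<le> 2 * card G" by (rule dG)
    also have "\<dots> = (\<Sum>x\<in>{..<n}. real (card {y\<in>{..<n}. adj x y}))"
      using sum_degrees [OF G] by (simp add: adj_def flip: of_nat_sum)
    finally have "a * card {..<n} * (card {..<n} + 1) + \<gamma>1 * card {..<n} ^ 2 \<le> (\<Sum>x\<in>{..<n}. real (card {y\<in>{..<n}. adj x y}))"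
      by simp
    moreover have "0 \<le> a" using k1 \<eta> by (simp add: a_def)
    ultimately obtain U where U: "U \<subseteq> {..<n}" "\<gamma>1 * n ^ 2 \<le> real (card U) ^ 2"
      "\<And>x. x \<in> U \<Longrightarrow> a * card U \<le> card {y\<in>U. adj x y}"
      using dense_core [of "{..<n}" adj a \<gamma>1] sym irr by auto
    have finU: "finite U" using U finite_subset by blast
    have cU: "sqrt \<gamma>1 * n \<le> card U"
      using real_sqrt_le_mono [OF U(2)] by (simp add: real_sqrt_mult)
    have "c * n \<le> \<beta> * card U"
      using cU \<eta> by (simp add: c_def \<beta>_def mult_left_mono)
    then have "(c * n) ^ Suc k \<le> (\<beta> * card U) ^ Suc k"
      using c by (intro power_mono) auto
    also have "\<dots> \<le> card (clique_lists adj U (Suc k))"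
    proof (cases "a \<le> 1")
      case True
      show ?thesis
      proof (rule clique_lists_count [OF finU U(3) sym])
        have "real k * (1 - a) = 1 - k * (\<eta> / 3)" using k by (simp add: a_def algebra_simps)
        also have "\<dots> \<le> 1 - \<beta>" using k \<eta> by (simp add: \<beta>_def)
        finally show "real k * (1 - a) \<le> 1 - \<beta>" .
      qed (use \<eta> True in \<open>auto simp: \<beta>_def\<close>)
    next
      case False
      \<comment> \<open>For \<open>a > 1\<close> the degrees in the core would exceed its order, so
        it would be empty, contrary to its size.\<close>
      have "U = {}"
      proof (rule ccontr)
        assume "U \<noteq> {}"
        then obtain x where x: "x \<in> U" by blast
        have "card {y\<in>U. adj x y} \<le> card U" using finU by (intro card_mono) auto
        moreover have "card U < a * card U" using False finU x card_gt_0_iff [of U] by (auto simp: mult_less_cancel_right2)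
        ultimately show False using U(3) [OF x] by linarith
      qed
      then show ?thesis using cU \<eta> n2 by (simp add: \<gamma>1_def)
    qed
    finally have cl: "c ^ Suc k * real n ^ Suc k \<le> card (clique_lists adj U (Suc k))"
      by (simp only: power_mult_distrib)
    define S where "S = clique_lists adj U (Suc k)"
    have S: "S \<subseteq> lists_of {..<n} (Suc k)" using U(1) by (auto simp: S_def clique_lists_def lists_of_def)
    have "c ^ Suc k \<le> card S / real (card {..<n}) ^ Suc k"
      using cl n2 by (simp add: S_def pos_le_divide_eq del: power_Suc)
    then have "\<gamma> \<le> (card S / real (card {..<n}) ^ Suc k) ^ (s ^ Suc k)"
      unfolding \<gamma>_def using c by (intro power_mono) auto
    then have "\<gamma> * real n ^ M \<le> (card S / real (card {..<n}) ^ Suc k) ^ (s ^ Suc k) * real (card {..<n}) ^ (Suc k * s)"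
      by (auto simp: M_def intro!: mult_right_mono)
    also have "\<dots> \<le> card (blow {..<n} s (Suc k) S)"
      by (rule card_blow_ge [OF _ _ S]) (use n2 in \<open>auto simp: lessThan_empty_iff\<close>)
    finally have B: "\<gamma> * real n ^ M \<le> card (blow {..<n} s (Suc k) S)" .
    define BL where "BL = blow {..<n} s (Suc k) S"
    note B = B [folded BL_def]
    define D where "D = {xs. length xs = M \<and> distinct xs \<and> set xs \<subseteq> {..<n}}"
    have Dsub: "D \<subseteq> lists_of {..<n} M" by (auto simp: D_def lists_of_def)
    have Bsub: "BL \<subseteq> lists_of {..<n} M" unfolding M_def BL_def by (rule blow_subset)
    have fD: "finite D" by (rule finite_subset [OF Dsub]) simp
    have fB: "finite BL" by (rule finite_subset [OF Bsub]) simp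
    \<comment> \<open>Both families live among the \<open>n ^ M\<close> lists, so their intersection
      has at least \<open>card BL + card D - n ^ M\<close> members.\<close>
    have "card BL + card D = card (BL \<union> D) + card (BL \<inter> D)"
      by (rule card_Un_Int [OF fB fD])
    moreover have "card (BL \<union> D) \<le> n ^ M"
      using card_mono [of "lists_of {..<n} M" "BL \<union> D"] Dsub Bsub
      by (simp add: card_lists_of)
    ultimately have "card BL + card D \<le> n ^ M + card (BL \<inter> D)"
      by linarith
    then have "real (card BL) + card D \<le> real n ^ M + card (BL \<inter> D)"
      by (metis (mono_tags) of_nat_add of_nat_le_iff of_nat_power)
    moreover have "real n ^ M * (1 - M ^ 2 / n) \<le> card D"
      unfolding D_def by (rule card_distinct_lists_ge) (use nM n2 in auto)
    ultimately have low: "(\<gamma> - M ^ 2 / n) * real n ^ M \<le> card (BL \<inter> D)"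
      using B by (simp add: algebra_simps)
    have "\<gamma> / 2 \<le> \<gamma> - M ^ 2 / n"
      using nM2 \<gamma> n2 by (simp add: field_simps)
    then have half: "\<gamma> / 2 * real n ^ M \<le> (\<gamma> - M ^ 2 / n) * real n ^ M"
      by (rule mult_right_mono) simp
    have sub: "BL \<inter> D \<subseteq> blowups n G (Suc k) s"
    proof
      fix z assume z: "z \<in> BL \<inter> D"
      have ordered: "{z ! (i * s + a), z ! (j * s + b)} \<in> G"
        if "i < j" "j < Suc k" "a < s" "b < s" for i j a b
      proof -
        \<comment> \<open>Entry \<open>a\<close> from block \<open>i\<close> and entry
          \<open>b\<close> from every other block form a clique, which contains the required
          edge.\<close>
        have "map (\<lambda>i'. z ! (i' * s + (if i' = i then a else b))) [0..<Suc k] \<in> S"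
          by (rule blow_select [of _ "{..<n}"]) (use z that in \<open>auto simp only: BL_def Int_iff split: if_splits\<close>)
        then have "sorted_wrt adj (map (\<lambda>i'. z ! (i' * s + (if i' = i then a else b))) [0..<Suc k])"
          by (simp add: S_def clique_lists_def del: upt_Suc)
        then have "adj (map (\<lambda>i'. z ! (i' * s + (if i' = i then a else b))) [0..<Suc k] ! i)
            (map (\<lambda>i'. z ! (i' * s + (if i' = i then a else b))) [0..<Suc k] ! j)"
          by (rule sorted_wrt_nth_less) (use that in auto)
        then show ?thesis using that by (simp add: adj_def del: upt_Suc)
      qed
      have "{z ! (i * s + a), z ! (j * s + b)} \<in> G"
        if "i \<noteq> j" "i < Suc k" "j < Suc k" "a < s" "b < s" for i j a b
        using that ordered [of i j a b] ordered [of j i b a]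
        by (metis insert_commute linorder_neqE_nat)
      then show "z \<in> blowups n G (Suc k) s"
        using z by (auto simp: blowups_def D_def M_def)
    qed
    have "finite (blowups n G (Suc k) s)"
      by (rule finite_subset [OF _ finite_lists_of [of "{..<n}" M]]) (auto simp: blowups_def lists_of_def M_def)
    then have "real (card (BL \<inter> D)) \<le> real (card (blowups n G (Suc k) s))"
      using card_mono [OF _ sub] by simp
    then have "\<gamma> / 2 * real n ^ M \<le> real (card (blowups n G (Suc k) s))" using low half by linarith
    then show ?thesis by (simp add: M_def del: mult_Suc)
  qed
  moreover have "0 < \<gamma> / 2" using \<gamma> by simp
  ultimately show ?thesis unfolding of_nat_power by blast
qed

section \<open>Upper bounds for dense graphs\<close>

text \<open>With \<open>k = 2 ^ r\<close>, a density above \<open>1 - 1 / k\<close> yields blow-ups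
  of the complete graph on \<open>k + 1\<close> vertices; here a single one suffices.\<close>

lemma pert_zero_dense:
  assumes l: "odd l" "2 ^ r + 1 \<le> l" and r: "0 < r" and d: "1 - 1 / 2 ^ r < d"
  shows "pert_zero l r d"
proof -
  define k :: nat where "k = 2 ^ r"
  define M :: nat where "M = 2 ^ r + 1"
  define \<eta> where "\<eta> = min 1 (d - (1 - 1 / 2 ^ r))"
  obtain t :: nat where t: "\<forall>G \<phi>. inj_on \<phi> ({..<M} \<times> {..<t}) \<longrightarrow>
    (\<forall>u v a b. u < M \<longrightarrow> v < M \<longrightarrow> a < t \<longrightarrow> b < t \<longrightarrow> u \<noteq> v \<longrightarrow> (u = v \<longrightarrow> a = b) \<longrightarrow>
      {\<phi> (u, a), \<phi> (v, b)} \<in> G) \<longrightarrow> cycle_ramsey l r G"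
    using blowup_cycle_ramsey [OF l M_def r, of "\<lambda>u. u"] by blast
  have "1 \<le> k" "0 < \<eta>" "\<eta> \<le> 1" using d by (auto simp: k_def \<eta>_def)
  from blowups_count [OF this, of t]
  obtain \<gamma> :: real and n0 where \<gamma>: "0 < \<gamma>" and cnt: "\<And>n G. n0 \<le> n \<Longrightarrow> is_graph n G \<Longrightarrow>
    1 - 1 / k + \<eta> \<le> density n G \<Longrightarrow> \<gamma> * n ^ (Suc k * t) \<le> card (blowups n G (Suc k) t)" by blast
  have "cycle_ramsey l r G" if n: "Suc n0 \<le> n" and G: "is_graph n G" and dG: "d \<le> density n G" for n G
  proof -
    have "1 - 1 / k + \<eta> \<le> density n G" using dG by (simp add: k_def \<eta>_def)
    then have "\<gamma> * n ^ (Suc k * t) \<le> card (blowups n G (Suc k) t)" using cnt n G by simp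
    moreover have "0 < \<gamma> * n ^ (Suc k * t)" using \<gamma> n by simp
    ultimately have "blowups n G (Suc k) t \<noteq> {}" by auto
    then obtain zs where "zs \<in> blowups n G (Suc k) t" by blast
    then have len: "length zs = M * t" and dis: "distinct zs"
      and E: "\<And>i j a b. \<lbrakk>i < M; j < M; i \<noteq> j; a < t; b < t\<rbrakk> \<Longrightarrow> {zs ! (i * t + a), zs ! (j * t + b)} \<in> G"
      by (auto simp: blowups_def M_def k_def)
    have code: "u * t + a < M * t" if "u < M" "a < t" for u a
    proof -
      have "u * t + a < Suc u * t" using that by simp
      also have "\<dots> \<le> M * t" using that by (intro mult_le_mono1) simp
      finally show ?thesis .
    qed
    show ?thesis
    proof (rule t [THEN spec, of G, THEN spec, of "\<lambda>x. zs ! (fst x * t + snd x)", THEN mp, THEN mp])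
      show "inj_on (\<lambda>x. zs ! (fst x * t + snd x)) ({..<M} \<times> {..<t})"
      proof (rule inj_onI)
        fix x y assume x: "x \<in> {..<M} \<times> {..<t}" and y: "y \<in> {..<M} \<times> {..<t}"
          and eq: "zs ! (fst x * t + snd x) = zs ! (fst y * t + snd y)"
        have lt: "snd x < t" "snd y < t" using x y by auto
        have "fst x * t + snd x = fst y * t + snd y"
          using dis eq x y code len by (auto simp: nth_eq_iff_index_eq)
        then have "(fst x * t + snd x) div t = (fst y * t + snd y) div t"
          "(fst x * t + snd x) mod t = (fst y * t + snd y) mod t" by simp_all
        then show "x = y" using lt by (simp add: prod_eq_iff)
      qed
      show "\<forall>u v a b. u < M \<longrightarrow> v < M \<longrightarrow> a < t \<longrightarrow> b < t \<longrightarrow> u \<noteq> v \<longrightarrow> (u = v \<longrightarrow> a = b) \<longrightarrow>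
        {zs ! (fst (u, a) * t + snd (u, a)), zs ! (fst (v, b) * t + snd (v, b))} \<in> G"
        using E by simp
    qed
  qed
  then show ?thesis unfolding pert_zero_def by blast
qed

text \<open>Induction on the length. Linearly many first entries have many continuations. Expose
  only a set \<open>R'\<close> of about \<open>1 / p\<close> of them: it is hit with probability
  close to 1, and it is so small that most continuations avoid it and can be found in the
  independent remainder.\<close>

lemma pr_hits_dense_lists:
  fixes c \<epsilon> :: real
  assumes "0 < c" "0 < \<epsilon>"
  shows "\<exists>K::real. \<forall>E::'a set. \<forall>p::real. \<forall>S. finite E \<longrightarrow> 0 \<le> p \<longrightarrow> p \<le> 1 \<longrightarrow> K \<le> p * card E \<longrightarrow>
    S \<subseteq> lists_of E L \<longrightarrow> c * real (card E) ^ L \<le> card S \<longrightarrow>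
    1 - \<epsilon> \<le> pr E p (\<lambda>F. \<exists>xs\<in>S. set xs \<subseteq> F)"
  using assms
proof (induction L arbitrary: c \<epsilon>)
  case 0
  have "1 - \<epsilon> \<le> pr E p (\<lambda>F. \<exists>xs\<in>S. set xs \<subseteq> F)"
    if "finite E" "S \<subseteq> lists_of E 0" "c * real (card E) ^ 0 \<le> card S" for E p and S :: "'a list set"
  proof -
    have "card S \<noteq> 0" using that 0 by auto
    then have "S \<noteq> {}" by auto
    then have "[] \<in> S" using that by (auto simp: lists_of_def)
    then have "pr E p (\<lambda>F. \<exists>xs\<in>S. set xs \<subseteq> F) = pr E p (\<lambda>_. True)" by (intro pr_cong) force
    then show ?thesis using pr_True [OF \<open>finite E\<close>] 0 by simp
  qed
  then show ?case by blast
next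
  case (Suc L)
  define c' where "c' = min c 1"
  define \<epsilon>' where "\<epsilon>' = min \<epsilon> 1"
  have c': "0 < c'" "c' \<le> 1" "c' \<le> c" and \<epsilon>': "0 < \<epsilon>'" "\<epsilon>' \<le> 1" "\<epsilon>' \<le> \<epsilon>"
    using Suc.prems by (auto simp: c'_def \<epsilon>'_def)
  have cq: "0 < c' / 4" and eq: "0 < \<epsilon>' / 2" using c' \<epsilon>' by simp_all
  obtain K' :: real where K': "\<And>E (p::real) S. \<lbrakk>finite E; 0 \<le> p; p \<le> 1; K' \<le> p * card E;
    S \<subseteq> lists_of E L; c' / 4 * real (card E) ^ L \<le> card S\<rbrakk> \<Longrightarrow>
    1 - \<epsilon>' / 2 \<le> pr E p (\<lambda>F. \<exists>xs\<in>S. set xs \<subseteq> (F::'a set))"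
    using Suc.IH [OF cq eq] by blast
  \<comment> \<open>With \<open>m \<ge> w / p\<close> elements exposed, all are missed with
    probability at most \<open>exp (- w) = \<epsilon>' / 2\<close>.\<close>
  define w where "w = ln (2 / \<epsilon>')"
  have w: "0 < w" using \<epsilon>' by (simp add: w_def)
  \<comment> \<open>The first bound leaves enough expected elements for the induction hypothesis on
    at least half of \<open>E\<close>; the second makes \<open>(L + 1) * m\<close> at most
    \<open>c' / 4\<close> of \<open>card E\<close>.\<close>
  define K where "K = max (2 * K') (4 * (w + 1) * real (L + 1) / c')"
  have K4: "4 * (w + 1) * real (L + 1) / c' \<le> K" by (simp add: K_def)
  have "0 < 4 * (w + 1) * real (L + 1) / c'" using w c' by simp
  then have K0: "0 < K" using K4 by linarith
  have "1 - \<epsilon> \<le> pr E p (\<lambda>F. \<exists>xs\<in>S. set xs \<subseteq> F)"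
    if fin: "finite E" and p: "0 \<le> p" "p \<le> 1" and pK: "K \<le> p * card E"
      and S: "S \<subseteq> lists_of E (Suc L)" and cS: "c * real (card E) ^ Suc L \<le> card S"
    for E :: "'a set" and p :: real and S
  proof -
    define N where "N = real (card E)"
    have "0 < p * N" using pK K0 by (simp add: N_def)
    then have p0: "0 < p" and N0: "0 < N" using p by (auto simp: N_def zero_less_mult_iff)
    have p1N: "1 / p \<le> N / K" using pK K0 p0 by (simp add: N_def field_simps)
    define Sl where "Sl = (\<lambda>e. {ys\<in>lists_of E L. e # ys \<in> S})"
    define R where "R = {e\<in>E. c' / 2 * N ^ L \<le> card (Sl e)}"
    have Sl_le: "card (Sl e) \<le> N ^ L" for e
    proof -
      have "card (Sl e) \<le> card (lists_of E L)"
        unfolding Sl_def by (rule card_mono) (use fin in auto)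
      then show ?thesis using fin by (simp add: card_lists_of N_def flip: of_nat_power)
    qed
    have "S \<subseteq> (\<Union>e\<in>E. (\<lambda>ys. e # ys) ` Sl e)"
    proof
      fix xs assume xs: "xs \<in> S"
      then have "xs \<in> lists_of E (Suc L)" using S by blast
      then obtain e ys where "xs = e # ys" "e \<in> E" "ys \<in> lists_of E L"
        by (cases xs) (auto simp: lists_of_def)
      then show "xs \<in> (\<Union>e\<in>E. (\<lambda>ys. e # ys) ` Sl e)" using xs by (auto simp: Sl_def)
    qed
    then have "card S \<le> card (\<Union>e\<in>E. (\<lambda>ys. e # ys) ` Sl e)"
      using fin by (intro card_mono) (auto simp: Sl_def)
    also have "\<dots> \<le> (\<Sum>e\<in>E. card ((\<lambda>ys. e # ys) ` Sl e))" by (rule card_UN_le [OF fin])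
    finally have "real (card S) \<le> (\<Sum>e\<in>E. real (card (Sl e)))"
      by (simp add: card_image inj_on_def flip: of_nat_sum)
    also have "\<dots> \<le> (\<Sum>e\<in>E. (if e \<in> R then N ^ L else 0) + c' / 2 * N ^ L)"
    proof (rule sum_mono)
      fix e assume "e \<in> E"
      have "0 \<le> c' / 2 * N ^ L" using c' N0 by simp
      then show "real (card (Sl e)) \<le> (if e \<in> R then N ^ L else 0) + c' / 2 * N ^ L"
        using Sl_le [of e] \<open>e \<in> E\<close> unfolding R_def by auto
    qed
    also have "\<dots> = card R * N ^ L + N * (c' / 2 * N ^ L)"
    proof -
      have "E \<inter> R = R" by (auto simp: R_def)
      then show ?thesis using fin by (simp add: sum.distrib sum.If_cases N_def)
    qed
    finally have "real (card S) \<le> card R * N ^ L + N * (c' / 2 * N ^ L)" .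
    moreover have "c' * N ^ Suc L \<le> c * N ^ Suc L" using c' N0 by (intro mult_right_mono) auto
    ultimately have "c' * N ^ Suc L \<le> card R * N ^ L + N * (c' / 2 * N ^ L)"
      using cS unfolding N_def by linarith
    then have "(c' / 2 * N) * N ^ L \<le> card R * N ^ L" by (simp add: field_simps)
    then have cR: "c' / 2 * N \<le> card R" using N0 by simp
    define m where "m = nat \<lceil>w / p\<rceil>"
    have wm: "w \<le> p * m" and "m \<le> w / p + 1"
    proof -
      have "w / p \<le> m" unfolding m_def by linarith
      then show "w \<le> p * m" using p0 by (simp add: field_simps)
      show "m \<le> w / p + 1" using w p0 unfolding m_def by (simp add: ceiling_correct less_imp_le of_nat_nat)
    qed
    then have "m \<le> (w + 1) * (1 / p)" using p p0 by (simp add: field_simps) 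
    also have "\<dots> \<le> (w + 1) * (N / K)" using p1N w by (intro mult_left_mono) auto
    also have "\<dots> \<le> c' / (4 * real (L + 1)) * N"
    proof -
      have "(w + 1) / K \<le> c' / (4 * real (L + 1))" using K4 K0 c' by (simp add: field_simps)
      from mult_right_mono [OF this, of N] N0 show ?thesis by simp
    qed
    finally have m: "m \<le> c' / (4 * real (L + 1)) * N" .
    have Lm: "real (L + 1) * real m \<le> c' / 4 * N"
    proof -
      have "x * (c' / (4 * x) * N) = c' / 4 * N" if "x \<noteq> 0" for x using that by simp
      from this [of "real (L + 1)"] show ?thesis
        using mult_left_mono [OF m, of "real (L + 1)"] by (simp only: of_nat_0_le_iff of_nat_eq_0_iff)
    qed
    have "1 * real m \<le> real (L + 1) * real m" by (intro mult_right_mono) auto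
    then have mN: "m \<le> c' / 4 * N" using Lm by simp
    have "c' / 4 * N \<le> c' / 2 * N" using c' N0 by (intro mult_right_mono) auto
    then have "real m \<le> real (card R)" using mN cR by linarith
    then have "m \<le> card R" by simp
    then obtain R' where R': "R' \<subseteq> R" "card R' = m" using obtain_subset_with_card_n by metis
    have R'E: "R' \<subseteq> E" using R' by (auto simp: R_def)
    have finR': "finite R'" using R'E fin finite_subset by blast
    define E' where "E' = E - R'"
    have cE': "real (card E') = N - m"
      using R' R'E fin card_mono [OF fin R'E] by (simp add: E'_def N_def card_Diff_subset finR' of_nat_diff)
    have "c' / 4 * N \<le> N / 2" using c' N0 by simp
    then have half: "N / 2 \<le> N - m" using mN by linarith
    have main: "1 - \<epsilon>' / 2 \<le> pr E' p (\<lambda>F'. \<exists>xs\<in>S. set xs \<subseteq> F1 \<union> F')" if "e \<in> R'" "e \<in> F1" for e F1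
    proof -
      have "1 - \<epsilon>' / 2 \<le> pr E' p (\<lambda>F'. \<exists>xs\<in>Sl e \<inter> lists_of E' L. set xs \<subseteq> F')"
      proof (rule K')
        show "finite E'" using fin by (simp add: E'_def)
        have "K' \<le> p * (N / 2)" using pK by (simp add: K_def N_def)
        also have "\<dots> \<le> p * (N - m)" using half p by (intro mult_left_mono) auto
        finally show "K' \<le> p * card E'" using cE' by simp
        \<comment> \<open>Continuations avoiding \<open>R'\<close>: both families lie in
          \<open>lists_of E L\<close>, and by Bernoulli's inequality \<open>lists_of E' L\<close> is
          almost all of it.\<close>
        have "card (Sl e) + card (lists_of E' L) = card (Sl e \<union> lists_of E' L) + card (Sl e \<inter> lists_of E' L)"
          by (rule card_Un_Int) (use fin in \<open>auto simp: Sl_def E'_def\<close>)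
        moreover have "card (Sl e \<union> lists_of E' L) \<le> card (lists_of E L)"
        proof (rule card_mono)
          show "Sl e \<union> lists_of E' L \<subseteq> lists_of E L" by (auto simp: Sl_def E'_def lists_of_def)
        qed (use fin in simp)
        ultimately have "card (Sl e) + card (lists_of E' L) \<le> card (lists_of E L) + card (Sl e \<inter> lists_of E' L)"
          by linarith
        then have "card (Sl e) + real (card E') ^ L \<le> N ^ L + card (Sl e \<inter> lists_of E' L)"
          using fin by (simp add: card_lists_of N_def E'_def flip: of_nat_power of_nat_add)
        moreover have "c' / 2 * N ^ L \<le> card (Sl e)" using that R' by (auto simp: R_def)
        moreover have "N ^ L * (1 - c' / 4) \<le> real (card E') ^ L"
        proof -
          have "real L * m \<le> c' / 4 * N" using Lm by (simp add: field_simps)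
          then have "1 - c' / 4 \<le> 1 + real L * (- (m / N))" using N0 by (simp add: field_simps)
          also have "\<dots> \<le> (1 + - (m / N)) ^ L"
            using half N0 by (intro Bernoulli_inequality) (simp add: field_simps)
          finally have "N ^ L * (1 - c' / 4) \<le> N ^ L * (1 + - (m / N)) ^ L"
            using N0 by (intro mult_left_mono) auto
          also have "\<dots> = (N * (1 + - (m / N))) ^ L" by (simp add: power_mult_distrib)
          also have "N * (1 + - (m / N)) = real (card E')" using N0 cE' by (simp add: right_diff_distrib)
          finally show ?thesis .
        qed
        ultimately have "c' / 4 * N ^ L \<le> card (Sl e \<inter> lists_of E' L)" by (simp add: algebra_simps)
        moreover have "c' / 4 * real (card E') ^ L \<le> c' / 4 * N ^ L"
          using c' cE' half by (intro mult_left_mono power_mono) auto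
        ultimately show "c' / 4 * real (card E') ^ L \<le> card (Sl e \<inter> lists_of E' L)" by linarith
      qed (use p in auto)
      also have "\<dots> \<le> pr E' p (\<lambda>F'. \<exists>xs\<in>S. set xs \<subseteq> F1 \<union> F')"
      proof (rule pr_mono [OF p])
        fix F' assume "\<exists>xs\<in>Sl e \<inter> lists_of E' L. set xs \<subseteq> F'"
        then obtain xs where "e # xs \<in> S" "set xs \<subseteq> F'" by (auto simp: Sl_def)
        then show "\<exists>xs\<in>S. set xs \<subseteq> F1 \<union> F'" using that by (intro bexI [of _ "e # xs"]) auto
      qed
      finally show ?thesis .
    qed
    let ?w = "\<lambda>F1. p ^ card F1 * (1 - p) ^ (card R' - card F1)"
    have total: "(\<Sum>F1\<in>Pow R'. ?w F1) = 1"
      using pr_True [OF finR', of p] by (simp add: pr_def)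
    have "(1 - p) ^ m \<le> exp (- p) ^ m"
      using p exp_ge_add_one_self [of "- p"] by (intro power_mono) auto
    also have "\<dots> = exp (- (p * m))" by (simp add: mult.commute flip: exp_of_nat_mult)
    also have "\<dots> \<le> exp (- w)" using wm by simp
    also have "\<dots> = \<epsilon>' / 2" using \<epsilon>' by (simp add: w_def exp_minus)
    finally have miss: "(1 - p) ^ m \<le> \<epsilon>' / 2" .
    have "0 \<le> \<epsilon>' * \<epsilon>'" by simp
    moreover have "(1 - \<epsilon>' / 2) * (1 - \<epsilon>' / 2) = 1 - \<epsilon>' + \<epsilon>' * \<epsilon>' / 4" by (simp add: algebra_simps)
    ultimately have sq: "1 - \<epsilon> \<le> (1 - \<epsilon>' / 2) * (1 - \<epsilon>' / 2)" using \<epsilon>' by linarith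
    have "(1 - \<epsilon>' / 2) * (1 - \<epsilon>' / 2) \<le> (1 - \<epsilon>' / 2) * (1 - (1 - p) ^ m)"
      by (rule mult_left_mono) (use miss \<epsilon>' in linarith)+
    with sq have lower: "1 - \<epsilon> \<le> (1 - \<epsilon>' / 2) * (1 - (1 - p) ^ m)" by linarith
    have "(1 - \<epsilon>' / 2) * (1 - (1 - p) ^ m) = (\<Sum>F1\<in>Pow R'. ?w F1 * (1 - \<epsilon>' / 2)) - (1 - p) ^ m * (1 - \<epsilon>' / 2)"
    proof -
      have "(\<Sum>F1\<in>Pow R'. ?w F1 * (1 - \<epsilon>' / 2)) = (\<Sum>F1\<in>Pow R'. ?w F1) * (1 - \<epsilon>' / 2)"
        by (rule sum_distrib_right [symmetric])
      then show ?thesis unfolding total by (simp only: mult_1_left right_diff_distrib mult_1_right mult.commute)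
    qed
    also have "\<dots> = (\<Sum>F1\<in>Pow R' - {{}}. ?w F1 * (1 - \<epsilon>' / 2))"
      using finR' R' by (subst sum.remove [of "Pow R'" "{}"]) auto
    also have "\<dots> \<le> (\<Sum>F1\<in>Pow R' - {{}}. ?w F1 * pr E' p (\<lambda>F'. \<exists>xs\<in>S. set xs \<subseteq> F1 \<union> F'))"
    proof (rule sum_mono, rule mult_left_mono)
      fix F1 assume "F1 \<in> Pow R' - {{}}"
      then obtain e where "e \<in> R'" "e \<in> F1" by blast
      then show "1 - \<epsilon>' / 2 \<le> pr E' p (\<lambda>F'. \<exists>xs\<in>S. set xs \<subseteq> F1 \<union> F')" by (rule main)
    qed (use p in auto)
    also have "\<dots> \<le> (\<Sum>F1\<in>Pow R'. ?w F1 * pr E' p (\<lambda>F'. \<exists>xs\<in>S. set xs \<subseteq> F1 \<union> F'))"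
      by (rule sum_mono2) (use finR' p in \<open>auto intro!: mult_nonneg_nonneg pr_nonneg zero_le_power\<close>)
    also have "\<dots> = pr (R' \<union> E') p (\<lambda>F. \<exists>xs\<in>S. set xs \<subseteq> F)"
      by (rule pr_Un [symmetric]) (use finR' fin in \<open>auto simp: E'_def\<close>)
    also have "R' \<union> E' = E" using R'E by (auto simp: E'_def)
    finally show ?thesis using lower by linarith
  qed
  then show ?case by blast
qed

lemma prob_ramsey_union_le_1: "0 \<le> p \<Longrightarrow> p \<le> 1 \<Longrightarrow> prob_ramsey_union l r n p G \<le> 1"
  unfolding prob_ramsey_union_def prob_gnp_eq_pr by (intro pr_le_1) auto

text \<open>\<open>f \<in> o(p)\<close> gives \<open>K * f n \<le> p n\<close> eventually for every
  constant \<open>K\<close>, so it is enough to find, for each error, a constant that works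
  uniformly in \<open>p\<close> and \<open>G\<close>.\<close>

lemma pert_upperI:
  assumes "\<And>\<epsilon>. 0 < \<epsilon> \<Longrightarrow> \<exists>K::real. 0 < K \<and> (\<exists>n0. \<forall>n\<ge>n0. \<forall>(p::real) G. 0 \<le> p \<longrightarrow> p \<le> 1 \<longrightarrow> K * f n \<le> p \<longrightarrow> is_graph n G \<longrightarrow>
     d \<le> density n G \<longrightarrow> 1 - \<epsilon> \<le> prob_ramsey_union l r n p G)"
    and f: "\<And>n. 0 \<le> f n"
  shows "pert_upper l r d f"
  unfolding pert_upper_def
proof (intro allI impI)
  fix p :: "nat \<Rightarrow> real" and G
  assume p: "\<forall>n. 0 \<le> p n \<and> p n \<le> 1" and fp: "f \<in> o(p)" and G: "\<forall>n. is_graph n (G n)"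
    and d: "\<forall>n\<ge>2. d \<le> density n (G n)"
  show "((\<lambda>n. prob_ramsey_union l r n (p n) (G n)) \<longlongrightarrow> 1) at_top"
  proof (rule tendstoI)
    fix e :: real assume e: "0 < e"
    obtain K n0 where K: "K > 0" and *: "\<And>n (p::real) G. \<lbrakk>n0 \<le> n; 0 \<le> p; p \<le> 1; K * f n \<le> p; is_graph n G; d \<le> density n G\<rbrakk>
      \<Longrightarrow> 1 - e / 2 \<le> prob_ramsey_union l r n p G" using assms(1) [OF half_gt_zero [OF e]] by blast
    have "eventually (\<lambda>n. norm (f n) \<le> 1 / K * norm (p n)) at_top"
      using landau_o.smallD [OF fp, of "1 / K"] K by simp
    moreover have "eventually (\<lambda>n. max n0 2 \<le> n) at_top" by (rule eventually_ge_at_top)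
    ultimately show "eventually (\<lambda>n. dist (prob_ramsey_union l r n (p n) (G n)) 1 < e) at_top"
    proof eventually_elim
      case (elim n)
      have "K * f n \<le> p n" using elim(1) K f [of n] p by (simp add: field_simps)
      then have "1 - e / 2 \<le> prob_ramsey_union l r n (p n) (G n)" using * [of n "p n" "G n"] elim p G d by auto
      moreover have "prob_ramsey_union l r n (p n) (G n) \<le> 1" using prob_ramsey_union_le_1 p by blast
      ultimately show ?case using e by (simp add: dist_real_def abs_real_def)
    qed
  qed
qed

definition pair_edges :: "nat \<Rightarrow> nat list \<Rightarrow> nat set list" where
  "pair_edges L zs = map (\<lambda>j. {zs ! (2 * j), zs ! Suc (2 * j)}) [0..<L]"

text \<open>Passing from a list of vertices to its list of pairs forgets only the orientation of
  each pair, one bit for each of the \<open>L\<close> pairs.\<close>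

lemma card_pair_edges_ge:
  assumes "finite B" and B: "\<And>zs. zs \<in> B \<Longrightarrow> length zs = 2 * L \<and> distinct zs"
  shows "card B \<le> card (pair_edges L ` B) * 2 ^ L"
proof -
  define \<Phi> where "\<Phi> = (\<lambda>zs. (pair_edges L zs, map (\<lambda>j. zs ! (2 * j) < zs ! Suc (2 * j)) [0..<L]))"
  have "inj_on \<Phi> B"
  proof (rule inj_onI)
    fix xs ys assume xs: "xs \<in> B" and ys: "ys \<in> B" and eq: "\<Phi> xs = \<Phi> ys"
    have pair: "xs ! (2 * j) = ys ! (2 * j) \<and> xs ! Suc (2 * j) = ys ! Suc (2 * j)" if "j < L" for j
    proof -
      have "pair_edges L xs ! j = pair_edges L ys ! j" using eq by (simp add: \<Phi>_def)
      then have "{xs ! (2 * j), xs ! Suc (2 * j)} = {ys ! (2 * j), ys ! Suc (2 * j)}"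
        using that by (simp add: pair_edges_def)
      moreover have "map (\<lambda>j. xs ! (2 * j) < xs ! Suc (2 * j)) [0..<L] ! j = map (\<lambda>j. ys ! (2 * j) < ys ! Suc (2 * j)) [0..<L] ! j"
        using eq by (simp only: \<Phi>_def prod.inject)
      then have "xs ! (2 * j) < xs ! Suc (2 * j) \<longleftrightarrow> ys ! (2 * j) < ys ! Suc (2 * j)"
        using that by simp
      ultimately show ?thesis unfolding doubleton_eq_iff by (metis less_asym' linorder_neqE_nat)
    qed
    show "xs = ys"
    proof (rule nth_equalityI)
      fix i assume "i < length xs"
      then have "i div 2 < L" using B [OF xs] by auto
      then show "xs ! i = ys ! i" using pair [of "i div 2"]
        by (cases "even i") (auto elim!: evenE oddE)
    qed (use B xs ys in auto)
  qed
  moreover have "\<Phi> ` B \<subseteq> pair_edges L ` B \<times> lists_of UNIV L" by (auto simp: \<Phi>_def lists_of_def)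
  moreover have "finite (pair_edges L ` B \<times> lists_of (UNIV :: bool set) L)" using assms by simp
  ultimately have "card B \<le> card (pair_edges L ` B \<times> lists_of (UNIV :: bool set) L)"
    by (rule card_inj_on_le)
  then show ?thesis by (simp add: card_cartesian_product card_lists_of)
qed

text \<open>A blow-up with classes of size \<open>2 * t\<close> needs only \<open>Suc k * t\<close>
  random edges, a bounded number. Since a positive proportion of all lists of edges serves,
  \<open>\<omega>(1)\<close> random edges contain one of them.\<close>

lemma pert_upper_few_edges:
  assumes l: "odd l" "2 ^ r + 1 \<le> l" and r: "0 < r" and d: "1 - 1 / 2 ^ (r - 1) < d"
  shows "pert_upper l r d (\<lambda>n. real n powr (-2))"
proof -
  define k :: nat where "k = 2 ^ (r - 1)"
  define M :: nat where "M = 2 ^ r + 1"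
  \<comment> \<open>The \<open>k + 1\<close> classes have \<open>2 * k + 2\<close> halves, so the
    quotient \<open>u div 2\<close> of \<open>u < M\<close> is a class number.\<close>
  have M: "M = 2 * k + 1" using r by (cases r) (auto simp: M_def k_def)
  define \<eta> where "\<eta> = min 1 (d - (1 - 1 / 2 ^ (r - 1)))"
  have gM: "u div 2 < M" if "u < M" for u using that by simp
  have grp: "\<not> (u div 2 = v div 2 \<and> v div 2 = w div 2)"
    if "u < M" "v < M" "w < M" "u \<noteq> v" "v \<noteq> w" "u \<noteq> w" for u v w :: nat
  proof
    assume "u div 2 = v div 2 \<and> v div 2 = w div 2"
    moreover have "u mod 2 = v mod 2 \<or> v mod 2 = w mod 2 \<or> u mod 2 = w mod 2"
      by (simp add: mod2_eq_if)
    ultimately show False using that(4-6) by (metis div_mod_decomp)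
  qed
  obtain t :: nat where t: "\<forall>G \<phi>. inj_on \<phi> ({..<M} \<times> {..<t}) \<longrightarrow>
    (\<forall>u v a b. u < M \<longrightarrow> v < M \<longrightarrow> a < t \<longrightarrow> b < t \<longrightarrow> u \<noteq> v \<longrightarrow> (u div 2 = v div 2 \<longrightarrow> a = b) \<longrightarrow>
      {\<phi> (u, a), \<phi> (v, b)} \<in> G) \<longrightarrow> cycle_ramsey l r G"
    using blowup_cycle_ramsey [of l r M "\<lambda>u. u div 2", OF l M_def r gM grp] by blast
  define L where "L = Suc k * t"
  have "1 \<le> k" "0 < \<eta>" "\<eta> \<le> 1" using d by (auto simp: k_def \<eta>_def)
  from blowups_count [OF this, of "2 * t"]
  obtain \<gamma> :: real and n0 where \<gamma>: "0 < \<gamma>" and cnt: "\<And>n G. n0 \<le> n \<Longrightarrow> is_graph n G \<Longrightarrow>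
    1 - 1 / k + \<eta> \<le> density n G \<Longrightarrow> \<gamma> * n ^ (Suc k * (2 * t)) \<le> card (blowups n G (Suc k) (2 * t))" by blast
  have len: "length zs = 2 * L" if "zs \<in> blowups n G (Suc k) (2 * t)" for zs n G
    using that by (simp add: blowups_def L_def)
  have dstn: "distinct zs \<and> set zs \<subseteq> {..<n}" if "zs \<in> blowups n G (Suc k) (2 * t)" for zs n G
    using that by (simp add: blowups_def)
  have ramsey: "cycle_ramsey l r (G \<union> F)"
    if zs: "zs \<in> blowups n G (Suc k) (2 * t)" and F: "set (pair_edges L zs) \<subseteq> F" for zs n G F
  proof -
    have dis: "distinct zs"
      and E: "\<And>i j a b. \<lbrakk>i < Suc k; j < Suc k; i \<noteq> j; a < 2 * t; b < 2 * t\<rbrakk> \<Longrightarrow>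
        {zs ! (i * (2 * t) + a), zs ! (j * (2 * t) + b)} \<in> G"
      using zs by (auto simp: blowups_def)
    \<comment> \<open>The classes \<open>2i\<close> and \<open>2i + 1\<close> of the new blow-up are the two sides of the matching
      \<open>pair_edges\<close> inside the class \<open>i\<close> of the old one.\<close>
    define q where "q = (\<lambda>x. (fst x div 2) * t + snd x :: nat)"
    define idx where "idx = (\<lambda>x. 2 * q x + fst x mod 2)"
    have qL: "q (u, a) < L" if "u < M" "a < t" for u a
    proof -
      have "q (u, a) < Suc (u div 2) * t" using that by (simp add: q_def)
      also have "\<dots> \<le> Suc k * t" using that M by (intro mult_le_mono1) simp
      finally show ?thesis by (simp add: L_def)
    qed
    have idxL: "idx (u, a) < length zs" if "u < M" "a < t" for u a
    proof -
      have "u mod 2 < 2" by simp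
      then show ?thesis using qL [OF that] len [OF zs] unfolding idx_def fst_conv by linarith
    qed
    show ?thesis
    proof (rule t [THEN spec, of "G \<union> F", THEN spec, of "\<lambda>x. zs ! idx x", THEN mp, THEN mp])
      show "inj_on (\<lambda>x. zs ! idx x) ({..<M} \<times> {..<t})"
      proof (rule inj_onI)
        fix x y assume x: "x \<in> {..<M} \<times> {..<t}" and y: "y \<in> {..<M} \<times> {..<t}"
          and eq: "zs ! idx x = zs ! idx y"
        have "idx x < length zs" "idx y < length zs"
          using x y idxL [of "fst x" "snd x"] idxL [of "fst y" "snd y"] by auto
        then have "idx x = idx y" using dis eq by (simp add: nth_eq_iff_index_eq)
        then have "idx x div 2 = idx y div 2" and m2: "idx x mod 2 = idx y mod 2" by simp_all
        then have "q x = q y" by (simp add: idx_def)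
        then have "q x div t = q y div t" "q x mod t = q y mod t" by simp_all
        moreover have "snd x < t" "snd y < t" using x y by auto
        ultimately have "fst x div 2 = fst y div 2" "snd x = snd y" by (simp_all add: q_def)
        moreover have "fst x mod 2 = fst y mod 2" using m2 by (simp add: idx_def)
        ultimately show "x = y" by (metis div_mod_decomp prod_eqI)
      qed
      show "\<forall>u v a b. u < M \<longrightarrow> v < M \<longrightarrow> a < t \<longrightarrow> b < t \<longrightarrow> u \<noteq> v \<longrightarrow> (u div 2 = v div 2 \<longrightarrow> a = b) \<longrightarrow>
        {zs ! idx (u, a), zs ! idx (v, b)} \<in> G \<union> F"
      proof (intro allI impI)
        fix u v a b assume *: "u < M" "v < M" "a < t" "b < t" "u \<noteq> v" "u div 2 = v div 2 \<longrightarrow> a = b"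
        show "{zs ! idx (u, a), zs ! idx (v, b)} \<in> G \<union> F"
        proof (cases "u div 2 = v div 2")
          case False
          have two: "u mod 2 < 2" "v mod 2 < 2" by simp_all
          have "2 * a + u mod 2 < 2 * t" "2 * b + v mod 2 < 2 * t" using * two by linarith+
          moreover have "u div 2 < Suc k" "v div 2 < Suc k" using * M by simp_all
          ultimately have "{zs ! ((u div 2) * (2 * t) + (2 * a + u mod 2)), zs ! ((v div 2) * (2 * t) + (2 * b + v mod 2))} \<in> G"
            using E False by blast
          then show ?thesis by (simp add: idx_def q_def algebra_simps)
        next
          case True
          then have "a = b" "q (u, a) = q (v, b)" using * by (simp_all add: q_def)
          moreover have "u mod 2 = 0 \<and> v mod 2 = 1 \<or> u mod 2 = 1 \<and> v mod 2 = 0"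
            using True * by (metis div_mod_decomp parity_cases even_iff_mod_2_eq_zero odd_iff_mod_2_eq_one)
          ultimately have "{zs ! idx (u, a), zs ! idx (v, b)} = {zs ! (2 * q (u, a)), zs ! Suc (2 * q (u, a))}"
            by (auto simp: idx_def)
          also have "\<dots> \<in> set (pair_edges L zs)"
            using qL [of u a] * by (auto simp: pair_edges_def)
          finally show ?thesis using F by blast
        qed
      qed
    qed
  qed
  show ?thesis
  proof (rule pert_upperI)
    fix \<epsilon> :: real assume \<epsilon>: "0 < \<epsilon>"
    obtain K' :: real where K': "\<And>(E :: nat set set) (p::real) S. \<lbrakk>finite E; 0 \<le> p; p \<le> 1; K' \<le> p * card E;
      S \<subseteq> lists_of E L; \<gamma> * real (card E) ^ L \<le> card S\<rbrakk> \<Longrightarrow>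
      1 - \<epsilon> \<le> pr E p (\<lambda>F. \<exists>xs\<in>S. set xs \<subseteq> F)"
      using pr_hits_dense_lists [OF \<gamma> \<epsilon>] by blast
    \<comment> \<open>The factor 4 pays for \<open>n ^ 2 / 4 \<le> C\<close>, so that
      \<open>p * C \<ge> K'\<close>.\<close>
    define K where "K = 4 * max K' 1"
    have main: "1 - \<epsilon> \<le> prob_ramsey_union l r n p G"
      if n: "max n0 2 \<le> n" and p: "0 \<le> p" "p \<le> 1" and Kp: "K * real n powr (-2) \<le> p"
        and G: "is_graph n G" and dG: "d \<le> density n G" for n G and p :: real
    proof -
      define B where "B = blowups n G (Suc k) (2 * t)"
      define C where "C = real (card (all_edges n))"
      have n2: "2 \<le> n" using n by simp
      have C: "C = real n * (real n - 1) / 2"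
        using n2 choose_two [of n] by (simp add: C_def card_all_edges real_of_nat_div of_nat_diff)
      have "2 * real n \<le> real n * real n" using n2 by (intro mult_right_mono) auto
      then have C4: "real n ^ 2 / 4 \<le> C" and C2: "2 * C \<le> real n ^ 2"
        using C by (simp_all add: power2_eq_square algebra_simps)
      have finB: "finite B"
        by (rule finite_subset [OF _ finite_lists_of [of "{..<n}" "Suc k * (2 * t)"]])
          (auto simp: B_def blowups_def lists_of_def)
      have "1 - 1 / k + \<eta> \<le> density n G" using dG by (simp add: k_def \<eta>_def)
      then have "\<gamma> * real n ^ (Suc k * (2 * t)) \<le> card B" using cnt [of n G] n G by (simp add: B_def)
      then have "\<gamma> * (real n ^ 2) ^ L \<le> card B" by (simp add: L_def algebra_simps flip: power_mult)
      moreover have "\<gamma> * (2 * C) ^ L \<le> \<gamma> * (real n ^ 2) ^ L"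
        using C2 \<gamma> by (intro mult_left_mono power_mono) (auto simp: C_def)
      \<comment> \<open>The \<open>2 ^ L\<close> orientations cancel against
        \<open>(2 * C) ^ L \<le> (n ^ 2) ^ L\<close>, so the proportion \<open>\<gamma>\<close>
        carries over from vertex lists to edge lists.\<close>
      moreover have "card B \<le> card (pair_edges L ` B) * 2 ^ L"
        by (rule card_pair_edges_ge [OF finB]) (use len dstn B_def in blast)
      then have "real (card B) \<le> card (pair_edges L ` B) * 2 ^ L"
        by (metis of_nat_mono of_nat_mult of_nat_numeral of_nat_power)
      ultimately have "\<gamma> * (2 * C) ^ L \<le> card (pair_edges L ` B) * 2 ^ L" by linarith
      then have "(\<gamma> * C ^ L) * 2 ^ L \<le> card (pair_edges L ` B) * 2 ^ L"
        by (simp only: power_mult_distrib mult_ac)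
      then have cS: "\<gamma> * C ^ L \<le> card (pair_edges L ` B)" by simp
      have sub: "pair_edges L ` B \<subseteq> lists_of (all_edges n) L"
      proof
        fix es assume "es \<in> pair_edges L ` B"
        then obtain zs where zs: "zs \<in> B" "es = pair_edges L zs" by blast
        have "{zs ! (2 * j), zs ! Suc (2 * j)} \<in> all_edges n" if "j < L" for j
        proof -
          have "2 * j < length zs" "Suc (2 * j) < length zs" using len zs(1) that by (auto simp: B_def)
          moreover have "distinct zs" "set zs \<subseteq> {..<n}" using zs(1) dstn B_def by blast+
          ultimately have "zs ! (2 * j) \<in> {..<n}" "zs ! Suc (2 * j) \<in> {..<n}" "zs ! (2 * j) \<noteq> zs ! Suc (2 * j)"
            using nth_mem by (blast, blast, simp add: nth_eq_iff_index_eq)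
          then show ?thesis by (auto simp: all_edges_def)
        qed
        then show "es \<in> lists_of (all_edges n) L" using zs(2) by (auto simp: pair_edges_def lists_of_def)
      qed
      have "K' \<le> K / 4" by (simp add: K_def)
      also have "\<dots> = K * real n powr (-2) * (real n ^ 2 / 4)"
        using n2 by (simp add: powr_minus powr_numeral field_simps)
      also have "\<dots> \<le> p * C"
        using Kp C4 p by (intro mult_mono) auto
      finally have "K' \<le> p * card (all_edges n)" by (simp add: C_def)
      then have "1 - \<epsilon> \<le> pr (all_edges n) p (\<lambda>F. \<exists>xs\<in>pair_edges L ` B. set xs \<subseteq> F)"
        using cS sub p by (intro K') (auto simp: C_def)
      also have "\<dots> \<le> pr (all_edges n) p (\<lambda>F. cycle_ramsey l r (G \<union> F))"
        by (rule pr_mono [OF p]) (use ramsey in \<open>auto simp: B_def\<close>)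
      finally show ?thesis by (simp add: prob_ramsey_union_def prob_gnp_eq_pr)
    qed
    have "\<exists>n0. \<forall>n\<ge>n0. \<forall>(p::real) G. 0 \<le> p \<longrightarrow> p \<le> 1 \<longrightarrow> K * real n powr (-2) \<le> p \<longrightarrow> is_graph n G \<longrightarrow>
     d \<le> density n G \<longrightarrow> 1 - \<epsilon> \<le> prob_ramsey_union l r n p G"
      by (rule exI [of _ "max n0 2"], intro allI impI, rule main)
    moreover have "0 < K" by (simp add: K_def)
    ultimately show "\<exists>K::real. 0 < K \<and> (\<exists>n0. \<forall>n\<ge>n0. \<forall>(p::real) G. 0 \<le> p \<longrightarrow> p \<le> 1 \<longrightarrow>
      K * real n powr (-2) \<le> p \<longrightarrow> is_graph n G \<longrightarrow> d \<le> density n G \<longrightarrow>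
      1 - \<epsilon> \<le> prob_ramsey_union l r n p G)"
      by (rule_tac exI [of _ K], rule_tac conjI)
  qed simp
qed

section \<open>Hypergraph containers\<close>

definition hdeg :: "'a set set \<Rightarrow> 'a set \<Rightarrow> nat" where
  "hdeg \<G> L = card {E\<in>\<G>. L \<subseteq> E}"

text \<open>\<open>fp\<close> assigns fingerprints of size at most \<open>b\<close> and \<open>ct\<close> containers satisfying \<open>Q\<close> to the
  independent sets of the hypergraph \<open>\<G>\<close>.  The last conjunct says that the fingerprint determines
  the container; it is stated for all sets between \<open>fp I\<close> and \<open>I\<close> because this form is
  preserved when one algorithm continues on the containers of another.\<close>

definition container_maps ::
    "'a set \<Rightarrow> 'a set set \<Rightarrow> real \<Rightarrow> ('a set \<Rightarrow> bool) \<Rightarrow> ('a set \<Rightarrow> 'a set) \<Rightarrow> ('a set \<Rightarrow> 'a set) \<Rightarrow> bool" where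
  "container_maps W \<G> b Q fp ct \<longleftrightarrow> (\<forall>I. I \<subseteq> W \<longrightarrow> (\<forall>E\<in>\<G>. \<not> E \<subseteq> I) \<longrightarrow>
     fp I \<subseteq> I \<and> real (card (fp I)) \<le> b \<and> I \<subseteq> ct I \<and> ct I \<subseteq> W \<and> Q (ct I) \<and>
     (\<forall>J. fp I \<subseteq> J \<longrightarrow> J \<subseteq> I \<longrightarrow> fp J = fp I \<and> ct J = ct I))"

definition containers :: "'a set \<Rightarrow> 'a set set \<Rightarrow> real \<Rightarrow> ('a set \<Rightarrow> bool) \<Rightarrow> bool" where
  "containers W \<G> b Q \<longleftrightarrow> (\<exists>fp ct. container_maps W \<G> b Q fp ct)"

lemma container_mapsD:
  assumes "container_maps W \<G> b Q fp ct" "I \<subseteq> W" "\<forall>E\<in>\<G>. \<not> E \<subseteq> I"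
  shows "fp I \<subseteq> I" "real (card (fp I)) \<le> b" "I \<subseteq> ct I" "ct I \<subseteq> W" "Q (ct I)"
    "\<And>J. fp I \<subseteq> J \<Longrightarrow> J \<subseteq> I \<Longrightarrow> fp J = fp I \<and> ct J = ct I"
proof -
  note D = assms(1) [unfolded container_maps_def, THEN spec, of I, THEN mp, OF assms(2), THEN mp, OF assms(3)]
  show "fp I \<subseteq> I" by (rule D [THEN conjunct1])
  show "real (card (fp I)) \<le> b" by (rule D [THEN conjunct2, THEN conjunct1])
  show "I \<subseteq> ct I" by (rule D [THEN conjunct2, THEN conjunct2, THEN conjunct1])
  show "ct I \<subseteq> W" by (rule D [THEN conjunct2, THEN conjunct2, THEN conjunct2, THEN conjunct1])
  show "Q (ct I)" by (rule D [THEN conjunct2, THEN conjunct2, THEN conjunct2, THEN conjunct2, THEN conjunct1])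
  show "fp J = fp I \<and> ct J = ct I" if "fp I \<subseteq> J" "J \<subseteq> I" for J
    by (rule D [THEN conjunct2, THEN conjunct2, THEN conjunct2, THEN conjunct2, THEN conjunct2, THEN spec, THEN mp, OF that(1), THEN mp, OF that(2)])
qed

lemma containersI:
  assumes "\<And>I. I \<subseteq> W \<Longrightarrow> \<forall>E\<in>\<G>. \<not> E \<subseteq> I \<Longrightarrow>
     fp I \<subseteq> I \<and> real (card (fp I)) \<le> b \<and> I \<subseteq> ct I \<and> ct I \<subseteq> W \<and> Q (ct I)"
    "\<And>I J. I \<subseteq> W \<Longrightarrow> \<forall>E\<in>\<G>. \<not> E \<subseteq> I \<Longrightarrow> fp I \<subseteq> J \<Longrightarrow> J \<subseteq> I \<Longrightarrow> fp J = fp I \<and> ct J = ct I"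
  shows "containers W \<G> b Q"
proof -
  have "container_maps W \<G> b Q fp ct"
    unfolding container_maps_def
  proof (intro allI impI)
    fix I assume I: "I \<subseteq> W" "\<forall>E\<in>\<G>. \<not> E \<subseteq> I"
    have "\<forall>J. fp I \<subseteq> J \<longrightarrow> J \<subseteq> I \<longrightarrow> fp J = fp I \<and> ct J = ct I"
      by (intro allI impI) (rule assms(2) [OF I])
    then show "fp I \<subseteq> I \<and> real (card (fp I)) \<le> b \<and> I \<subseteq> ct I \<and> ct I \<subseteq> W \<and> Q (ct I) \<and>
       (\<forall>J. fp I \<subseteq> J \<longrightarrow> J \<subseteq> I \<longrightarrow> fp J = fp I \<and> ct J = ct I)"
      using assms(1) [OF I] by blast
  qed
  then show ?thesis unfolding containers_def by blast
qed

lemma containers_leaf: "0 \<le> b \<Longrightarrow> Q W \<Longrightarrow> containers W \<G> b Q"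
  by (rule containersI [of _ _ "\<lambda>_. {}" _ "\<lambda>_. W"]) auto

lemma containers_mono:
  assumes "containers W \<G> b Q" "b \<le> b'" "\<G> \<subseteq> \<G>'" "\<And>C. C \<subseteq> W \<Longrightarrow> Q C \<Longrightarrow> Q' C"
  shows "containers W \<G>' b' Q'"
proof -
  from assms(1) obtain fp ct where m: "container_maps W \<G> b Q fp ct" by (auto simp: containers_def)
  show ?thesis
  proof (rule containersI [of _ _ fp _ ct])
    fix I assume I: "I \<subseteq> W" "\<forall>E\<in>\<G>'. \<not> E \<subseteq> I"
    then have "\<forall>E\<in>\<G>. \<not> E \<subseteq> I" using assms(3) by blast
    note D = container_mapsD [OF m I(1) this]
    show "fp I \<subseteq> I \<and> real (card (fp I)) \<le> b' \<and> I \<subseteq> ct I \<and> ct I \<subseteq> W \<and> Q' (ct I)"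
      using D(1-5) assms(2) assms(4) [of "ct I"] by (metis order_trans)
    show "fp J = fp I \<and> ct J = ct I" if "fp I \<subseteq> J" "J \<subseteq> I" for J by (rule D(6) [OF that])
  qed
qed

text \<open>A vertex that is itself an edge lies in no independent set, so it is removed from every
  container at no cost.\<close>

lemma containers_singletons:
  assumes "containers (W - {v. {v} \<in> \<G>}) \<G> b Q"
  shows "containers W \<G> b Q"
proof -
  from assms obtain fp ct where m: "container_maps (W - {v. {v} \<in> \<G>}) \<G> b Q fp ct"
    by (auto simp: containers_def)
  show ?thesis
  proof (rule containersI [of _ _ fp _ ct])
    fix I assume I: "I \<subseteq> W" "\<forall>E\<in>\<G>. \<not> E \<subseteq> I"
    then have I': "I \<subseteq> W - {v. {v} \<in> \<G>}" "\<forall>E\<in>\<G>. \<not> E \<subseteq> I" by auto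
    note D = container_mapsD [OF m I']
    show "fp I \<subseteq> I \<and> real (card (fp I)) \<le> b \<and> I \<subseteq> ct I \<and> ct I \<subseteq> W \<and> Q (ct I)"
      using D(1-5) by auto
    show "fp J = fp I \<and> ct J = ct I" if "fp I \<subseteq> J" "J \<subseteq> I" for J by (rule D(6) [OF that])
  qed
qed

text \<open>One step of the algorithm: ask whether \<open>v \<in> I\<close>. If so, \<open>v\<close>
  joins the fingerprint, and links of \<open>v\<close> become further sets that \<open>I\<close>
  cannot contain. If not, \<open>v\<close> is deleted for free. A set between \<open>fp I\<close>
  and \<open>I\<close> gives the same answer as \<open>I\<close>.\<close>

lemma containers_query:
  assumes yes: "containers W \<G>1 b Q" and no: "containers (W - {v}) \<G> (b + 1) Q"
    and G1: "\<And>E. E \<in> \<G>1 \<Longrightarrow> E \<in> \<G> \<or> insert v E \<in> \<G>"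
  shows "containers W \<G> (b + 1) Q"
proof -
  from yes obtain fp1 ct1 where m1: "container_maps W \<G>1 b Q fp1 ct1" by (auto simp: containers_def)
  from no obtain fp0 ct0 where m0: "container_maps (W - {v}) \<G> (b + 1) Q fp0 ct0" by (auto simp: containers_def)
  define fp where "fp = (\<lambda>I. if v \<in> I then insert v (fp1 I) else fp0 I)"
  define ct where "ct = (\<lambda>I. if v \<in> I then ct1 I else ct0 I)"
  show ?thesis
  proof (rule containersI [of _ _ fp _ ct])
    fix I assume I: "I \<subseteq> W" "\<forall>E\<in>\<G>. \<not> E \<subseteq> I"
    show "fp I \<subseteq> I \<and> real (card (fp I)) \<le> b + 1 \<and> I \<subseteq> ct I \<and> ct I \<subseteq> W \<and> Q (ct I)"
    proof (cases "v \<in> I")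
      case True
      have ind: "\<forall>E\<in>\<G>1. \<not> E \<subseteq> I" using I(2) G1 True by (metis insert_subset)
      note D = container_mapsD [OF m1 I(1) ind]
      have "card (insert v (fp1 I)) \<le> Suc (card (fp1 I))" by (rule card_insert_le_m1) simp_all
      moreover have "real (card (fp1 I)) \<le> b" by (rule D(2))
      ultimately have "real (card (insert v (fp1 I))) \<le> b + 1" by linarith
      moreover have "fp1 I \<subseteq> I" "I \<subseteq> ct1 I" "ct1 I \<subseteq> W" "Q (ct1 I)" by (rule D)+
      ultimately show ?thesis using True unfolding fp_def ct_def by simp
    next
      case False
      then have I': "I \<subseteq> W - {v}" using I by blast
      note D = container_mapsD [OF m0 I' I(2)]
      have "fp0 I \<subseteq> I" "real (card (fp0 I)) \<le> b + 1" "I \<subseteq> ct0 I" "ct0 I \<subseteq> W - {v}" "Q (ct0 I)"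
        by (rule D)+
      then show ?thesis using False unfolding fp_def ct_def by auto
    qed
  next
    fix I J assume I: "I \<subseteq> W" "\<forall>E\<in>\<G>. \<not> E \<subseteq> I" and J: "fp I \<subseteq> J" "J \<subseteq> I"
    show "fp J = fp I \<and> ct J = ct I"
    proof (cases "v \<in> I")
      case True
      have ind: "\<forall>E\<in>\<G>1. \<not> E \<subseteq> I" using I(2) G1 True by (metis insert_subset)
      have "v \<in> J" "fp1 I \<subseteq> J" using J True by (auto simp: fp_def)
      then have "fp1 J = fp1 I \<and> ct1 J = ct1 I" using container_mapsD(6) [OF m1 I(1) ind _ J(2)] by blast
      then show ?thesis using True \<open>v \<in> J\<close> by (simp only: fp_def ct_def if_True)
    next
      case False
      then have I': "I \<subseteq> W - {v}" using I by blast
      have "v \<notin> J" "fp0 I \<subseteq> J" using J False by (auto simp: fp_def)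
      then have "fp0 J = fp0 I \<and> ct0 J = ct0 I" using container_mapsD(6) [OF m0 I' I(2) _ J(2)] by blast
      then show ?thesis using False \<open>v \<notin> J\<close> by (simp only: fp_def ct_def if_False)
    qed
  qed
qed

text \<open>The fingerprint is the union of both fingerprints: a set between it and \<open>I\<close>
  has the same first container, and then the same second one.\<close>

lemma containers_compose:
  assumes first: "containers W \<G> b1 Q1" and second: "\<And>C. C \<subseteq> W \<Longrightarrow> Q1 C \<Longrightarrow> containers C \<G> b2 Q2"
  shows "containers W \<G> (b1 + b2) Q2"
proof -
  from first obtain fp1 ct1 where m1: "container_maps W \<G> b1 Q1 fp1 ct1" by (auto simp: containers_def)
  have "\<forall>C. \<exists>fp ct. C \<subseteq> W \<and> Q1 C \<longrightarrow> container_maps C \<G> b2 Q2 fp ct"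
    using second unfolding containers_def by blast
  then obtain fp2 ct2 where m2: "\<And>C. C \<subseteq> W \<Longrightarrow> Q1 C \<Longrightarrow> container_maps C \<G> b2 Q2 (fp2 C) (ct2 C)" by metis
  define fp where "fp = (\<lambda>I. fp1 I \<union> fp2 (ct1 I) I)"
  define ct where "ct = (\<lambda>I. ct2 (ct1 I) I)"
  show ?thesis
  proof (rule containersI [of _ _ fp _ ct])
    fix I assume I: "I \<subseteq> W" "\<forall>E\<in>\<G>. \<not> E \<subseteq> I"
    note A = container_mapsD [OF m1 I]
    note B = container_mapsD [OF m2 [OF A(4,5)] A(3) I(2)]
    have "card (fp I) \<le> card (fp1 I) + card (fp2 (ct1 I) I)"
      unfolding fp_def by (rule card_Un_le)
    then have "real (card (fp I)) \<le> b1 + b2" using A(2) B(2) by linarith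
    then show "fp I \<subseteq> I \<and> real (card (fp I)) \<le> b1 + b2 \<and> I \<subseteq> ct I \<and> ct I \<subseteq> W \<and> Q2 (ct I)"
      using A(1,3,4) B(1,3,4,5) unfolding fp_def ct_def by auto
    show "fp J = fp I \<and> ct J = ct I" if "fp I \<subseteq> J" "J \<subseteq> I" for J
    proof -
      have "fp1 J = fp1 I \<and> ct1 J = ct1 I"
        by (rule A(6)) (use that in \<open>auto simp: fp_def\<close>)
      moreover have "fp2 (ct1 I) J = fp2 (ct1 I) I \<and> ct2 (ct1 I) J = ct2 (ct1 I) I"
        by (rule B(6)) (use that in \<open>auto simp: fp_def\<close>)
      ultimately show ?thesis by (simp add: fp_def ct_def)
    qed
  qed
qed

text \<open>Containers of a larger ground set are cut down to \<open>W\<close>. This lets the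
  induction hypothesis be used on the original ground set, although vertices have been deleted
  meanwhile.\<close>

lemma containers_restrict:
  assumes "containers W0 \<G> b Q" "W \<subseteq> W0" "\<And>C C'. C' \<subseteq> C \<Longrightarrow> C \<subseteq> W0 \<Longrightarrow> Q C \<Longrightarrow> Q C'"
  shows "containers W \<G> b Q"
proof -
  from assms(1) obtain fp ct where m: "container_maps W0 \<G> b Q fp ct" by (auto simp: containers_def)
  show ?thesis
  proof (rule containersI [of _ _ fp _ "\<lambda>I. ct I \<inter> W"])
    fix I assume I: "I \<subseteq> W" "\<forall>E\<in>\<G>. \<not> E \<subseteq> I"
    then have "I \<subseteq> W0" using assms(2) by blast
    note D = container_mapsD [OF m this I(2)]
    have "Q (ct I \<inter> W)" by (rule assms(3) [OF _ D(4) D(5)]) auto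
    then show "fp I \<subseteq> I \<and> real (card (fp I)) \<le> b \<and> I \<subseteq> ct I \<inter> W \<and> ct I \<inter> W \<subseteq> W \<and> Q (ct I \<inter> W)"
      using D(1-3) I(1) by blast
    show "fp J = fp I \<and> ct J \<inter> W = ct I \<inter> W" if "fp I \<subseteq> J" "J \<subseteq> I" for J
      using D(6) [OF that] by blast
  qed
qed

text \<open>The degree condition of the container lemma, with \<open>1 / x\<close> in the role of \<open>\<tau>\<close>.\<close>

definition spread :: "'a set \<Rightarrow> nat \<Rightarrow> real \<Rightarrow> real \<Rightarrow> 'a set set \<Rightarrow> bool" where
  "spread W k \<Lambda> x \<G> \<longleftrightarrow> (\<forall>E\<in>\<G>. E \<subseteq> W \<and> card E = k) \<and>
    (\<forall>L. L \<subseteq> W \<longrightarrow> L \<noteq> {} \<longrightarrow> card L \<le> k \<longrightarrow> real (hdeg \<G> L) \<le> \<Lambda> * x ^ (k - card L))"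

lemma spread_finite: "finite W \<Longrightarrow> spread W k \<Lambda> x \<G> \<Longrightarrow> finite \<G>"
  by (rule finite_subset [of _ "Pow W"]) (auto simp: spread_def)

lemma hdeg_double_count:
  assumes "finite \<G>" "finite S" "\<And>E. E \<in> \<G> \<Longrightarrow> finite E \<and> card E = s"
  shows "(\<Sum>L\<in>S. hdeg \<G> L) \<le> 2 ^ s * card \<G>"
proof -
  have "(\<Sum>L\<in>S. hdeg \<G> L) = (\<Sum>L\<in>S. \<Sum>E\<in>\<G>. if L \<subseteq> E then 1 else 0)"
    using assms(1) by (simp add: hdeg_def sum.If_cases Int_def)
  also have "\<dots> = (\<Sum>E\<in>\<G>. \<Sum>L\<in>S. if L \<subseteq> E then 1 else 0)" by (rule sum.swap)
  also have "\<dots> \<le> (\<Sum>E\<in>\<G>. 2 ^ s)"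
  proof (rule sum_mono)
    fix E assume E: "E \<in> \<G>"
    have "(\<Sum>L\<in>S. if L \<subseteq> E then 1 else 0) = card {L\<in>S. L \<subseteq> E}"
      using assms(2) by (simp add: sum.If_cases Int_def)
    also have "\<dots> \<le> card (Pow E)" using assms(3) [OF E] by (intro card_mono) auto
    also have "\<dots> = 2 ^ s" using assms(3) [OF E] by (simp add: card_Pow)
    finally show "(\<Sum>L\<in>S. if L \<subseteq> E then 1 else 0) \<le> (2 ^ s :: nat)" .
  qed
  finally show ?thesis by (simp add: mult.commute)
qed

text \<open>\<open>\<G>\<close> collects links of vertices already selected.  The members of \<open>\<A>\<close> that meet a removed
  vertex or contain a set whose degree in \<open>\<G>\<close> is saturated are a minority, so some vertex has many
  admissible links; adding them raises each degree by at most the amount its bound allows.\<close>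

lemma container_select_vertex:
  fixes c \<Lambda> x N :: real
  assumes fin: "finite W0" and x: "1 \<le> x" and N: "real (card W0) \<le> N" "0 < N" and s: "1 \<le> s"
    and c: "0 < c" and \<Lambda>: "1 \<le> \<Lambda>"
    and A: "spread W0 (Suc s) \<Lambda> x \<A>" "c * x ^ s * N \<le> card \<A>"
    and G: "spread W0 s (1 + \<Lambda>) x \<G>" "card \<G> \<le> c / (2 ^ (s + 2) * \<Lambda>) * x ^ (s - 1) * N"
    and W: "W \<subseteq> W0" "real (card W0) - card W \<le> c / (4 * \<Lambda>) * N"
  obtains v \<G>1 where "v \<in> W" "spread W0 s (1 + \<Lambda>) x \<G>1" "card \<G> + c / 4 * x ^ s \<le> card \<G>1"
    "\<G> \<subseteq> \<G>1" "\<And>E. E \<in> \<G>1 \<Longrightarrow> E \<in> \<G> \<or> insert v E \<in> \<A>"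
proof -
  have finA: "finite \<A>" and finG: "finite \<G>" using spread_finite [OF fin] A G by blast+
  have Auni: "E \<subseteq> W0 \<and> card E = Suc s" if "E \<in> \<A>" for E using A(1) that by (simp add: spread_def)
  have Guni: "E \<subseteq> W0 \<and> card E = s" if "E \<in> \<G>" for E using G(1) that by (simp add: spread_def)
  have Adeg: "real (hdeg \<A> L) \<le> \<Lambda> * x ^ (Suc s - card L)" if "L \<subseteq> W0" "L \<noteq> {}" "card L \<le> Suc s" for L
    using A(1) that by (simp add: spread_def)
  have Gdeg: "real (hdeg \<G> L) \<le> (1 + \<Lambda>) * x ^ (s - card L)" if "L \<subseteq> W0" "L \<noteq> {}" "card L \<le> s" for L
    using G(1) that by (simp add: spread_def)
  \<comment> \<open>Saturation means degree at least \<open>x ^ (s - card L)\<close>. Below it, one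
    further link adds at most \<open>\<Lambda> * x ^ (s - card L)\<close>, so the bound with
    \<open>1 + \<Lambda>\<close> survives.\<close>
  define Sat where "Sat = {L. L \<subseteq> W0 \<and> L \<noteq> {} \<and> card L \<le> s \<and> x ^ (s - card L) \<le> hdeg \<G> L}"
  have finSat: "finite Sat" by (rule finite_subset [of _ "Pow W0"]) (use fin in \<open>auto simp: Sat_def\<close>)
  define Av where "Av = {E\<in>\<A>. E \<subseteq> W \<and> \<not> (\<exists>L\<in>Sat. L \<subseteq> E)}"
  have "\<A> \<subseteq> Av \<union> (\<Union>v\<in>W0 - W. {E\<in>\<A>. {v} \<subseteq> E}) \<union> (\<Union>L\<in>Sat. {E\<in>\<A>. L \<subseteq> E})"
    using Auni by (auto simp: Av_def)
  then have "card \<A> \<le> card (Av \<union> (\<Union>v\<in>W0 - W. {E\<in>\<A>. {v} \<subseteq> E}) \<union> (\<Union>L\<in>Sat. {E\<in>\<A>. L \<subseteq> E}))"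
    using fin finA finSat by (intro card_mono) (auto simp: Av_def)
  also have "\<dots> \<le> card Av + card (\<Union>v\<in>W0 - W. {E\<in>\<A>. {v} \<subseteq> E}) + card (\<Union>L\<in>Sat. {E\<in>\<A>. L \<subseteq> E})"
    by (meson add_le_mono1 card_Un_le order_trans)
  also have "\<dots> \<le> card Av + (\<Sum>v\<in>W0 - W. hdeg \<A> {v}) + (\<Sum>L\<in>Sat. hdeg \<A> L)"
    unfolding hdeg_def using fin finSat by (intro add_mono card_UN_le order_refl) auto
  finally have cA: "real (card \<A>) \<le> card Av + (\<Sum>v\<in>W0 - W. real (hdeg \<A> {v})) + (\<Sum>L\<in>Sat. real (hdeg \<A> L))"
    by (simp flip: of_nat_sum of_nat_add)
  have "(\<Sum>v\<in>W0 - W. real (hdeg \<A> {v})) \<le> (\<Sum>v\<in>W0 - W. \<Lambda> * x ^ s)"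
    using Adeg by (intro sum_mono) force
  also have "\<dots> = (real (card W0) - card W) * (\<Lambda> * x ^ s)"
    using fin W(1) finite_subset [OF W(1) fin] card_mono [OF fin W(1)] by (simp add: card_Diff_subset of_nat_diff)
  also have "\<dots> \<le> (c / (4 * \<Lambda>) * N) * (\<Lambda> * x ^ s)"
    using W(2) \<Lambda> x by (intro mult_right_mono) auto
  also have "\<dots> = c / 4 * x ^ s * N" using \<Lambda> by simp
  finally have lost1: "(\<Sum>v\<in>W0 - W. real (hdeg \<A> {v})) \<le> c / 4 * x ^ s * N" .
  \<comment> \<open>For a saturated set the degree in \<open>\<A>\<close> is bounded by
    \<open>\<Lambda> * x\<close> times the degree in \<open>\<G>\<close>. Double counting then
    charges the lost members of \<open>\<A>\<close> to \<open>card \<G>\<close>, which is still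
    small.\<close>
  have "(\<Sum>L\<in>Sat. real (hdeg \<A> L)) \<le> (\<Sum>L\<in>Sat. \<Lambda> * x * real (hdeg \<G> L))"
  proof (rule sum_mono)
    fix L assume L: "L \<in> Sat"
    then have "real (hdeg \<A> L) \<le> \<Lambda> * x ^ (Suc s - card L)" by (intro Adeg) (auto simp: Sat_def)
    also have "\<dots> = \<Lambda> * x * x ^ (s - card L)" using L by (simp add: Sat_def Suc_diff_le)
    also have "\<dots> \<le> \<Lambda> * x * real (hdeg \<G> L)"
      using L \<Lambda> x by (intro mult_left_mono) (auto simp: Sat_def)
    finally show "real (hdeg \<A> L) \<le> \<Lambda> * x * real (hdeg \<G> L)" .
  qed
  also have "\<dots> = \<Lambda> * x * real (\<Sum>L\<in>Sat. hdeg \<G> L)" by (simp add: sum_distrib_left)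
  also have "\<dots> \<le> \<Lambda> * x * real (2 ^ s * card \<G>)"
  proof (intro mult_left_mono of_nat_mono hdeg_double_count finG finSat)
    fix E assume "E \<in> \<G>"
    then show "finite E \<and> card E = s" using Guni fin finite_subset by blast
  qed (use \<Lambda> x in auto)
  also have "\<dots> = \<Lambda> * x * 2 ^ s * card \<G>" by simp
  also have "\<dots> \<le> \<Lambda> * x * 2 ^ s * (c / (2 ^ (s + 2) * \<Lambda>) * x ^ (s - 1) * N)"
    using G(2) \<Lambda> x by (intro mult_left_mono) auto
  also have "\<dots> = c / 4 * (x * x ^ (s - 1)) * N" using \<Lambda> by (simp add: power_add field_simps)
  also have "x * x ^ (s - 1) = x ^ s" using s by (cases s) auto
  finally have lost2: "(\<Sum>L\<in>Sat. real (hdeg \<A> L)) \<le> c / 4 * x ^ s * N" .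
  have cAv: "c / 2 * x ^ s * N \<le> card Av" using cA lost1 lost2 A(2) by linarith
  have finW: "finite W" using W(1) fin finite_subset by blast
  have finAv: "finite Av" using finA by (simp add: Av_def)
  \<comment> \<open>Averaging: otherwise the members of \<open>Av\<close>, each containing at least
    one vertex of \<open>W\<close>, would number at most half of what \<open>cAv\<close>
    guarantees.\<close>
  obtain v where v: "v \<in> W" "c / 4 * x ^ s \<le> card {E\<in>Av. v \<in> E}"
  proof (rule ccontr)
    assume *: "\<not> thesis"
    have "real (card Av) \<le> real (\<Sum>E\<in>Av. card E)"
    proof (rule of_nat_mono)
      have "card Av = (\<Sum>E\<in>Av. 1)" by simp
      also have "\<dots> \<le> (\<Sum>E\<in>Av. card E)" using Auni by (intro sum_mono) (auto simp: Av_def)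
      finally show "card Av \<le> (\<Sum>E\<in>Av. card E)" .
    qed
    also have "(\<Sum>E\<in>Av. card E) = (\<Sum>E\<in>Av. \<Sum>v\<in>W. if v \<in> E then 1 else 0)"
    proof (rule sum.cong [OF refl])
      fix E assume "E \<in> Av"
      then have "W \<inter> E = E" by (auto simp: Av_def)
      then show "card E = (\<Sum>v\<in>W. if v \<in> E then 1 else 0)" using finW by (simp add: sum.If_cases)
    qed
    also have "\<dots> = (\<Sum>v\<in>W. \<Sum>E\<in>Av. if v \<in> E then 1 else 0)" by (rule sum.swap)
    also have "\<dots> = (\<Sum>v\<in>W. card {E\<in>Av. v \<in> E})"
      using finAv by (simp add: sum.If_cases Int_def)
    also have "real \<dots> = (\<Sum>v\<in>W. real (card {E\<in>Av. v \<in> E}))" by simp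
    also have "\<dots> \<le> (\<Sum>v\<in>W. c / 4 * x ^ s)"
      using * that by (intro sum_mono) (meson le_cases)
    also have "\<dots> = card W * (c / 4 * x ^ s)" by simp
    also have "\<dots> \<le> N * (c / 4 * x ^ s)"
      using card_mono [OF fin W(1)] N(1) c x by (intro mult_right_mono) auto
    finally have "c / 2 * x ^ s * N \<le> c / 4 * x ^ s * N" using cAv by (simp add: mult.commute)
    moreover have "0 < c / 4 * x ^ s * N" using c x N by simp
    moreover have "c / 2 * x ^ s * N = 2 * (c / 4 * x ^ s * N)" by simp
    ultimately show False by linarith
  qed
  define Lk where "Lk = (\<lambda>E. E - {v}) ` {E\<in>Av. v \<in> E}"
  have LkE: "\<exists>E\<in>Av. v \<in> E \<and> D = E - {v}" if "D \<in> Lk" for D using that by (auto simp: Lk_def)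
  have finLk: "finite Lk" using finAv by (simp add: Lk_def)
  have Lkuni: "D \<subseteq> W0 \<and> card D = s" if "D \<in> Lk" for D
  proof -
    obtain E where E: "E \<in> Av" "v \<in> E" "D = E - {v}" using LkE [OF \<open>D \<in> Lk\<close>] by blast
    then have "E \<subseteq> W0 \<and> card E = Suc s" using Auni by (simp add: Av_def)
    then show ?thesis using E by (auto simp: card_Diff_singleton)
  qed
  have "inj_on (\<lambda>E. E - {v}) {E\<in>Av. v \<in> E}" by (auto simp: inj_on_def)
  then have cLk: "c / 4 * x ^ s \<le> card Lk" using v(2) by (simp add: Lk_def card_image)
  \<comment> \<open>A member of \<open>\<G>\<close> has degree at least \<open>1 = x ^ 0\<close> and
    is therefore saturated, so all links of \<open>v\<close> taken from \<open>Av\<close> are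
    new.\<close>
  have disj: "\<G> \<inter> Lk = {}"
  proof (rule ccontr)
    assume "\<G> \<inter> Lk \<noteq> {}"
    then obtain D where D: "D \<in> \<G>" "D \<in> Lk" by blast
    then obtain E where E: "E \<in> Av" "v \<in> E" "D = E - {v}" using LkE by blast
    have "{F\<in>\<G>. D \<subseteq> F} \<noteq> {}" using D by blast
    then have "0 < hdeg \<G> D" using finG by (simp add: hdeg_def card_gt_0_iff)
    moreover have "D \<noteq> {}" using Lkuni [OF D(2)] s by auto
    ultimately have "D \<in> Sat" using Lkuni [OF D(2)] by (simp add: Sat_def)
    then show False using E by (auto simp: Av_def)
  qed
  have deg1: "real (hdeg (\<G> \<union> Lk) L) \<le> (1 + \<Lambda>) * x ^ (s - card L)"
    if L: "L \<subseteq> W0" "L \<noteq> {}" "card L \<le> s" for L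
  proof (cases "\<exists>D\<in>Lk. L \<subseteq> D")
    case False
    then have "{E \<in> \<G> \<union> Lk. L \<subseteq> E} = {E \<in> \<G>. L \<subseteq> E}" by blast
    then show ?thesis using Gdeg [OF L] by (simp add: hdeg_def)
  next
    case True
    then obtain D where D: "D \<in> Lk" "L \<subseteq> D" by blast
    then obtain E where E: "E \<in> Av" "v \<in> E" "D = E - {v}" using LkE by blast
    have vL: "v \<notin> L" using D E by blast
    have "L \<notin> Sat" using E D by (auto simp: Av_def)
    then have "real (hdeg \<G> L) \<le> x ^ (s - card L)" using L by (auto simp: Sat_def)
    moreover have "real (hdeg Lk L) \<le> \<Lambda> * x ^ (s - card L)"
    proof -
      have "card {D \<in> Lk. L \<subseteq> D} \<le> card {E\<in>\<A>. insert v L \<subseteq> E}"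
      proof (rule card_inj_on_le [of "insert v"])
        show "inj_on (insert v) {D \<in> Lk. L \<subseteq> D}"
          using LkE by (auto simp: inj_on_def)
        show "insert v ` {D \<in> Lk. L \<subseteq> D} \<subseteq> {E \<in> \<A>. insert v L \<subseteq> E}"
        proof
          fix F assume "F \<in> insert v ` {D \<in> Lk. L \<subseteq> D}"
          then obtain D where D: "D \<in> Lk" "L \<subseteq> D" "F = insert v D" by blast
          then obtain E where E: "E \<in> Av" "v \<in> E" "D = E - {v}" using LkE by blast
          then have "F = E" using D by blast
          then show "F \<in> {E \<in> \<A>. insert v L \<subseteq> E}" using D E by (auto simp: Av_def)
        qed
      qed (use finA in auto)
      then have "real (hdeg Lk L) \<le> real (hdeg \<A> (insert v L))" by (simp add: hdeg_def)
      also have "\<dots> \<le> \<Lambda> * x ^ (Suc s - card (insert v L))"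
      proof (rule Adeg)
        show "insert v L \<subseteq> W0" using L v(1) W(1) by blast
        show "card (insert v L) \<le> Suc s"
          using L vL finite_subset [OF L(1) fin] by simp
      qed simp
      also have "\<dots> = \<Lambda> * x ^ (s - card L)"
        using vL finite_subset [OF L(1) fin] by simp
      finally show ?thesis .
    qed
    moreover have "hdeg (\<G> \<union> Lk) L \<le> hdeg \<G> L + hdeg Lk L"
    proof -
      have "{E \<in> \<G> \<union> Lk. L \<subseteq> E} = {E \<in> \<G>. L \<subseteq> E} \<union> {E \<in> Lk. L \<subseteq> E}" by blast
      then show ?thesis unfolding hdeg_def by (simp add: card_Un_le)
    qed
    ultimately show ?thesis by (simp add: distrib_right)
  qed
  show thesis
  proof (rule that [of v "\<G> \<union> Lk"])
    show "spread W0 s (1 + \<Lambda>) x (\<G> \<union> Lk)"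
      unfolding spread_def using Guni Lkuni deg1 by blast
    show "card \<G> + c / 4 * x ^ s \<le> card (\<G> \<union> Lk)"
      using cLk card_Un_disjoint [OF finG finLk disj] by simp
    show "E \<in> \<G> \<or> insert v E \<in> \<A>" if "E \<in> \<G> \<union> Lk" for E
    proof (cases "E \<in> \<G>")
      case False
      then obtain E' where E': "E' \<in> Av" "v \<in> E'" "E = E' - {v}" using LkE \<open>E \<in> \<G> \<union> Lk\<close> by blast
      then have "insert v E = E'" by blast
      then show ?thesis using E' by (auto simp: Av_def)
    qed simp
  qed (use v in auto)
qed

definition shrinks :: "'a set \<Rightarrow> 'a set set \<Rightarrow> real \<Rightarrow> real \<Rightarrow> bool" where
  "shrinks W \<G> b a \<longleftrightarrow> containers W \<G> b (\<lambda>C. real (card C) + a \<le> card W)"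

text \<open>Induction on the uniformity. Vertices are queried until one of two things happens:
  enough of them have been deleted, or so many links have accumulated that the induction hypothesis
  applies to the \<open>(k - 1)\<close>-uniform hypergraph of links. Either way a proportion of the
  vertices is lost.\<close>

lemma uniform_shrinks:
  assumes "1 \<le> k" "0 < c" "1 \<le> \<Lambda>"
  shows "\<exists>B \<delta>::real. 0 < B \<and> 0 < \<delta> \<and> (\<forall>(W::'a set) \<G> N x. finite W \<longrightarrow> 1 \<le> x \<longrightarrow> x \<le> N \<longrightarrow> real (card W) \<le> N \<longrightarrow>
    spread W k \<Lambda> x \<G> \<longrightarrow> c * x ^ (k - 1) * N \<le> card \<G> \<longrightarrow> shrinks W \<G> (B * (N / x)) (\<delta> * N))"
  using assms
proof (induction k arbitrary: c \<Lambda> rule: nat_induct_at_least)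
  case base
  have "shrinks W \<G> (1 * (N / x)) (c * N)"
    if "finite W" "1 \<le> x" "x \<le> N" "spread W 1 \<Lambda> x \<G>" "c * x ^ (1 - 1) * N \<le> card \<G>"
    for W :: "'a set" and \<G> N x
  proof -
    define S where "S = {v. {v} \<in> \<G>}"
    have uni: "E \<subseteq> W \<and> card E = 1" if "E \<in> \<G>" for E using \<open>spread W 1 \<Lambda> x \<G>\<close> that by (simp add: spread_def)
    have "\<G> = (\<lambda>v. {v}) ` S" using uni by (auto simp: S_def card_1_singleton_iff)
    then have cS: "card \<G> = card S" by (simp add: card_image)
    have S: "S \<subseteq> W" using uni by (auto simp: S_def)
    have "real (card (W - S)) = card W - card S"
      using S \<open>finite W\<close> finite_subset [OF S] card_mono [OF _ S] by (simp add: card_Diff_subset of_nat_diff)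
    then have "containers (W - S) \<G> (1 * (N / x)) (\<lambda>C. real (card C) + c * N \<le> card W)"
      using that cS card_mono [OF \<open>finite W\<close> S] by (intro containers_leaf) (auto simp: of_nat_diff)
    then show ?thesis unfolding shrinks_def S_def by (rule containers_singletons)
  qed
  then show ?case using base by (intro exI [of _ 1] exI [of _ c]) auto
next
  case (Suc s)
  \<comment> \<open>The edge count for the induction hypothesis is exactly the bound on
    \<open>\<G>\<close> up to which \<open>container_select_vertex\<close> still finds a
    vertex.\<close>
  define c' where "c' = c / (2 ^ (s + 2) * \<Lambda>)"
  have c': "0 < c'" using Suc.prems by (simp add: c'_def)
  have L1: "1 \<le> 1 + \<Lambda>" using Suc.prems by simp
  obtain B0 \<delta>0 :: real where B0: "0 < B0" "0 < \<delta>0" and IH: "\<And>(W::'a set) \<G> N x. \<lbrakk>finite W; 1 \<le> x; x \<le> N; real (card W) \<le> N;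
    spread W s (1 + \<Lambda>) x \<G>; c' * x ^ (s - 1) * N \<le> card \<G>\<rbrakk> \<Longrightarrow> shrinks W \<G> (B0 * (N / x)) (\<delta>0 * N)"
    using Suc.IH [OF c' L1] by blast
  define \<delta> where "\<delta> = min \<delta>0 (c / (4 * \<Lambda>))"
  \<comment> \<open>\<open>B0\<close> comes from the induction hypothesis, \<open>4 * c' / c\<close>
    is \<open>T / D\<close> in units of \<open>N / x\<close>, and 1 covers rounding because
    \<open>N / x \<ge> 1\<close>.\<close>
  define B where "B = B0 + 4 * c' / c + 1"
  have \<delta>: "0 < \<delta>" "\<delta> \<le> \<delta>0" "\<delta> \<le> c / (4 * \<Lambda>)" using B0 Suc.prems by (auto simp: \<delta>_def)
  have B: "0 < B" using B0 c' Suc.prems by (simp add: B_def add_pos_pos)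
  have "shrinks W0 \<A> (B * (N / x)) (\<delta> * N)"
    if fin: "finite W0" and x: "1 \<le> x" "x \<le> N" and N: "real (card W0) \<le> N"
      and A: "spread W0 (Suc s) \<Lambda> x \<A>" "c * x ^ (Suc s - 1) * N \<le> card \<A>"
    for W0 :: "'a set" and \<A> N x
  proof -
    define T where "T = c' * x ^ (s - 1) * N"
    define D where "D = c / 4 * x ^ s"
    define \<beta> where "\<beta> = (\<lambda>\<G>::'a set set. B0 * (N / x) + (if T \<le> card \<G> then 0 else (T - card \<G>) / D + 1))"
    define Q where "Q = (\<lambda>C::'a set. real (card C) + \<delta> * N \<le> card W0)"
    have D0: "0 < D" using Suc.prems x by (simp add: D_def)
    have N0: "0 < N" using x by linarith
    have \<beta>0: "0 \<le> \<beta> \<G>" for \<G> using B0 N0 x D0 by (auto simp: \<beta>_def intro!: add_nonneg_nonneg divide_nonneg_pos)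
    \<comment> \<open>\<open>\<beta> \<G>\<close> bounds the number of selected vertices that are still possible: each one adds at least
      \<open>D\<close> links, and at \<open>T\<close> links the induction hypothesis applies to \<open>\<G>\<close>.\<close>
    have main: "containers W (\<A> \<union> \<G>) (\<beta> \<G>) Q"
      if "W \<subseteq> W0" "spread W0 s (1 + \<Lambda>) x \<G>" for W \<G>
      using that
    proof (induction "card W + (card (Pow W0) - card \<G>)" arbitrary: W \<G> rule: less_induct)
      \<comment> \<open>The measure drops in both branches of a query: either \<open>\<G>\<close>
        grows or \<open>W\<close> loses a vertex.\<close>
      case less
      consider "T \<le> card \<G>" | "c / (4 * \<Lambda>) * N \<le> real (card W0) - card W"
        | "card \<G> < T" "real (card W0) - card W \<le> c / (4 * \<Lambda>) * N" by linarith
      then show ?case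
      proof cases
        case 1
        have "containers W0 \<G> (B0 * (N / x)) (\<lambda>C. real (card C) + \<delta>0 * N \<le> card W0)"
          using IH [OF fin x N less.prems(2)] 1 by (simp add: shrinks_def T_def)
        then have "containers W \<G> (B0 * (N / x)) (\<lambda>C. real (card C) + \<delta>0 * N \<le> card W0)"
        proof (rule containers_restrict [OF _ less.prems(1)])
          fix C C' assume "C' \<subseteq> C" "C \<subseteq> W0" "real (card C) + \<delta>0 * N \<le> card W0"
          moreover have "card C' \<le> card C" using calculation fin finite_subset by (blast intro: card_mono)
          ultimately show "real (card C') + \<delta>0 * N \<le> card W0" by linarith
        qed
        then show ?thesis
        proof (rule containers_mono)
          show "B0 * (N / x) \<le> \<beta> \<G>" using 1 by (simp add: \<beta>_def)
          fix C :: "'a set" assume "real (card C) + \<delta>0 * N \<le> card W0"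
          moreover have "\<delta> * N \<le> \<delta>0 * N" using \<delta> N0 by (intro mult_right_mono) auto
          ultimately show "Q C" by (simp add: Q_def)
        qed simp
      next
        case 2
        have "\<delta> * N \<le> c / (4 * \<Lambda>) * N" using \<delta> N0 by (intro mult_right_mono) auto
        then show ?thesis using 2 by (intro containers_leaf \<beta>0) (simp add: Q_def)
      next
        case 3
        obtain v \<G>1 where v: "v \<in> W" and G1: "spread W0 s (1 + \<Lambda>) x \<G>1" "card \<G> + D \<le> card \<G>1" "\<G> \<subseteq> \<G>1"
          "\<And>E. E \<in> \<G>1 \<Longrightarrow> E \<in> \<G> \<or> insert v E \<in> \<A>"
          by (rule container_select_vertex [OF fin x(1) N N0 Suc.hyps Suc.prems A(1) _ less.prems(2) _ less.prems(1) 3(2)])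
            (use A(2) 3(1) in \<open>auto simp: T_def c'_def D_def\<close>)
        have finW: "finite W" using less.prems(1) fin finite_subset by blast
        have "\<G>1 \<subseteq> Pow W0" using G1(1) by (auto simp: spread_def)
        then have "card \<G>1 \<le> card (Pow W0)" using fin by (intro card_mono) auto
        moreover have "card \<G> < card \<G>1" using G1(2) D0 by linarith
        ultimately have m1: "card W + (card (Pow W0) - card \<G>1) < card W + (card (Pow W0) - card \<G>)" by linarith
        have "card (W - {v}) < card W" using v finW by (rule card_Diff1_less [rotated])
        then have m0: "card (W - {v}) + (card (Pow W0) - card \<G>) < card W + (card (Pow W0) - card \<G>)" by linarith
        \<comment> \<open>The budget falls by at least 1, which pays for \<open>v\<close>; the
          summand 1 in \<open>\<beta>\<close> pays for the step that crosses
          \<open>T\<close>.\<close>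
        have step: "\<beta> \<G>1 \<le> \<beta> \<G> - 1"
        proof (cases "T \<le> card \<G>1")
          case True
          then show ?thesis using 3(1) D0 by (simp add: \<beta>_def)
        next
          case False
          have "(T - card \<G>1) / D \<le> (T - card \<G> - D) / D" using G1(2) D0 by (intro divide_right_mono) auto
          also have "\<dots> = (T - card \<G>) / D - 1" using D0 by (simp add: diff_divide_distrib)
          finally show ?thesis using False 3(1) by (simp add: \<beta>_def)
        qed
        have "containers W (\<A> \<union> \<G>) ((\<beta> \<G> - 1) + 1) Q"
        proof (rule containers_query [of W "\<A> \<union> \<G>1" _ _ v])
          show "containers W (\<A> \<union> \<G>1) (\<beta> \<G> - 1) Q"
            by (rule containers_mono [OF less.hyps [OF m1 less.prems(1) G1(1)] step]) auto
          have "W - {v} \<subseteq> W0" using less.prems(1) by blast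
          then show "containers (W - {v}) (\<A> \<union> \<G>) (\<beta> \<G> - 1 + 1) Q"
            using less.hyps [OF m0 _ less.prems(2)] by simp
          show "E \<in> \<A> \<union> \<G> \<or> insert v E \<in> \<A> \<union> \<G>" if "E \<in> \<A> \<union> \<G>1" for E
            using that G1(4) by blast
        qed
        then show ?thesis by simp
      qed
    qed
    have "spread W0 s (1 + \<Lambda>) x {}" using Suc.prems x by (simp add: spread_def hdeg_def)
    then have "containers W0 (\<A> \<union> {}) (\<beta> {}) Q" by (intro main) auto
    moreover have "\<beta> {} \<le> B * (N / x)"
    proof -
      have "1 \<le> N / x" using x by simp
      moreover have "T / D = 4 * c' / c * (N / x)"
        using Suc.hyps x Suc.prems by (cases s) (auto simp: T_def D_def field_simps)
      moreover have "0 < T" using c' x N0 by (simp add: T_def)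
      moreover have "\<beta> {} = B0 * (N / x) + (T / D + 1)" if "0 < T" using that by (simp add: \<beta>_def)
      moreover have "B * (N / x) = B0 * (N / x) + 4 * c' / c * (N / x) + N / x"
        by (simp only: B_def distrib_right mult_1_left)
      ultimately show ?thesis by linarith
    qed
    ultimately have "containers W0 \<A> (B * (N / x)) Q" by (rule containers_mono) auto
    then show ?thesis unfolding shrinks_def Q_def .
  qed
  then show ?case using B \<delta>(1) by blast
qed

section \<open>Containers for cycles and the upper bound for arbitrary graphs\<close>

definition cyc :: "nat \<Rightarrow> (nat \<Rightarrow> nat) \<Rightarrow> nat set set" where
  "cyc l f = (\<lambda>i. {f i, f (Suc i mod l)}) ` {..<l}"

definition cycle_maps :: "nat \<Rightarrow> nat \<Rightarrow> (nat \<Rightarrow> nat) set" where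
  "cycle_maps l n = {f \<in> {..<l} \<rightarrow>\<^sub>E {..<n}. inj_on f {..<l}}"

definition cycles :: "nat \<Rightarrow> nat \<Rightarrow> nat set set set" where
  "cycles l n = cyc l ` cycle_maps l n"

lemma finite_cycle_maps [simp]: "finite (cycle_maps l n)"
  unfolding cycle_maps_def by (rule finite_subset [of _ "{..<l} \<rightarrow>\<^sub>E {..<n}"]) (auto intro: finite_PiE)

lemma finite_cycles [simp]: "finite (cycles l n)"
  by (simp add: cycles_def)

lemma Suc_mod_neq: "2 \<le> l \<Longrightarrow> i < l \<Longrightarrow> Suc i mod l \<noteq> i"
  by (cases "Suc i = l") auto

lemma card_cyc:
  assumes "3 \<le> l" "inj_on f {..<l}"
  shows "card (cyc l f) = l"
proof -
  have "inj_on (\<lambda>i. {f i, f (Suc i mod l)}) {..<l}"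
  proof (rule inj_onI)
    fix i j assume ij: "i \<in> {..<l}" "j \<in> {..<l}" and eq: "{f i, f (Suc i mod l)} = {f j, f (Suc j mod l)}"
    have finj: "f a = f b \<Longrightarrow> a = b" if "a < l" "b < l" for a b
      using assms(2) that by (auto simp: inj_on_def)
    have lt: "Suc i mod l < l" "Suc j mod l < l" using assms by simp_all
    from eq consider "f i = f j" | "f i = f (Suc j mod l)" "f (Suc i mod l) = f j"
      unfolding doubleton_eq_iff by blast
    then show "i = j"
    proof cases
      case 1
      then show ?thesis using finj ij by simp
    next
      case 2
      then have "i = Suc j mod l" "Suc i mod l = j" using finj ij lt by auto
      then show ?thesis using assms(1) ij by (cases "Suc i = l"; cases "Suc j = l") auto
    qed
  qed
  then show ?thesis by (simp add: cyc_def card_image)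
qed

lemma cyc_subset_all_edges:
  assumes "2 \<le> l" "f \<in> cycle_maps l n"
  shows "cyc l f \<subseteq> all_edges n"
proof
  fix e assume "e \<in> cyc l f"
  then obtain i where i: "i < l" "e = {f i, f (Suc i mod l)}" by (auto simp: cyc_def)
  have "Suc i mod l < l" "Suc i mod l \<noteq> i" using assms Suc_mod_neq i by auto
  then have "f i < n" "f (Suc i mod l) < n" "f i \<noteq> f (Suc i mod l)"
    using assms(2) i by (auto simp: cycle_maps_def inj_on_def)
  then show "e \<in> all_edges n" using i by (auto simp: all_edges_def)
qed

lemma cyclesD:
  assumes "3 \<le> l" "C \<in> cycles l n"
  shows "C \<subseteq> all_edges n" "card C = l" "has_cycle l C"
proof -
  obtain f where f: "f \<in> cycle_maps l n" "C = cyc l f" using assms by (auto simp: cycles_def)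
  show "C \<subseteq> all_edges n" using cyc_subset_all_edges [OF _ f(1)] assms f by simp
  show "card C = l" using card_cyc [OF assms(1), of f] f by (simp add: cycle_maps_def)
  show "has_cycle l C" unfolding has_cycle_def f(2)
    by (rule exI [of _ f]) (use f in \<open>auto simp: cycle_maps_def cyc_def\<close>)
qed

lemma has_cycle_imp_cycles:
  assumes "has_cycle l F" "F \<subseteq> all_edges n"
  obtains C where "C \<in> cycles l n" "C \<subseteq> F"
proof -
  obtain f where f: "inj_on f {..<l}" "\<And>i. i < l \<Longrightarrow> {f i, f (Suc i mod l)} \<in> F"
    using assms(1) by (auto simp: has_cycle_def)
  define h where "h = restrict f {..<l}"
  have "f i < n" if "i < l" for i
  proof -
    have "{f i, f (Suc i mod l)} \<in> all_edges n" using f(2) [OF that] assms(2) by blast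
    then show ?thesis by (auto simp: all_edges_eq)
  qed
  then have "h \<in> cycle_maps l n" using f(1) by (auto simp: h_def cycle_maps_def inj_on_def)
  moreover have "cyc l h \<subseteq> F" using f(2) by (auto simp: cyc_def h_def)
  ultimately show thesis using that by (auto simp: cycles_def)
qed

lemma card_PiE_fix_le:
  fixes n l :: nat
  assumes "S \<subseteq> {..<l}" "card V \<le> v" "1 \<le> v"
  shows "card (PiE {..<l} (\<lambda>i. if i \<in> S then V else {..<n})) \<le> v ^ l * n ^ (l - card S)"
proof -
  have fS: "finite S" using assms(1) finite_subset by blast
  have "card (PiE {..<l} (\<lambda>i. if i \<in> S then V else {..<n})) = (\<Prod>i<l. card (if i \<in> S then V else {..<n}))"
    by (rule card_PiE) simp
  also have "\<dots> = (\<Prod>i<l. if i \<in> S then card V else n)" by (rule prod.cong) auto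
  also have "\<dots> = card V ^ card ({..<l} \<inter> {i. i \<in> S}) * n ^ card ({..<l} \<inter> - {i. i \<in> S})"
    by (simp add: prod.If_cases)
  also have "{..<l} \<inter> {i. i \<in> S} = S" using assms by auto
  also have "{..<l} \<inter> - {i. i \<in> S} = {..<l} - S" by auto
  also have "card ({..<l} - S) = l - card S" using assms fS by (simp add: card_Diff_subset)
  also have "card V ^ card S * n ^ (l - card S) \<le> v ^ l * n ^ (l - card S)"
  proof (rule mult_right_mono)
    have "card S \<le> l" using card_mono [OF _ assms(1)] by simp
    then have "v ^ card S \<le> v ^ l" using assms(3) by (rule power_increasing)
    moreover have "card V ^ card S \<le> v ^ card S" using assms(2) by (rule power_mono) simp
    ultimately show "card V ^ card S \<le> v ^ l" by (rule order_trans [rotated])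
  qed simp
  finally show ?thesis .
qed

text \<open>Hence the edges in a proper nonempty set of positions have an endpoint whose own
  position is not in the set; this is the additional vertex in the degree bound for cycles.\<close>

lemma cyclic_closed_all:
  assumes "J \<subseteq> {..<l}" "J \<noteq> {}" "(\<lambda>i. Suc i mod l) ` J \<subseteq> J"
  shows "J = {..<l}"
proof -
  obtain i where i: "i \<in> J" using assms by blast
  have "(i + k) mod l \<in> J" for k
  proof (induction k)
    case 0
    then show ?case using i assms(1) by auto
  next
    case (Suc k)
    then have "Suc ((i + k) mod l) mod l \<in> J" using assms(3) by blast
    then show ?case by (simp add: mod_Suc_eq)
  qed
  then have "j \<in> J" if "j < l" for j
  proof -
    have "(i + (j + l - i)) mod l \<in> J" by fact
    moreover have "i + (j + l - i) = j + l" using i assms(1) that by auto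
    ultimately show ?thesis using that by simp
  qed
  then show ?thesis using assms(1) by auto
qed

text \<open>A copy of \<open>C\<^sub>l\<close> containing \<open>j < l\<close> given edges has at least \<open>j + 1\<close> of its vertices among their
  at most \<open>2l\<close> endpoints.\<close>

definition cyc_const :: "nat \<Rightarrow> nat" where
  "cyc_const l = 2 ^ l * (2 * l) ^ l"

lemma hdeg_cycles_le:
  assumes l: "3 \<le> l" and L: "L \<subseteq> all_edges n" "L \<noteq> {}" "card L \<le> l"
  shows "hdeg (cycles l n) L \<le> cyc_const l * n ^ (l - Suc (card L))"
proof -
  have finL: "finite L" using L finite_subset by fastforce
  have n: "1 \<le> n" using L by (auto simp: all_edges_def)
  define j where "j = card L"
  \<comment> \<open>The minimum covers the case of all \<open>l\<close> edges, which span only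
    \<open>l\<close> vertices.\<close>
  define m where "m = min (Suc j) l"
  define X where "X = {f \<in> cycle_maps l n. L \<subseteq> cyc l f}"
  define Y where "Y = (\<lambda>S. PiE {..<l} (\<lambda>i. if i \<in> S then \<Union>L else {..<n}))"
  have cUL: "card (\<Union>L) \<le> 2 * l"
  proof -
    have "card (\<Union>L) \<le> (\<Sum>e\<in>L. card e)" by (rule card_Union_le_sum_card)
    also have "\<dots> = (\<Sum>e\<in>L. 2)" using L by (intro sum.cong) (auto simp: all_edges_eq)
    also have "\<dots> \<le> 2 * l" using L by simp
    finally show ?thesis .
  qed
  have finUL: "finite (\<Union>L)" using L finL by (auto simp: all_edges_eq intro: finite_subset)
  \<comment> \<open>Classify the maps by the set \<open>S\<close> of positions sent to endpoints of
    \<open>L\<close>: at most \<open>2 ^ l\<close> sets, at most \<open>(2 * l) ^ l\<close> choices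
    on \<open>S\<close>, and the remaining positions are free.\<close>
  have "X \<subseteq> (\<Union>S\<in>{S\<in>Pow {..<l}. m \<le> card S}. Y S)"
  proof
    fix f assume f: "f \<in> X"
    define S where "S = {i\<in>{..<l}. f i \<in> \<Union>L}"
    define J where "J = {i\<in>{..<l}. {f i, f (Suc i mod l)} \<in> L}"
    have "L \<subseteq> (\<lambda>i. {f i, f (Suc i mod l)}) ` J" using f by (auto simp: X_def cyc_def J_def)
    then have "card L \<le> card ((\<lambda>i. {f i, f (Suc i mod l)}) ` J)" by (intro card_mono) (auto simp: J_def)
    also have "\<dots> \<le> card J" by (rule card_image_le) (simp add: J_def)
    finally have cJ: "j \<le> card J" by (simp add: j_def)
    have JS: "J \<union> (\<lambda>i. Suc i mod l) ` J \<subseteq> S" using l by (auto simp: J_def S_def)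
    have finS: "finite S" by (simp add: S_def)
    have "m \<le> card S"
    proof (cases "(\<lambda>i. Suc i mod l) ` J \<subseteq> J")
      case True
      have "J \<noteq> {}" using cJ L(2) finL by (auto simp: j_def)
      then have "J = {..<l}" using True by (intro cyclic_closed_all) (auto simp: J_def)
      then have "card {..<l} \<le> card S" using JS finS by (intro card_mono) auto
      then show ?thesis by (simp add: m_def)
    next
      case False
      then obtain i where i: "i \<in> S" "i \<notin> J" using JS by blast
      then have "card (insert i J) \<le> card S" using JS finS by (intro card_mono) auto
      moreover have "card (insert i J) = Suc (card J)" using i by (simp add: J_def)
      ultimately show ?thesis using cJ by (simp add: m_def)
    qed
    moreover have "f \<in> Y S" using f by (auto simp: X_def cycle_maps_def Y_def S_def)
    moreover have "S \<subseteq> {..<l}" by (auto simp: S_def)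
    ultimately show "f \<in> (\<Union>S\<in>{S\<in>Pow {..<l}. m \<le> card S}. Y S)" by blast
  qed
  moreover have "finite (Y S)" for S unfolding Y_def by (rule finite_PiE) (use finUL in auto)
  ultimately have "card X \<le> card (\<Union>S\<in>{S\<in>Pow {..<l}. m \<le> card S}. Y S)"
    by (intro card_mono) auto
  also have "\<dots> \<le> (\<Sum>S\<in>{S\<in>Pow {..<l}. m \<le> card S}. card (Y S))"
    by (rule card_UN_le) simp
  also have "\<dots> \<le> (\<Sum>S\<in>{S\<in>Pow {..<l}. m \<le> card S}. (2 * l) ^ l * n ^ (l - m))"
  proof (rule sum_mono)
    fix S assume S: "S \<in> {S\<in>Pow {..<l}. m \<le> card S}"
    have "card (Y S) \<le> (2 * l) ^ l * n ^ (l - card S)"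
      unfolding Y_def by (rule card_PiE_fix_le) (use S cUL l in auto)
    also have "\<dots> \<le> (2 * l) ^ l * n ^ (l - m)"
      using S n by (intro mult_left_mono power_increasing) auto
    finally show "card (Y S) \<le> (2 * l) ^ l * n ^ (l - m)" .
  qed
  also have "\<dots> = card {S\<in>Pow {..<l}. m \<le> card S} * ((2 * l) ^ l * n ^ (l - m))" by simp
  also have "\<dots> \<le> 2 ^ l * ((2 * l) ^ l * n ^ (l - m))"
  proof (rule mult_right_mono)
    have "card {S\<in>Pow {..<l}. m \<le> card S} \<le> card (Pow {..<l})" by (rule card_mono) auto
    then show "card {S\<in>Pow {..<l}. m \<le> card S} \<le> 2 ^ l" by (simp add: card_Pow)
  qed simp
  finally have "card X \<le> cyc_const l * n ^ (l - m)" by (simp add: cyc_const_def mult.assoc)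
  moreover have "hdeg (cycles l n) L \<le> card X"
  proof -
    have "{C\<in>cycles l n. L \<subseteq> C} = cyc l ` X" by (auto simp: cycles_def X_def)
    then show ?thesis unfolding hdeg_def using card_image_le [of X "cyc l"] by (simp add: X_def)
  qed
  moreover have "l - m = l - Suc (card L)" by (simp add: m_def j_def)
  ultimately show ?thesis by simp
qed

text \<open>The solution \<open>p\<close> of \<open>n ^ (l - 2) * p ^ (l - 1) = 1\<close>.\<close>

definition thr :: "nat \<Rightarrow> nat \<Rightarrow> real" where
  "thr l n = real n powr (-1 + 1 / (real l - 1))"

lemma thr_pos: "0 < n \<Longrightarrow> 0 < thr l n"
  by (simp add: thr_def)

lemma thr_power:
  assumes "3 \<le> l" "0 < n"
  shows "(1 / thr l n) ^ (l - 1) = real n ^ (l - 2)"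
proof -
  have "(1 / thr l n) ^ (l - 1) = real n powr (- (-1 + 1 / (real l - 1)) * (l - 1))"
    using assms by (simp add: thr_def powr_minus_divide [symmetric] powr_powr flip: powr_realpow)
  also have "- (-1 + 1 / (real l - 1)) * real (l - 1) = real (l - 2)"
    using assms by (simp add: of_nat_diff field_simps)
  also have "real n powr real (l - 2) = real n ^ (l - 2)" by (rule powr_realpow) (use assms in simp)
  finally show ?thesis .
qed

lemma thr_ge: "3 \<le> l \<Longrightarrow> 0 < n \<Longrightarrow> 1 / real n \<le> thr l n"
proof -
  assume "3 \<le> l" "0 < n"
  then have "real n powr (-1) \<le> real n powr (-1 + 1 / (real l - 1))" by (intro powr_mono) auto
  then show ?thesis using \<open>0 < n\<close> by (simp add: thr_def powr_minus_divide)
qed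

lemma thr_le_1: "3 \<le> l \<Longrightarrow> 0 < n \<Longrightarrow> thr l n \<le> 1"
proof -
  assume "3 \<le> l" "0 < n"
  then have "real n powr (-1 + 1 / (real l - 1)) \<le> real n powr 0" by (intro powr_mono) (auto simp: field_simps)
  then show ?thesis using \<open>0 < n\<close> by (simp add: thr_def)
qed

text \<open>In exponents of \<open>n\<close>, for \<open>j < l\<close>: the left side is
  \<open>l - j\<close> minus 1, the right side is \<open>l - j\<close> minus
  \<open>(l - j) / (l - 1) \<le> 1\<close>. Equality holds at \<open>j = 1\<close>, so the degree of
  a single edge dictates the threshold.\<close>

lemma thr_degree_bound:
  assumes l: "3 \<le> l" and n: "0 < n" and j: "1 \<le> j" "j \<le> l"
  shows "real n ^ (l - Suc j) \<le> (1 / thr l n) ^ (l - j)"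
proof (cases "j = l")
  case False
  have "(1 / thr l n) ^ (l - j) = real n powr (- (-1 + 1 / (real l - 1)) * (l - j))"
    using n by (simp add: thr_def powr_minus_divide [symmetric] powr_powr flip: powr_realpow)
  moreover have "real (l - Suc j) \<le> - (-1 + 1 / (real l - 1)) * real (l - j)"
  proof -
    have "real (l - j) / (real l - 1) \<le> 1" using l j by (simp add: of_nat_diff)
    moreover have "real (l - Suc j) = real (l - j) - 1" using False j by (simp add: of_nat_diff)
    ultimately show ?thesis by (simp add: left_diff_distrib)
  qed
  then have "real n powr real (l - Suc j) \<le> real n powr (- (-1 + 1 / (real l - 1)) * (l - j))"
    using n by (intro powr_mono) auto
  moreover have "real n powr real (l - Suc j) = real n ^ (l - Suc j)" by (rule powr_realpow) (use n in simp)
  ultimately show ?thesis by (simp only:)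
qed simp

lemma spread_cycles:
  assumes l: "3 \<le> l" and n: "0 < n" and W: "W \<subseteq> all_edges n"
  shows "spread W l (cyc_const l) (1 / thr l n) {C\<in>cycles l n. C \<subseteq> W}"
  unfolding spread_def
proof (intro conjI ballI allI impI)
  fix C assume "C \<in> {C\<in>cycles l n. C \<subseteq> W}"
  then show "C \<subseteq> W" "card C = l" using cyclesD [OF l] by auto
next
  fix L assume L: "L \<subseteq> W" "L \<noteq> {}" "card L \<le> l"
  have "1 \<le> card L" using L W finite_subset [of L "all_edges n"] by (simp add: Suc_le_eq card_gt_0_iff)
  have "hdeg {C\<in>cycles l n. C \<subseteq> W} L \<le> hdeg (cycles l n) L"
    unfolding hdeg_def by (rule card_mono) auto
  also have "\<dots> \<le> cyc_const l * n ^ (l - Suc (card L))"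
    using hdeg_cycles_le [OF l] L W by blast
  finally have "real (hdeg {C\<in>cycles l n. C \<subseteq> W} L) \<le> cyc_const l * real n ^ (l - Suc (card L))"
    by (metis of_nat_mono of_nat_mult of_nat_power)
  also have "\<dots> \<le> cyc_const l * (1 / thr l n) ^ (l - card L)"
    by (intro mult_left_mono thr_degree_bound l n \<open>1 \<le> card L\<close> L) simp
  finally show "real (hdeg {C\<in>cycles l n. C \<subseteq> W} L) \<le> cyc_const l * (1 / thr l n) ^ (l - card L)" .
qed

text \<open>As long as a container spans \<open>c * n ^ l\<close> copies it can be shrunk by
  \<open>\<delta> * n ^ 2\<close> edges. This happens a bounded number of times, so the fingerprints
  stay of order \<open>n ^ 2 * thr l n\<close>.\<close>

lemma cycle_containers:
  fixes c :: real
  assumes l: "3 \<le> l" and c: "0 < c"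
  shows "\<exists>B::real. 0 < B \<and> (\<forall>n>0. containers (all_edges n) (cycles l n) (B * (real n ^ 2 * thr l n))
    (\<lambda>C. real (card {E\<in>cycles l n. E \<subseteq> C}) < c * real n ^ l))"
proof -
  have "0 < cyc_const l" using l by (simp add: cyc_const_def)
  moreover have l1: "1 \<le> l" using l by simp
  ultimately have k1: "1 \<le> real (cyc_const l)" by simp
  obtain B0 \<delta> :: real where B0: "0 < B0" "0 < \<delta>" and
    sh: "\<And>(W::nat set set) \<G> N x. \<lbrakk>finite W; 1 \<le> x; x \<le> N; real (card W) \<le> N;
    spread W l (cyc_const l) x \<G>; c * x ^ (l - 1) * N \<le> card \<G>\<rbrakk> \<Longrightarrow> shrinks W \<G> (B0 * (N / x)) (\<delta> * N)"
    using uniform_shrinks [OF l1 c k1, where 'a = "nat set"] by blast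
  \<comment> \<open>The number of rounds: at most \<open>N\<close> edges are present and each round
    removes \<open>\<delta> * N\<close>.\<close>
  define m where "m = nat \<lceil>1 / \<delta>\<rceil>"
  have "containers (all_edges n) (cycles l n) (m * B0 * (real n ^ 2 * thr l n))
    (\<lambda>C. real (card {E\<in>cycles l n. E \<subseteq> C}) < c * real n ^ l)" if n: "0 < n" for n
  proof -
    define N where "N = real n ^ 2"
    define x where "x = 1 / thr l n"
    define Q where "Q = (\<lambda>C. real (card {E\<in>cycles l n. E \<subseteq> C}) < c * real n ^ l)"
    have x1: "1 \<le> x" using thr_pos [OF n] thr_le_1 [OF l n] by (simp add: x_def)
    have "x \<le> n" using thr_ge [OF l n] thr_pos [OF n, of l] n by (simp add: x_def field_simps)
    also have "\<dots> \<le> N" using n by (simp add: N_def self_le_power)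
    finally have xN: "x \<le> N" .
    have Nx: "N / x = real n ^ 2 * thr l n" by (simp add: N_def x_def)
    have Nx0: "0 \<le> B0 * (N / x)" using B0 thr_pos [OF n, of l] by (simp add: Nx)
    have cN: "real (card W) \<le> N" if "W \<subseteq> all_edges n" for W
      using card_mono [OF finite_all_edges that] card_all_edges_le [of n] zero_le_power2 [of "real n"]
      unfolding N_def by linarith
    have main: "containers W (cycles l n) (real k * (B0 * (N / x))) Q"
      if "W \<subseteq> all_edges n" "real (card W) \<le> k * (\<delta> * N)" for k W
      using that
    proof (induction k arbitrary: W)
      case 0
      then have "W = {}" using finite_subset by fastforce
      moreover have "E \<noteq> {}" if "E \<in> cycles l n" for E using cyclesD(2) [OF l that] l by auto
      ultimately have "{E\<in>cycles l n. E \<subseteq> W} = {}" by auto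
      then have "Q W" unfolding Q_def using c n by (simp only: card.empty) simp
      then show ?case by (intro containers_leaf) auto
    next
      case (Suc k)
      show ?case
      proof (cases "Q W")
        case True
        then show ?thesis by (intro containers_leaf mult_nonneg_nonneg Nx0) auto
      next
        case False
        \<comment> \<open>The edge condition of \<open>uniform_shrinks\<close> is thus exactly the
          failure of \<open>Q\<close>.\<close>
        have "x ^ (l - 1) * N = real n ^ l"
        proof -
          have "l = l - 2 + 2" using l by simp
          then have "real n ^ l = real n ^ (l - 2) * real n ^ 2" by (metis power_add)
          then show ?thesis using thr_power [OF l n] by (simp add: x_def N_def)
        qed
        then have "c * x ^ (l - 1) * N \<le> card {E\<in>cycles l n. E \<subseteq> W}" using False by (simp add: Q_def mult.assoc)
        then have "shrinks W {E\<in>cycles l n. E \<subseteq> W} (B0 * (N / x)) (\<delta> * N)"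
          using spread_cycles [OF l n Suc.prems(1)] finite_subset [OF Suc.prems(1) finite_all_edges]
          by (intro sh x1 xN cN Suc.prems(1)) (simp_all add: x_def)
        then have "containers W (cycles l n) (B0 * (N / x)) (\<lambda>C. real (card C) + \<delta> * N \<le> card W)"
          unfolding shrinks_def by (rule containers_mono) auto
        then have "containers W (cycles l n) (B0 * (N / x) + k * (B0 * (N / x))) Q"
        proof (rule containers_compose)
          fix C assume C: "C \<subseteq> W" "real (card C) + \<delta> * N \<le> card W"
          show "containers C (cycles l n) (k * (B0 * (N / x))) Q"
            by (rule Suc.IH) (use C Suc.prems in \<open>auto simp: algebra_simps\<close>)
        qed
        moreover have "real (Suc k) * (B0 * (N / x)) = B0 * (N / x) + k * (B0 * (N / x))"
          by (simp only: of_nat_Suc distrib_right mult_1_left)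
        ultimately show ?thesis by (simp only:)
      qed
    qed
    have "1 \<le> m * \<delta>"
    proof -
      have "1 / \<delta> \<le> m" unfolding m_def by linarith
      then show ?thesis using B0 by (simp add: field_simps)
    qed
    then have "1 * N \<le> m * \<delta> * N" by (intro mult_right_mono) (auto simp: N_def)
    then have "real (card (all_edges n)) \<le> m * (\<delta> * N)" using cN [of "all_edges n"] by (simp add: mult.assoc)
    then have "containers (all_edges n) (cycles l n) (real m * (B0 * (N / x))) Q" by (intro main) auto
    then show ?thesis unfolding Q_def Nx by (simp only: mult.assoc)
  qed
  moreover have "0 < m * B0"
  proof -
    have "0 < 1 / \<delta>" using B0 by simp
    then have "0 < m" unfolding m_def by linarith
    then show ?thesis using B0 by simp
  qed
  ultimately show ?thesis by blast
qed

section \<open>Supersaturation for unions of sets with few cycles\<close>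

lemma card_maps_pair_le:
  assumes "i < M" "j < M" "i \<noteq> j" "T \<subseteq> {..<n} \<times> {..<n}"
  shows "card {g \<in> {..<M} \<rightarrow>\<^sub>E {..<n}. (g i, g j) \<in> T} \<le> card T * n ^ (M - 2)"
proof -
  define P where "P = (\<lambda>ab::nat \<times> nat. PiE {..<M} (\<lambda>k. if k = i then {fst ab} else if k = j then {snd ab} else {..<n}))"
  have finT: "finite T" using assms(4) finite_subset by blast
  have "{g \<in> {..<M} \<rightarrow>\<^sub>E {..<n}. (g i, g j) \<in> T} \<subseteq> (\<Union>ab\<in>T. P ab)"
  proof
    fix g assume g: "g \<in> {g \<in> {..<M} \<rightarrow>\<^sub>E {..<n}. (g i, g j) \<in> T}"
    then have "g \<in> P (g i, g j)" by (auto simp: P_def PiE_iff)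
    then show "g \<in> (\<Union>ab\<in>T. P ab)" using g by blast
  qed
  moreover have "finite (P ab)" for ab unfolding P_def by (rule finite_PiE) auto
  ultimately have "card {g \<in> {..<M} \<rightarrow>\<^sub>E {..<n}. (g i, g j) \<in> T} \<le> card (\<Union>ab\<in>T. P ab)"
    using finT by (intro card_mono) auto
  also have "\<dots> \<le> (\<Sum>ab\<in>T. card (P ab))" by (rule card_UN_le [OF finT])
  also have "\<dots> = (\<Sum>ab\<in>T. n ^ (M - 2))"
  proof (rule sum.cong [OF refl])
    fix ab
    have "card (P ab) = (\<Prod>k<M. card (if k = i then {fst ab} else if k = j then {snd ab} else {..<n}))"
      unfolding P_def by (rule card_PiE) simp
    also have "\<dots> = (\<Prod>k<M. if k \<in> {i, j} then 1 else n)" by (rule prod.cong) auto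
    also have "\<dots> = n ^ card ({..<M} \<inter> - {i, j})"
    proof -
      have "(\<Prod>k<M. if k \<in> A then 1 else n) = n ^ card ({..<M} \<inter> - A)" for A
        by (simp add: prod.If_cases)
      then show ?thesis .
    qed
    also have "{..<M} \<inter> - {i, j} = {..<M} - {i, j}" by auto
    also have "card ({..<M} - {i, j}) = M - 2"
      using assms(1-3) by (subst card_Diff_subset) auto
    finally show "card (P ab) = n ^ (M - 2)" .
  qed
  finally show ?thesis by simp
qed

text \<open>Average over all maps of a fixed Ramsey clique on \<open>M\<close> vertices into
  \<open>{..<n}\<close>. If few pairs were missed, at least half of the maps would send all pairs
  into the sets \<open>C k\<close>. Colouring each pair by such a \<open>k\<close> gives a cycle
  inside some \<open>C k\<close>, and one cycle accounts for too few maps.\<close>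

lemma cycle_supersaturation:
  assumes l: "odd l" "2 ^ r + 1 \<le> l" "3 \<le> l" and r: "0 < r"
  shows "\<exists>c \<delta>::real. 0 < c \<and> 0 < \<delta> \<and> \<delta> \<le> 1 \<and> (\<exists>n0. \<forall>n\<ge>n0. \<forall>C::nat \<Rightarrow> nat set set.
    (\<forall>k<r. card {E\<in>cycles l n. E \<subseteq> C k} < c * real n ^ l) \<longrightarrow>
    \<delta> * real n ^ 2 \<le> card (all_edges n - (\<Union>k<r. C k)))"
proof -
  obtain M0 where M0: "cycle_ramsey l r (all_edges M0)" using complete_graph_cycle_ramsey [OF l(1,2) r] by blast
  define M where "M = max M0 2"
  have "all_edges M0 \<subseteq> all_edges M" by (auto simp: all_edges_def M_def) (metis less_max_iff_disj)
  then have ram: "cycle_ramsey l r (all_edges M)" using M0 cycle_ramsey_mono by blast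
  have M2: "2 \<le> M" by (simp add: M_def)
  \<comment> \<open>The factors count colours, positions of the cycle in the clique and labellings
    of one cycle; 2 stands for the half of the maps that are good.\<close>
  define c where "c = 1 / (2 * real r * real M ^ l * real l ^ l)"
  \<comment> \<open>At most a quarter of the maps fail because of a missed pair, and by
    \<open>4 * M ^ 2 \<le> n\<close> at most a quarter because of a collision.\<close>
  define \<delta> where "\<delta> = 1 / (8 * real M ^ 2)"
  define n0 where "n0 = max M (4 * M ^ 2)"
  have c0: "0 < c" using r M2 l by (simp add: c_def)
  have \<delta>0: "0 < \<delta>" using M2 by (simp add: \<delta>_def)
  have "1 \<le> real M ^ 2" using M2 by simp
  then have "1 \<le> 8 * real M ^ 2" by linarith
  then have \<delta>1: "\<delta> \<le> 1" unfolding \<delta>_def by (subst divide_le_eq_1) linarith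
  have "\<delta> * real n ^ 2 \<le> card (all_edges n - (\<Union>k<r. C k))"
    if n: "n0 \<le> n" and few: "\<And>k. k < r \<Longrightarrow> card {E\<in>cycles l n. E \<subseteq> C k} < c * real n ^ l"
    for n and C :: "nat \<Rightarrow> nat set set"
  proof (rule ccontr)
    assume less: "\<not> \<delta> * real n ^ 2 \<le> card (all_edges n - (\<Union>k<r. C k))"
    define R where "R = all_edges n - (\<Union>k<r. C k)"
    have nM: "M \<le> n" "4 * M ^ 2 \<le> n" using n by (auto simp: n0_def)
    have n2: "2 \<le> n" using nM M2 by simp
    define \<G> where "\<G> = {..<M} \<rightarrow>\<^sub>E {..<n}"
    have cG: "card \<G> = n ^ M" unfolding \<G>_def by (subst card_PiE) auto
    have finG: "finite \<G>" unfolding \<G>_def by (rule finite_PiE) auto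
    \<comment> \<open>The diagonal is included, so that maps outside \<open>bad\<close> are
      injective.\<close>
    define T where "T = {(a, b). a < n \<and> b < n \<and> (a = b \<or> {a, b} \<in> R)}"
    have Tsub: "T \<subseteq> {..<n} \<times> {..<n}" by (auto simp: T_def)
    have cT: "card T \<le> n + 2 * card R"
    proof -
      have finR: "finite R" by (simp add: R_def)
      define P where "P = (\<lambda>e::nat set. {(a, b). e = {a, b} \<and> a \<noteq> b})"
      have cP: "card (P e) \<le> 2 \<and> finite (P e)" if "e \<in> R" for e
      proof -
        obtain a b where ab: "e = {a, b}" using \<open>e \<in> R\<close> by (auto simp: R_def all_edges_def)
        have "P e \<subseteq> {(a, b), (b, a)}" unfolding P_def ab by (auto simp: doubleton_eq_iff)
        moreover have "card {(a, b), (b, a)} \<le> 2" by (rule card_insert_le_m1) auto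
        ultimately show ?thesis using card_mono [of "{(a, b), (b, a)}" "P e"] finite_subset by fastforce
      qed
      have "T \<subseteq> (\<lambda>a. (a, a)) ` {..<n} \<union> (\<Union>e\<in>R. P e)"
        by (auto simp: T_def P_def)
      then have "card T \<le> card ((\<lambda>a. (a, a)) ` {..<n} \<union> (\<Union>e\<in>R. P e))"
        using finR cP by (intro card_mono) auto
      also have "\<dots> \<le> card ((\<lambda>a. (a, a)) ` {..<n}) + card (\<Union>e\<in>R. P e)" by (rule card_Un_le)
      also have "\<dots> \<le> n + (\<Sum>e\<in>R. card (P e))"
        using card_UN_le [OF finR, of P] card_image_le [of "{..<n}" "\<lambda>a. (a, a)"] by (intro add_mono) auto
      also have "(\<Sum>e\<in>R. card (P e)) \<le> (\<Sum>e\<in>R. 2)" using cP by (intro sum_mono) auto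
      finally show ?thesis by simp
    qed
    define bad where "bad = (\<Union>ij\<in>{ij\<in>{..<M}\<times>{..<M}. fst ij \<noteq> snd ij}. {g \<in> \<G>. (g (fst ij), g (snd ij)) \<in> T})"
    have "card bad \<le> (\<Sum>ij\<in>{ij\<in>{..<M}\<times>{..<M}. fst ij \<noteq> snd ij}. card {g \<in> \<G>. (g (fst ij), g (snd ij)) \<in> T})"
      unfolding bad_def by (rule card_UN_le) simp
    also have "\<dots> \<le> (\<Sum>ij\<in>{ij\<in>{..<M}\<times>{..<M}. fst ij \<noteq> snd ij}. card T * n ^ (M - 2))"
      unfolding \<G>_def by (intro sum_mono card_maps_pair_le Tsub) auto
    also have "\<dots> \<le> card ({..<M}\<times>{..<M}) * (card T * n ^ (M - 2))"
    proof -
      have "card {ij\<in>{..<M}\<times>{..<M}. fst ij \<noteq> snd ij} \<le> card ({..<M}\<times>{..<M})"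
        by (rule card_mono) auto
      then show ?thesis unfolding sum_constant by (intro mult_le_mono1) simp
    qed
    finally have "card bad \<le> M ^ 2 * (card T * n ^ (M - 2))" by (simp add: power2_eq_square card_cartesian_product)
    then have "real (card bad) \<le> real M ^ 2 * (real (card T) * real n ^ (M - 2))"
      by (metis of_nat_mono of_nat_mult of_nat_power)
    also have "\<dots> \<le> real M ^ 2 * ((real n + 2 * (\<delta> * real n ^ 2)) * real n ^ (M - 2))"
    proof (intro mult_left_mono mult_right_mono)
      have "real (card T) \<le> n + 2 * real (card R)" using cT by (metis of_nat_add of_nat_mono of_nat_mult of_nat_numeral)
      then show "real (card T) \<le> real n + 2 * (\<delta> * real n ^ 2)" using less by (simp add: R_def)
    qed auto
    also have "\<dots> \<le> (real n ^ 2 / 2) * real n ^ (M - 2)"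
    proof -
      have "real M ^ 2 * (2 * (\<delta> * real n ^ 2)) = real n ^ 2 / 4" using M2 by (simp add: \<delta>_def)
      moreover have "real (4 * M ^ 2) \<le> real n" using nM by (rule_tac of_nat_mono)
      then have "(4 * real M ^ 2) * real n \<le> real n * real n" by (intro mult_right_mono) auto
      then have "4 * (real M ^ 2 * real n) \<le> real n ^ 2" by (simp add: power2_eq_square mult.assoc)
      ultimately have "real M ^ 2 * (real n + 2 * (\<delta> * real n ^ 2)) \<le> real n ^ 2 / 2"
        unfolding distrib_left by linarith
      from mult_right_mono [OF this, of "real n ^ (M - 2)"] show ?thesis by (simp add: mult.assoc)
    qed
    also have "\<dots> = real n ^ M / 2"
    proof -
      have "M = 2 + (M - 2)" using M2 by simp
      then have "real n ^ M = real n ^ 2 * real n ^ (M - 2)" by (metis power_add)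
      then show ?thesis by simp
    qed
    finally have cbad: "real (card bad) \<le> real n ^ M / 2" .
    have finbad: "bad \<subseteq> \<G>" by (auto simp: bad_def)
    have cgood: "real n ^ M / 2 \<le> card (\<G> - bad)"
    proof -
      have "card (\<G> - bad) = card \<G> - card bad" using finbad finG finite_subset by (intro card_Diff_subset) auto
      moreover have "card bad \<le> card \<G>" using finbad finG by (rule_tac card_mono)
      ultimately have "real (card (\<G> - bad)) = real n ^ M - real (card bad)" using cG by (simp add: of_nat_diff)
      then show ?thesis using cbad by linarith
    qed
    define Y where "Y = (\<lambda>k. {h \<in> cycle_maps l n. cyc l h \<subseteq> C k})"
    \<comment> \<open>The maps that place the cycle \<open>f\<close> of the clique onto the labelled
      cycle \<open>h\<close>; only the other \<open>M - l\<close> vertices are free.\<close>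
    define Z where "Z = (\<lambda>f h. {g \<in> \<G>. \<forall>j<l. g (f j) = (h j :: nat)})"
    have Zcard: "card (Z f h) \<le> n ^ (M - l)" if f: "f \<in> cycle_maps l M" for f h
    proof -
      have fl: "f j < M" if "j < l" for j using f that by (auto simp: cycle_maps_def)
      have fi: "inj_on f {..<l}" using f by (simp add: cycle_maps_def)
      define W where "W = PiE {..<M} (\<lambda>v. if v \<in> f ` {..<l} then {h (inv_into {..<l} f v)} else {..<n})"
      have "Z f h \<subseteq> W"
      proof
        fix g assume g: "g \<in> Z f h"
        have "g (f j) = h (inv_into {..<l} f (f j))" if "j < l" for j
          using g that inv_into_f_f [OF fi] by (auto simp: Z_def)
        then show "g \<in> W" using g by (auto simp: Z_def W_def \<G>_def PiE_iff)
      qed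
      moreover have "finite W" unfolding W_def by (rule finite_PiE) auto
      ultimately have "card (Z f h) \<le> card W" by (intro card_mono)
      also have "card W = (\<Prod>v<M. card (if v \<in> f ` {..<l} then {h (inv_into {..<l} f v)} else {..<n}))"
        unfolding W_def by (rule card_PiE) simp
      also have "\<dots> = (\<Prod>v<M. if v \<in> f ` {..<l} then 1 else n)" by (rule prod.cong) auto
      also have "\<dots> = n ^ card ({..<M} \<inter> - f ` {..<l})" by (simp add: prod.If_cases)
      also have "{..<M} \<inter> - f ` {..<l} = {..<M} - f ` {..<l}" by auto
      also have "card ({..<M} - f ` {..<l}) = M - l"
        using fl by (subst card_Diff_subset) (auto simp: card_image [OF fi])
      finally show ?thesis .
    qed
    have cover: "\<G> - bad \<subseteq> (\<Union>k<r. \<Union>f\<in>cycle_maps l M. \<Union>h\<in>Y k. Z f h)"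
    proof
      fix g assume g: "g \<in> \<G> - bad"
      have notT: "(g i, g j) \<notin> T" if "i < M" "j < M" "i \<noteq> j" for i j
        using g that by (force simp: bad_def)
      have gn: "g i < n" if "i < M" for i using g that by (auto simp: \<G>_def)
      have edge: "\<exists>k<r. g ` e \<in> C k" if "e \<in> all_edges M" for e
      proof -
        obtain i j where ij: "i < M" "j < M" "i \<noteq> j" "e = {i, j}"
          using \<open>e \<in> all_edges M\<close> by (auto simp: all_edges_def)
        have "g i \<noteq> g j" "{g i, g j} \<notin> R" using notT [OF ij(1-3)] gn ij by (auto simp: T_def)
        moreover have "{g i, g j} \<in> all_edges n" using calculation gn ij by (auto simp: all_edges_def)
        ultimately show ?thesis using ij(4) by (auto simp: R_def)
      qed
      define col where "col = (\<lambda>e. if e \<in> all_edges M then (SOME k. k < r \<and> g ` e \<in> C k) else 0)"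
      have col: "col e < r \<and> g ` e \<in> C (col e)" if "e \<in> all_edges M" for e
        using someI_ex [OF edge [OF that]] that by (simp add: col_def)
      then obtain k where k: "k < r" "has_cycle l {e\<in>all_edges M. col e = k}"
        using ram unfolding cycle_ramsey_def by blast
      obtain D where D: "D \<in> cycles l M" "D \<subseteq> {e\<in>all_edges M. col e = k}"
        by (rule has_cycle_imp_cycles [OF k(2), of M]) auto
      then obtain f where f: "f \<in> cycle_maps l M" "D = cyc l f" by (auto simp: cycles_def)
      define h where "h = restrict (g \<circ> f) {..<l}"
      have fl: "f j < M" if "j < l" for j using f that by (auto simp: cycle_maps_def)
      have "h \<in> cycle_maps l n"
        unfolding cycle_maps_def
      proof (intro CollectI conjI)
        show "h \<in> {..<l} \<rightarrow>\<^sub>E {..<n}" using gn fl by (auto simp: h_def)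
        have "g (f i) \<noteq> g (f j)" if "i < l" "j < l" "i \<noteq> j" for i j
        proof -
          have "f i \<noteq> f j" using f(1) that by (auto simp: cycle_maps_def inj_on_def)
          then show ?thesis using notT [OF fl [OF that(1)] fl [OF that(2)]] gn fl that by (auto simp: T_def)
        qed
        then show "inj_on h {..<l}" by (auto simp: h_def inj_on_def)
      qed
      moreover have "cyc l h \<subseteq> C k"
      proof
        fix e assume "e \<in> cyc l h"
        then obtain i where i: "i < l" "e = {h i, h (Suc i mod l)}" by (auto simp: cyc_def)
        then have "e = g ` {f i, f (Suc i mod l)}" using l by (simp add: h_def)
        moreover have "{f i, f (Suc i mod l)} \<in> {e\<in>all_edges M. col e = k}"
          using D(2) f(2) i by (auto simp: cyc_def)
        then have "col {f i, f (Suc i mod l)} = k" "g ` {f i, f (Suc i mod l)} \<in> C (col {f i, f (Suc i mod l)})"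
          using col [of "{f i, f (Suc i mod l)}"] by blast+
        ultimately show "e \<in> C k" by (simp only:)
      qed
      ultimately have "h \<in> Y k" by (simp add: Y_def)
      moreover have "g \<in> Z f h" using g by (simp add: Z_def h_def)
      ultimately show "g \<in> (\<Union>k<r. \<Union>f\<in>cycle_maps l M. \<Union>h\<in>Y k. Z f h)" using k(1) f(1) by blast
    qed
    have finY: "finite (Y k)" for k by (simp add: Y_def)
    have finZ: "finite (Z f h)" for f h using finG by (simp add: Z_def)
    have Ycard: "real (card (Y k)) < real l ^ l * (c * real n ^ l)" if "k < r" for k
    proof -
      have "Y k \<subseteq> (\<Union>E\<in>{E\<in>cycles l n. E \<subseteq> C k}. {h\<in>cycle_maps l n. cyc l h = E})"
        by (auto simp: Y_def cycles_def)
      then have "card (Y k) \<le> card (\<Union>E\<in>{E\<in>cycles l n. E \<subseteq> C k}. {h\<in>cycle_maps l n. cyc l h = E})"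
        by (intro card_mono) auto
      also have "\<dots> \<le> (\<Sum>E\<in>{E\<in>cycles l n. E \<subseteq> C k}. card {h\<in>cycle_maps l n. cyc l h = E})"
        by (rule card_UN_le) simp
      also have "\<dots> \<le> (\<Sum>E\<in>{E\<in>cycles l n. E \<subseteq> C k}. l ^ l)"
      proof (rule sum_mono)
        fix E assume "E \<in> {E\<in>cycles l n. E \<subseteq> C k}"
        then obtain h0 where h0: "h0 \<in> cycle_maps l n" "E = cyc l h0" by (auto simp: cycles_def)
        have U: "\<Union>(cyc l h) = h ` {..<l}" for h
          using l by (auto simp: cyc_def)
        have "{h\<in>cycle_maps l n. cyc l h = E} \<subseteq> {..<l} \<rightarrow>\<^sub>E (h0 ` {..<l})"
        proof
          fix h assume h: "h \<in> {h\<in>cycle_maps l n. cyc l h = E}"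
          then have "h ` {..<l} = h0 ` {..<l}" using U [of h] U [of h0] h0 by simp
          then show "h \<in> {..<l} \<rightarrow>\<^sub>E (h0 ` {..<l})" using h by (auto simp: cycle_maps_def PiE_iff)
        qed
        then have "card {h\<in>cycle_maps l n. cyc l h = E} \<le> card ({..<l} \<rightarrow>\<^sub>E (h0 ` {..<l}))"
          by (intro card_mono finite_PiE) auto
        also have "\<dots> = card (h0 ` {..<l}) ^ l" by (subst card_PiE) auto
        also have "\<dots> \<le> l ^ l" using card_image_le [of "{..<l}" h0] by (intro power_mono) auto
        finally show "card {h\<in>cycle_maps l n. cyc l h = E} \<le> l ^ l" .
      qed
      also have "\<dots> = l ^ l * card {E\<in>cycles l n. E \<subseteq> C k}" by simp
      finally have "real (card (Y k)) \<le> real l ^ l * real (card {E\<in>cycles l n. E \<subseteq> C k})"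
        by (metis of_nat_mono of_nat_mult of_nat_power)
      also have "\<dots> < real l ^ l * (c * real n ^ l)" using few [OF that] l by (intro mult_strict_left_mono) auto
      finally show ?thesis .
    qed
    have "card (\<G> - bad) \<le> card (\<Union>k<r. \<Union>f\<in>cycle_maps l M. \<Union>h\<in>Y k. Z f h)"
      using cover finY finZ by (intro card_mono) auto
    also have "\<dots> \<le> (\<Sum>k<r. card (\<Union>f\<in>cycle_maps l M. \<Union>h\<in>Y k. Z f h))" by (rule card_UN_le) simp
    also have "\<dots> \<le> (\<Sum>k<r. \<Sum>f\<in>cycle_maps l M. card (\<Union>h\<in>Y k. Z f h))"
      by (intro sum_mono card_UN_le) simp
    also have "\<dots> \<le> (\<Sum>k<r. \<Sum>f\<in>cycle_maps l M. \<Sum>h\<in>Y k. card (Z f h))"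
      by (intro sum_mono card_UN_le finY)
    also have "\<dots> \<le> (\<Sum>k<r. \<Sum>f\<in>cycle_maps l M. \<Sum>h\<in>Y k. n ^ (M - l))"
      by (intro sum_mono Zcard)
    also have "\<dots> = card (cycle_maps l M) * n ^ (M - l) * (\<Sum>k<r. card (Y k))"
      by (simp add: sum_distrib_left mult_ac)
    finally have "real (card (\<G> - bad)) \<le> real (card (cycle_maps l M)) * real n ^ (M - l) * (\<Sum>k<r. real (card (Y k)))"
      by (metis (mono_tags, lifting) of_nat_mono of_nat_mult of_nat_power of_nat_sum sum.cong)
    also have "\<dots> \<le> real M ^ l * real n ^ (M - l) * (\<Sum>k<r. real (card (Y k)))"
    proof (intro mult_right_mono sum_nonneg)
      have "card (cycle_maps l M) \<le> card ({..<l} \<rightarrow>\<^sub>E {..<M})"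
        by (rule card_mono) (auto simp: cycle_maps_def intro: finite_PiE)
      also have "\<dots> = M ^ l" by (subst card_PiE) auto
      finally show "real (card (cycle_maps l M)) \<le> real M ^ l" by (metis of_nat_mono of_nat_power)
    qed auto
    also have "\<dots> < real M ^ l * real n ^ (M - l) * (\<Sum>k<r. real l ^ l * (c * real n ^ l))"
      using M2 n2 r by (intro mult_strict_left_mono sum_strict_mono Ycard) auto
    also have "\<dots> = (real n ^ (M - l) * real n ^ l) * ((real r * real M ^ l * real l ^ l) * c)" by (simp add: mult_ac)
    also have "(real r * real M ^ l * real l ^ l) * c = 1 / 2" using r M2 l by (simp add: c_def)
    also have "real n ^ (M - l) * real n ^ l = real n ^ M"
    proof -
      \<comment> \<open>This gives \<open>l \<le> M\<close>, without which the truncated exponent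
        \<open>M - l\<close> could not be recombined. A good map exists by \<open>cgood\<close>, and
        it produces a cycle in the clique.\<close>
      have "cycle_maps l M \<noteq> {}"
      proof
        assume "cycle_maps l M = {}"
        then have empty: "\<G> - bad = {}" using cover by auto
        have "real n ^ M / 2 \<le> 0" using cgood by (simp only: empty card.empty of_nat_0)
        moreover have "0 < real n ^ M / 2" using n2 by simp
        ultimately show False by linarith
      qed
      then obtain f where "f \<in> cycle_maps l M" by blast
      then have "card {..<l} \<le> card {..<M}" by (intro card_inj_on_le [of f]) (auto simp: cycle_maps_def)
      then show ?thesis by (simp flip: power_add)
    qed
    finally show False using cgood by simp
  qed
  then show ?thesis using c0 \<delta>0 \<delta>1 by blast
qed

section \<open>Union bound over fingerprints\<close>

lemma sum_Pow_power: "finite E \<Longrightarrow> (\<Sum>T\<in>Pow E. a ^ card T) = (1 + a :: real) ^ card E"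
proof (induction E rule: finite_induct)
  case (insert x E)
  have "(\<Sum>T\<in>Pow (insert x E). a ^ card T) = (\<Sum>T\<in>Pow E. a ^ card T) + (\<Sum>T\<in>insert x ` Pow E. a ^ card T)"
    unfolding Pow_insert by (rule sum.union_disjoint) (use insert in auto)
  also have "(\<Sum>T\<in>insert x ` Pow E. a ^ card T) = (\<Sum>T\<in>Pow E. a ^ card (insert x T))"
    by (rule sum.reindex_cong [of "insert x"]) (use insert in \<open>auto simp: inj_on_def\<close>)
  also have "\<dots> = (\<Sum>T\<in>Pow E. a * a ^ card T)"
  proof (rule sum.cong [OF refl])
    fix T assume "T \<in> Pow E"
    then have "finite T" "x \<notin> T" using insert finite_subset by auto
    then show "a ^ card (insert x T) = a * a ^ card T" by simp
  qed
  also have "\<dots> = a * (\<Sum>T\<in>Pow E. a ^ card T)" by (simp add: sum_distrib_left)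
  finally show ?case using insert by (simp add: algebra_simps)
qed simp

text \<open>Exponential tilting: for \<open>card T \<le> b\<close> and \<open>y \<le> 1\<close> the
  factor \<open>y powr (card T - b)\<close> is at least 1; inserting it allows the sum to be
  extended to all subsets.\<close>

lemma sum_small_subsets_le:
  fixes p y b :: real
  assumes "finite E" "0 \<le> p" "0 < y" "y \<le> 1" "0 \<le> b"
  shows "(\<Sum>T\<in>{T\<in>Pow E. real (card T) \<le> b}. p ^ card T) \<le> y powr (-b) * exp (p * y * card E)"
proof -
  have "(\<Sum>T\<in>{T\<in>Pow E. real (card T) \<le> b}. p ^ card T) \<le> (\<Sum>T\<in>{T\<in>Pow E. real (card T) \<le> b}. y powr (-b) * (p * y) ^ card T)"
  proof (rule sum_mono)
    fix T assume T: "T \<in> {T\<in>Pow E. real (card T) \<le> b}"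
    have "1 = y powr (-b) * y powr b" using assms by (simp flip: powr_add)
    also have "\<dots> \<le> y powr (-b) * y powr (card T)"
      using T assms by (intro mult_left_mono powr_mono') auto
    also have "\<dots> = y powr (-b) * y ^ card T" using assms by (simp add: powr_realpow)
    finally have "1 * p ^ card T \<le> (y powr (-b) * y ^ card T) * p ^ card T"
      using assms by (intro mult_right_mono) auto
    then show "p ^ card T \<le> y powr (-b) * (p * y) ^ card T" by (simp add: power_mult_distrib mult_ac)
  qed
  also have "\<dots> \<le> (\<Sum>T\<in>Pow E. y powr (-b) * (p * y) ^ card T)"
    by (rule sum_mono2) (use assms in auto)
  also have "\<dots> = y powr (-b) * (1 + p * y) ^ card E"
    using sum_Pow_power [OF assms(1), of "p * y"] by (simp flip: sum_distrib_left)
  also have "\<dots> \<le> y powr (-b) * exp (p * y) ^ card E"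
    using assms exp_ge_add_one_self [of "p * y"] by (intro mult_left_mono power_mono) auto
  also have "exp (p * y) ^ card E = exp (p * y * card E)" by (simp add: mult.commute flip: exp_of_nat_mult)
  finally show ?thesis .
qed

text \<open>A good colouring splits \<open>F\<close> into \<open>r\<close> independent sets. Their
  fingerprints are disjoint subsets of \<open>F\<close>, and \<open>F\<close> avoids all pairs
  outside the containers. For a fixed tuple these two events concern disjoint sets of edges, so the
  probability factorizes.\<close>

lemma prob_not_ramsey_le:
  fixes b \<delta> y p :: real
  assumes l: "3 \<le> l" and cont: "containers (all_edges n) (cycles l n) b Q" and p: "0 \<le> p" "p \<le> 1"
    and y: "0 < y" "y \<le> 1" and b: "0 \<le> b"
    and miss: "\<And>C. (\<And>k. k < r \<Longrightarrow> Q (C k)) \<Longrightarrow> \<delta> * real n ^ 2 \<le> card (all_edges n - (\<Union>k<r. C k))"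
  shows "pr (all_edges n) p (\<lambda>F. \<not> cycle_ramsey l r F) \<le>
    exp (- p * (\<delta> * real n ^ 2)) * (y powr (-b) * exp (p * y * real n ^ 2)) ^ r"
proof -
  define E where "E = all_edges n"
  have finE: "finite E" by (simp add: E_def)
  obtain fp ct where m: "container_maps E (cycles l n) b Q fp ct"
    using cont by (auto simp: containers_def E_def)
  define S where "S = {T\<in>Pow E. real (card T) \<le> b}"
  have finS: "finite S" using finE by (simp add: S_def)
  define \<T> where "\<T> = {T \<in> {..<r} \<rightarrow>\<^sub>E S. (\<forall>i<r. \<forall>j<r. i \<noteq> j \<longrightarrow> T i \<inter> T j = {}) \<and> (\<forall>i<r. T i \<subseteq> ct (T i)) \<and>
    \<delta> * real n ^ 2 \<le> card (E - (\<Union>i<r. ct (T i)))}"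
  have finT: "finite \<T>" unfolding \<T>_def using finS by (intro finite_subset [OF _ finite_PiE [of "{..<r}" "\<lambda>_. S"]]) auto
  have "pr E p (\<lambda>F. \<not> cycle_ramsey l r F) \<le>
      pr E p (\<lambda>F. \<exists>T\<in>\<T>. (\<Union>i<r. T i) \<subseteq> F \<and> F \<inter> (E - (\<Union>i<r. ct (T i))) = {})"
  proof (rule pr_mono [OF p])
    fix F assume F: "F \<subseteq> E" "\<not> cycle_ramsey l r F"
    then obtain c where c: "\<forall>e\<in>F. c e < r" "\<And>k. k < r \<Longrightarrow> \<not> has_cycle l {e\<in>F. c e = k}"
      unfolding cycle_ramsey_def by blast
    define I where "I = (\<lambda>k. {e\<in>F. c e = k})"
    have ind: "\<forall>D\<in>cycles l n. \<not> D \<subseteq> I k" if "k < r" for k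
      using c(2) [OF that] cyclesD(3) [OF l] has_cycle_mono unfolding I_def by blast
    have IE: "I k \<subseteq> E" for k using F by (auto simp: I_def)
    note D = container_mapsD [OF m IE ind]
    define T where "T = restrict (\<lambda>k. fp (I k)) {..<r}"
    \<comment> \<open>The container is recovered by applying \<open>ct\<close> to the fingerprint
      itself; hence the union bound ranges over fingerprints only.\<close>
    have ctT: "ct (fp (I k)) = ct (I k)" if "k < r" for k
      using D(6) [OF that order_refl D(1) [OF that]] by simp
    have "T \<in> \<T>"
      unfolding \<T>_def
    proof (intro CollectI conjI allI impI)
      show "T \<in> {..<r} \<rightarrow>\<^sub>E S"
      proof (rule PiE_I)
        fix k assume "k \<in> {..<r}"
        then have k: "k < r" by simp
        show "T k \<in> S" using D(1,2) [OF k] IE [of k] k by (auto simp: T_def S_def)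
      qed (simp add: T_def)
      show "T i \<inter> T j = {}" if "i < r" "j < r" "i \<noteq> j" for i j
      proof -
        have "I i \<inter> I j = {}" using that by (auto simp: I_def)
        then show ?thesis using D(1) [OF that(1)] D(1) [OF that(2)] that by (auto simp: T_def)
      qed
      show "T i \<subseteq> ct (T i)" if "i < r" for i
        using D(1,3) [OF that] ctT [OF that] that by (auto simp: T_def)
      have "(\<Union>i<r. ct (T i)) = (\<Union>i<r. ct (I i))" using ctT by (auto simp: T_def)
      moreover have "\<delta> * real n ^ 2 \<le> card (E - (\<Union>i<r. ct (I i)))"
        unfolding E_def by (rule miss) (rule D(5))
      ultimately show "\<delta> * real n ^ 2 \<le> card (E - (\<Union>i<r. ct (T i)))" by simp
    qed
    moreover have "(\<Union>i<r. T i) \<subseteq> F" using D(1) by (auto simp: T_def I_def)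
    moreover have "F \<inter> (E - (\<Union>i<r. ct (T i))) = {}"
    proof -
      have "e \<in> (\<Union>i<r. ct (T i))" if "e \<in> F" for e
      proof -
        have "c e < r" "e \<in> I (c e)" using c that by (auto simp: I_def)
        then have "e \<in> ct (T (c e))" using D(3) ctT by (auto simp: T_def)
        then show ?thesis using \<open>c e < r\<close> by blast
      qed
      then show ?thesis by blast
    qed
    ultimately show "\<exists>T\<in>\<T>. (\<Union>i<r. T i) \<subseteq> F \<and> F \<inter> (E - (\<Union>i<r. ct (T i))) = {}" by blast
  qed
  also have "\<dots> \<le> (\<Sum>T\<in>\<T>. pr E p (\<lambda>F. (\<Union>i<r. T i) \<subseteq> F \<and> F \<inter> (E - (\<Union>i<r. ct (T i))) = {}))"
    by (rule pr_Bex [OF p finT])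
  also have "\<dots> \<le> (\<Sum>T\<in>\<T>. exp (- p * (\<delta> * real n ^ 2)) * (\<Prod>i<r. p ^ card (T i)))"
  proof (rule sum_mono)
    fix T assume T: "T \<in> \<T>"
    then have TS: "T i \<in> S" if "i < r" for i using that by (auto simp: \<T>_def)
    define R where "R = E - (\<Union>i<r. ct (T i))"
    have TE: "T i \<subseteq> E" "finite (T i)" if "i < r" for i
      using TS [OF that] finite_subset [OF _ finE] by (auto simp: S_def)
    have "pr E p (\<lambda>F. (\<Union>i<r. T i) \<subseteq> F \<and> F \<inter> R = {}) = p ^ card (\<Union>i<r. T i) * (1 - p) ^ card R"
    proof (rule pr_contain_avoid [OF finE])
      show "(\<Union>i<r. T i) \<subseteq> E" using TE by blast
      have "T i \<subseteq> ct (T i)" if "i < r" for i using T that by (simp add: \<T>_def)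
      then show "(\<Union>i<r. T i) \<inter> R = {}" unfolding R_def by blast
    qed (simp add: R_def)
    also have "card (\<Union>i<r. T i) = (\<Sum>i<r. card (T i))"
      by (rule card_UN_disjoint) (use TE T in \<open>auto simp: \<T>_def\<close>)
    also have "p ^ (\<Sum>i<r. card (T i)) = (\<Prod>i<r. p ^ card (T i))" by (rule power_sum)
    finally have eq: "pr E p (\<lambda>F. (\<Union>i<r. T i) \<subseteq> F \<and> F \<inter> R = {}) = (\<Prod>i<r. p ^ card (T i)) * (1 - p) ^ card R" .
    have "(1 - p) ^ card R \<le> exp (- p) ^ card R"
      using p exp_ge_add_one_self [of "- p"] by (intro power_mono) auto
    also have "\<dots> = exp (- p * card R)" by (simp add: mult.commute flip: exp_of_nat_mult)
    also have "\<dots> \<le> exp (- p * (\<delta> * real n ^ 2))"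
      using T p by (auto simp: \<T>_def R_def intro!: mult_left_mono)
    finally have "(\<Prod>i<r. p ^ card (T i)) * (1 - p) ^ card R \<le> (\<Prod>i<r. p ^ card (T i)) * exp (- p * (\<delta> * real n ^ 2))"
      using p by (intro mult_left_mono prod_nonneg) auto
    then show "pr E p (\<lambda>F. (\<Union>i<r. T i) \<subseteq> F \<and> F \<inter> (E - (\<Union>i<r. ct (T i))) = {}) \<le>
        exp (- p * (\<delta> * real n ^ 2)) * (\<Prod>i<r. p ^ card (T i))"
      using eq unfolding R_def by (simp only: mult.commute)
  qed
  also have "\<dots> = exp (- p * (\<delta> * real n ^ 2)) * (\<Sum>T\<in>\<T>. \<Prod>i<r. p ^ card (T i))"
    by (simp only: sum_distrib_left)
  also have "\<dots> \<le> exp (- p * (\<delta> * real n ^ 2)) * (\<Sum>T\<in>{..<r} \<rightarrow>\<^sub>E S. \<Prod>i<r. p ^ card (T i))"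
    by (intro mult_left_mono sum_mono2 finite_PiE) (use finS p in \<open>auto simp: \<T>_def intro!: prod_nonneg\<close>)
  also have "(\<Sum>T\<in>{..<r} \<rightarrow>\<^sub>E S. \<Prod>i<r. p ^ card (T i)) = (\<Prod>i<r. \<Sum>T\<in>S. p ^ card T)"
    by (rule prod_sum_PiE [symmetric]) (use finS in auto)
  also have "\<dots> = (\<Sum>T\<in>S. p ^ card T) ^ r" by simp
  also have "\<dots> \<le> (y powr (-b) * exp (p * y * real n ^ 2)) ^ r"
  proof (rule power_mono)
    have "(\<Sum>T\<in>S. p ^ card T) \<le> y powr (-b) * exp (p * y * card E)"
      unfolding S_def by (rule sum_small_subsets_le) (use finE p y b in auto)
    also have "\<dots> \<le> y powr (-b) * exp (p * y * real n ^ 2)"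
    proof -
      have "real (card E) \<le> real n ^ 2"
        using card_all_edges_le [of n] zero_le_power2 [of "real n"] unfolding E_def by linarith
      then show ?thesis using p y by (intro mult_left_mono) (auto intro!: mult_left_mono)
    qed
    finally show "(\<Sum>T\<in>S. p ^ card T) \<le> y powr (-b) * exp (p * y * real n ^ 2)" .
  qed (use p in \<open>auto intro!: sum_nonneg\<close>)
  finally show ?thesis by (simp add: E_def)
qed

text \<open>With \<open>p \<ge> K * thr l n\<close> the two costs of the fingerprints are at most a
  quarter each of the gain \<open>\<delta> * p * n ^ 2\<close>, so half of it remains.\<close>

lemma pert_upper_thr:
  assumes l: "odd l" "2 ^ r + 1 \<le> l" "3 \<le> l" and r: "0 < r"
  shows "pert_upper l r d (thr l)"
proof -
  obtain c \<delta> :: real and n0 where c: "0 < c" and \<delta>: "0 < \<delta>" "\<delta> \<le> 1" and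
    sat: "\<And>n C. n0 \<le> n \<Longrightarrow> (\<And>k. k < r \<Longrightarrow> card {E\<in>cycles l n. E \<subseteq> C k} < c * real n ^ l) \<Longrightarrow>
    \<delta> * real n ^ 2 \<le> card (all_edges n - (\<Union>k<r. C k))"
    using cycle_supersaturation [OF l r] by blast
  obtain B :: real where B: "0 < B" and cont: "\<And>n. 0 < n \<Longrightarrow> containers (all_edges n) (cycles l n) (B * (real n ^ 2 * thr l n))
    (\<lambda>C. real (card {E\<in>cycles l n. E \<subseteq> C}) < c * real n ^ l)"
    using cycle_containers [OF l(3) c] by blast
  \<comment> \<open>Makes the total of the \<open>r\<close> exponents \<open>p * y * n ^ 2\<close>
    equal to \<open>\<delta> / 4 * p * n ^ 2\<close>.\<close>
  define y where "y = \<delta> / (4 * r)"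
  have y: "0 < y" "y \<le> 1" using \<delta> r by (auto simp: y_def divide_le_eq)
  define w where "w = - ln y"
  have w: "0 \<le> w" using y by (simp add: w_def)
  \<comment> \<open>The first summand makes \<open>r * b * w \<le> \<delta> / 4 * p * n ^ 2\<close>;
    the second ensures \<open>p \<ge> thr l n \<ge> 1 / n\<close>, so that the remaining exponent
    tends to infinity.\<close>
  define K where "K = 4 * r * B * w / \<delta> + 1"
  have K: "0 < K" "1 \<le> K" using B w \<delta> by (auto simp: K_def add_nonneg_pos)
  show ?thesis
  proof (rule pert_upperI)
    fix \<epsilon> :: real assume \<epsilon>: "0 < \<epsilon>"
    define n1 where "n1 = max n0 (nat \<lceil>2 * (1 / \<epsilon>) / \<delta>\<rceil> + 1)"
    have "1 - \<epsilon> \<le> prob_ramsey_union l r n p G"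
      if n: "n1 \<le> n" and p: "0 \<le> p" "p \<le> 1" and Kp: "K * thr l n \<le> p" for n G and p :: real
    proof -
      have n0: "n0 \<le> n" "0 < n" using n by (auto simp: n1_def)
      have ne: "2 * (1 / \<epsilon>) / \<delta> \<le> n" using n unfolding n1_def by linarith
      define b where "b = B * (real n ^ 2 * thr l n)"
      have b: "0 \<le> b" using B thr_pos [OF n0(2), of l] by (simp add: b_def)
      have "pr (all_edges n) p (\<lambda>F. \<not> cycle_ramsey l r F) \<le>
        exp (- p * (\<delta> * real n ^ 2)) * (y powr (-b) * exp (p * y * real n ^ 2)) ^ r"
        unfolding b_def by (rule prob_not_ramsey_le [OF l(3) cont [OF n0(2)] p y b [unfolded b_def]]) (rule sat [OF n0(1)])
      also have "y powr (-b) = exp (b * w)" using y by (simp add: powr_def w_def)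
      also have "exp (- p * (\<delta> * real n ^ 2)) * (exp (b * w) * exp (p * y * real n ^ 2)) ^ r =
          exp (- p * (\<delta> * real n ^ 2) + r * (b * w + p * y * real n ^ 2))"
        by (simp only: exp_add [symmetric] exp_of_nat_mult [symmetric])
      also have "- p * (\<delta> * real n ^ 2) + r * (b * w + p * y * real n ^ 2) \<le> - (\<delta> * n / 2)"
      proof -
        have 1: "r * (p * y * real n ^ 2) = \<delta> / 4 * (p * real n ^ 2)" using r by (simp add: y_def)
        have "r * (b * w) = (r * B * w) * thr l n * real n ^ 2" by (simp add: b_def mult_ac)
        also have "\<dots> \<le> \<delta> / 4 * p * real n ^ 2"
        proof (rule mult_right_mono)
          have "r * B * w = \<delta> / 4 * (K - 1)" using \<delta> by (simp add: K_def)
          also have "\<dots> * thr l n \<le> \<delta> / 4 * K * thr l n"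
            using \<delta> thr_pos [OF n0(2), of l] by (intro mult_right_mono) auto
          also have "\<dots> \<le> \<delta> / 4 * p" using Kp \<delta> by (simp add: mult.assoc)
          finally show "r * B * w * thr l n \<le> \<delta> / 4 * p" .
        qed simp
        finally have 2: "r * (b * w) \<le> \<delta> / 4 * (p * real n ^ 2)" by (simp add: mult.assoc)
        have "1 / real n \<le> p"
        proof -
          have "1 / real n \<le> 1 * thr l n" using thr_ge [OF l(3) n0(2)] by simp
          also have "\<dots> \<le> K * thr l n" using K thr_pos [OF n0(2), of l] by (intro mult_right_mono) auto
          finally show ?thesis using Kp by linarith
        qed
        then have "1 / real n * real n ^ 2 \<le> p * real n ^ 2" by (intro mult_right_mono) auto
        then have "n \<le> p * real n ^ 2" using n0 by (simp add: power2_eq_square)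
        then have "\<delta> / 2 * n \<le> \<delta> / 2 * (p * real n ^ 2)" using \<delta> by (intro mult_left_mono) auto
        moreover have "- p * (\<delta> * real n ^ 2) + r * (b * w + p * y * real n ^ 2) =
           - (\<delta> * (p * real n ^ 2)) + r * (b * w) + r * (p * y * real n ^ 2)" by (simp add: distrib_left mult_ac)
        ultimately show ?thesis using 1 2 by linarith
      qed
      then have "exp (- p * (\<delta> * real n ^ 2) + r * (b * w + p * y * real n ^ 2)) \<le> exp (- (\<delta> * n / 2))" by simp
      also have "exp (- (\<delta> * n / 2)) \<le> \<epsilon>"
      proof -
        have "2 * (1 / \<epsilon>) \<le> n * \<delta>" using ne by (simp only: pos_divide_le_eq [OF \<delta>(1)])
        then have "1 / \<epsilon> \<le> \<delta> * n / 2" by (simp add: mult.commute)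
        also have "\<dots> \<le> exp (\<delta> * n / 2)" using exp_ge_add_one_self [of "\<delta> * n / 2"] by linarith
        finally show ?thesis using \<epsilon> by (simp add: exp_minus field_simps)
      qed
      finally have "pr (all_edges n) p (\<lambda>F. \<not> cycle_ramsey l r F) \<le> \<epsilon>" .
      then have "1 - \<epsilon> \<le> pr (all_edges n) p (cycle_ramsey l r)"
        using pr_compl [OF finite_all_edges, of n p "cycle_ramsey l r"] by simp
      also have "\<dots> \<le> pr (all_edges n) p (\<lambda>F. cycle_ramsey l r (G \<union> F))"
        by (rule pr_mono [OF p]) (erule cycle_ramsey_mono, blast)
      finally show ?thesis by (simp add: prob_ramsey_union_def prob_gnp_eq_pr)
    qed
    then have "\<exists>n0. \<forall>n\<ge>n0. \<forall>(p::real) G. 0 \<le> p \<longrightarrow> p \<le> 1 \<longrightarrow> K * thr l n \<le> p \<longrightarrow> is_graph n G \<longrightarrow>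
     d \<le> density n G \<longrightarrow> 1 - \<epsilon> \<le> prob_ramsey_union l r n p G"
      by blast
    then show "\<exists>K::real. 0 < K \<and> (\<exists>n0. \<forall>n\<ge>n0. \<forall>(p::real) G. 0 \<le> p \<longrightarrow> p \<le> 1 \<longrightarrow>
      K * thr l n \<le> p \<longrightarrow> is_graph n G \<longrightarrow> d \<le> density n G \<longrightarrow> 1 - \<epsilon> \<le> prob_ramsey_union l r n p G)"
      using K(1) by (rule_tac exI [of _ K], rule_tac conjI)
  qed (simp add: thr_def)
qed

section \<open>Lower bounds\<close>

definition turan :: "nat \<Rightarrow> nat \<Rightarrow> nat set set" where
  "turan m n = {{a, b} | a b. a < n \<and> b < n \<and> a mod m \<noteq> b mod m}"

lemma turan_graph: "is_graph n (turan m n)"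
  by (auto simp: is_graph_def turan_def all_edges_def)

lemma card_residue_class_le: "card {b\<in>{..<n}. b mod m = i} \<le> Suc ((n - 1) div m)"
proof -
  have "card {b\<in>{..<n}. b mod m = i} \<le> card {..(n - 1) div m}"
  proof (rule card_inj_on_le [of "\<lambda>b. b div m"])
    show "inj_on (\<lambda>b. b div m) {b\<in>{..<n}. b mod m = i}"
      by (rule inj_onI) (metis (mono_tags, lifting) div_mod_decomp mem_Collect_eq)
    show "(\<lambda>b. b div m) ` {b\<in>{..<n}. b mod m = i} \<subseteq> {..(n - 1) div m}"
      by (auto intro: div_le_mono)
  qed simp
  then show ?thesis by simp
qed

text \<open>Every vertex misses at most \<open>(n - 1) div m\<close> others, since its residue class
  has at most one vertex more than that. The bound therefore has no error term and holds for each
  \<open>n \<ge> 2\<close>, as the definition of the threshold demands.\<close>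

lemma turan_density:
  assumes m: "1 \<le> m" and n: "2 \<le> n"
  shows "1 - 1 / real m \<le> density n (turan m n)"
proof -
  define R where "R = all_edges n - turan m n"
  have sub: "turan m n \<subseteq> all_edges n" using turan_graph by (simp add: is_graph_def)
  have finT: "finite (turan m n)" using finite_subset [OF sub finite_all_edges] .
  have "is_graph n R" by (auto simp: R_def is_graph_def)
  then have "2 * card R = (\<Sum>x<n. card {y\<in>{..<n}. {x, y} \<in> R})" using sum_degrees by simp
  also have "\<dots> \<le> (\<Sum>x<n. (n - 1) div m)"
  proof (rule sum_mono)
    fix x assume x: "x \<in> {..<n}"
    have "{y\<in>{..<n}. {x, y} \<in> R} \<subseteq> {b\<in>{..<n}. b mod m = x mod m} - {x}"
    proof
      fix y assume y: "y \<in> {y\<in>{..<n}. {x, y} \<in> R}"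
      then have "{x, y} \<in> all_edges n" "{x, y} \<notin> turan m n" by (auto simp: R_def)
      then have "x \<noteq> y" "x mod m = y mod m" using x y by (auto simp: all_edges_eq turan_def)
      then show "y \<in> {b\<in>{..<n}. b mod m = x mod m} - {x}" using y by auto
    qed
    then have "card {y\<in>{..<n}. {x, y} \<in> R} \<le> card ({b\<in>{..<n}. b mod m = x mod m} - {x})"
      by (rule card_mono [rotated]) simp
    also have "\<dots> = card {b\<in>{..<n}. b mod m = x mod m} - 1" using x by (subst card_Diff_singleton) auto
    also have "\<dots> \<le> (n - 1) div m" using card_residue_class_le [of n m "x mod m"] by simp
    finally show "card {y\<in>{..<n}. {x, y} \<in> R} \<le> (n - 1) div m" .
  qed
  finally have "m * (2 * card R) \<le> m * (n * ((n - 1) div m))" by simp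
  also have "\<dots> = n * (m * ((n - 1) div m))" by simp
  also have "\<dots> \<le> n * (n - 1)" by (intro mult_le_mono) auto
  also have "n * (n - 1) = 2 * (n choose 2)" 
  proof -
    have "even (n * (n - 1))" by (cases n) auto
    then show ?thesis using choose_two [of n] by simp
  qed
  finally have "m * card R \<le> n choose 2" by simp
  then have "real m * card R \<le> n choose 2" by (metis of_nat_mono of_nat_mult)
  moreover have "card (turan m n) + card R = n choose 2"
    using card_Diff_subset [OF finT sub] card_mono [OF finite_all_edges sub] by (simp add: R_def card_all_edges)
  then have "real (card (turan m n)) + card R = n choose 2" by (metis of_nat_add)
  moreover have C: "0 < real (n choose 2)" using n by simp
  ultimately have "(1 - 1 / real m) * real (n choose 2) \<le> card (turan m n)"
  proof -
    have "real (card R) \<le> real (n choose 2) / real m"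
      using \<open>real m * card R \<le> n choose 2\<close> m by (simp add: pos_le_divide_eq mult.commute)
    then show ?thesis using \<open>real (card (turan m n)) + card R = n choose 2\<close> by (simp add: left_diff_distrib)
  qed
  then show ?thesis using C by (simp add: density_def pos_le_divide_eq)
qed

lemma odd_cycle_not_alternating:
  assumes "odd l" "\<And>j. j < l \<Longrightarrow> s j \<longleftrightarrow> \<not> s (Suc j mod l)"
  shows False
proof -
  have alt: "j < l \<Longrightarrow> s j \<longleftrightarrow> (s 0 \<longleftrightarrow> even j)" for j
  proof (induction j)
    case (Suc j)
    then show ?case using assms(2) [of j] by auto
  qed simp
  obtain k where k: "l = 2 * k + 1" using assms(1) by (rule oddE)
  have lt: "2 * k < l" and last: "Suc (2 * k) mod l = 0" using k by simp_all
  have "s (2 * k) \<longleftrightarrow> s 0" using alt [OF lt] by (simp only: even_mult_iff even_numeral simp_thms)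
  moreover have "s (2 * k) \<longleftrightarrow> \<not> s 0" using assms(2) [OF lt] by (simp only: last)
  ultimately show False by blast
qed

text \<open>The binary digits of the residue modulo \<open>2 ^ k\<close> give \<open>k\<close>
  bipartitions that together separate all classes. Edges between classes are coloured by a
  separating digit, and only the edges of \<open>F\<close> inside classes need the other
  \<open>r - k\<close> colours.\<close>

lemma turan_union_not_ramsey:
  assumes l: "odd l" and k: "k \<le> r" and nr: "\<not> cycle_ramsey l (r - k) F"
  shows "\<not> cycle_ramsey l r (turan (2 ^ k) n \<union> F)"
proof -
  obtain c' where c': "\<And>e. e \<in> F \<Longrightarrow> c' e < r - k" "\<And>j. j < r - k \<Longrightarrow> \<not> has_cycle l {e\<in>F. c' e = j}"
    using nr unfolding cycle_ramsey_def by blast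
  define sep where "sep = (\<lambda>e i. i < k \<and> (\<exists>a b::nat. e = {a, b} \<and> bit a i \<noteq> bit b i))"
  \<comment> \<open>Edges of \<open>F\<close> between classes also receive a separating digit; each
    colour below \<open>k\<close> is bipartite in any case.\<close>
  define c where "c = (\<lambda>e. if \<exists>i. sep e i then (SOME i. sep e i) else k + c' e)"
  have sepc: "sep e (c e)" if "\<exists>i. sep e i" for e using someI_ex [OF that] that by (simp add: c_def)
  have inF: "e \<in> F" if "e \<in> turan (2 ^ k) n \<union> F" "\<nexists>i. sep e i" for e
  proof (rule ccontr)
    assume "e \<notin> F"
    then have "e \<in> turan (2 ^ k) n" using that by blast
    then obtain a b where ab: "e = {a, b}" "a mod 2 ^ k \<noteq> b mod 2 ^ k"
      by (auto simp: turan_def)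
    then have "take_bit k a \<noteq> take_bit k b" by (simp add: take_bit_eq_mod)
    then obtain i where "bit (take_bit k a) i \<noteq> bit (take_bit k b) i" using bit_eqI by blast
    then have "sep e i" using ab by (auto simp: sep_def bit_take_bit_iff)
    then show False using that(2) by blast
  qed
  have cr: "c e < r" if "e \<in> turan (2 ^ k) n \<union> F" for e
  proof (cases "\<exists>i. sep e i")
    case True
    then show ?thesis using sepc [OF True] k by (auto simp: sep_def)
  next
    case False
    then have "c e = k + c' e" by (simp only: c_def if_False)
    then show ?thesis using c'(1) [OF inF [OF that False]] by simp
  qed
  have "\<not> has_cycle l {e \<in> turan (2 ^ k) n \<union> F. c e = j}" if "j < r" for j
  proof
    assume "has_cycle l {e \<in> turan (2 ^ k) n \<union> F. c e = j}"
    then obtain f where f: "inj_on f {..<l}"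
      and fe: "\<And>i. i < l \<Longrightarrow> {f i, f (Suc i mod l)} \<in> turan (2 ^ k) n \<union> F \<and> c {f i, f (Suc i mod l)} = j"
      unfolding has_cycle_def by blast
    show False
    proof (cases "j < k")
      case True
      have "bit (f i) j \<noteq> bit (f (Suc i mod l)) j" if "i < l" for i
      proof -
        have "c {f i, f (Suc i mod l)} = j" using fe [OF that] by blast
        then have "\<exists>i'. sep {f i, f (Suc i mod l)} i'" using True by (auto simp: c_def split: if_splits)
        then have "sep {f i, f (Suc i mod l)} j" using sepc fe [OF that] by metis
        then show ?thesis by (auto simp: sep_def doubleton_eq_iff)
      qed
      then show False using odd_cycle_not_alternating [OF l, of "\<lambda>i. bit (f i) j"] by blast
    next
      case False
      have "{f i, f (Suc i mod l)} \<in> {e\<in>F. c' e = j - k}" if "i < l" for i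
      proof -
        have ns: "\<nexists>i'. sep {f i, f (Suc i mod l)} i'"
        proof
          assume "\<exists>i'. sep {f i, f (Suc i mod l)} i'"
          from sepc [OF this] have "j < k" using fe [OF that] by (simp add: sep_def)
          then show False using False by simp
        qed
        have "c {f i, f (Suc i mod l)} = k + c' {f i, f (Suc i mod l)}"
          unfolding c_def by (rule if_not_P) (rule ns)
        then show ?thesis using inF [OF _ ns] fe [OF that] by auto
      qed
      then have "has_cycle l {e\<in>F. c' e = j - k}" using f unfolding has_cycle_def by blast
      then show False using c'(2) [of "j - k"] \<open>j < r\<close> False k by auto
    qed
  qed
  then show ?thesis using cr unfolding cycle_ramsey_def by blast
qed

text \<open>The dense graph is always the complete \<open>2 ^ k\<close>-partite one; it remains to
  show that the random graph alone is unlikely to be Ramsey for \<open>r - k\<close> colours, with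
  constants uniform in \<open>p\<close>.\<close>

lemma pert_lowerI:
  assumes l: "odd l" and k: "k \<le> r" and d: "d \<le> 1 - 1 / 2 ^ k" and g: "\<And>n. 0 \<le> g n"
    and small: "\<And>\<epsilon>::real. 0 < \<epsilon> \<Longrightarrow> \<exists>\<eta>::real. 0 < \<eta> \<and> (\<exists>n0. \<forall>n\<ge>n0. \<forall>p::real. 0 \<le> p \<longrightarrow> p \<le> 1 \<longrightarrow> p \<le> \<eta> * g n \<longrightarrow>
      pr (all_edges n) p (cycle_ramsey l (r - k)) \<le> \<epsilon>)"
  shows "pert_lower l r d g"
  unfolding pert_lower_def
proof (intro allI impI)
  fix p :: "nat \<Rightarrow> real" assume p: "\<forall>n. 0 \<le> p n \<and> p n \<le> 1" and pg: "p \<in> o(g)"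
  have "((\<lambda>n. prob_ramsey_union l r n (p n) (turan (2 ^ k) n)) \<longlongrightarrow> 0) at_top"
  proof (rule tendstoI)
    fix e :: real assume e: "0 < e"
    obtain \<eta> :: real and n0 where \<eta>: "0 < \<eta>" and *: "\<And>n p. \<lbrakk>n0 \<le> n; 0 \<le> p; p \<le> 1; p \<le> \<eta> * g n\<rbrakk> \<Longrightarrow>
      pr (all_edges n) p (cycle_ramsey l (r - k)) \<le> e / 2"
      using small [OF half_gt_zero [OF e]] by blast
    have "eventually (\<lambda>n. norm (p n) \<le> \<eta> * norm (g n)) at_top"
      by (rule landau_o.smallD [OF pg \<eta>])
    moreover have "eventually (\<lambda>n. n0 \<le> n) at_top" by (rule eventually_ge_at_top)
    ultimately show "eventually (\<lambda>n. dist (prob_ramsey_union l r n (p n) (turan (2 ^ k) n)) 0 < e) at_top"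
    proof eventually_elim
      case (elim n)
      have pn: "0 \<le> p n" "p n \<le> 1" using p by auto
      have "prob_ramsey_union l r n (p n) (turan (2 ^ k) n) \<le> pr (all_edges n) (p n) (cycle_ramsey l (r - k))"
        unfolding prob_ramsey_union_def prob_gnp_eq_pr
        by (rule pr_mono [OF pn]) (use turan_union_not_ramsey [OF l k] in blast)
      also have "\<dots> \<le> e / 2" using elim g [of n] pn by (intro *) auto
      finally have "prob_ramsey_union l r n (p n) (turan (2 ^ k) n) \<le> e / 2" .
      moreover have "0 \<le> prob_ramsey_union l r n (p n) (turan (2 ^ k) n)"
        unfolding prob_ramsey_union_def prob_gnp_eq_pr by (rule pr_nonneg [OF pn])
      ultimately show ?case using e by (simp add: dist_real_def)
    qed
  qed
  moreover have "d \<le> density n (turan (2 ^ k) n)" if "2 \<le> n" for n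
    using turan_density [of "2 ^ k" n] that d by simp
  ultimately show "\<exists>G. (\<forall>n. is_graph n (G n)) \<and> (\<forall>n\<ge>2. d \<le> density n (G n)) \<and>
      ((\<lambda>n. prob_ramsey_union l r n (p n) (G n)) \<longlongrightarrow> 0) at_top"
    using turan_graph by (intro exI [of _ "turan (2 ^ k)"]) blast
qed

lemma card_all_edges_le_square: "real (card (all_edges n)) \<le> real n ^ 2"
  using card_all_edges_le [of n] zero_le_power2 [of "real n"] by linarith

lemma pert_lower_empty:
  assumes l: "odd l" and d: "d \<le> 1 - 1 / 2 ^ r"
  shows "pert_lower l r d (\<lambda>n. real n powr (-2))"
proof (rule pert_lowerI [OF l order_refl d])
  fix \<epsilon> :: real assume \<epsilon>: "0 < \<epsilon>"
  have "pr (all_edges n) p (cycle_ramsey l (r - r)) \<le> \<epsilon>"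
    if n: "1 \<le> n" and p: "0 \<le> p" "p \<le> 1" "p \<le> \<epsilon> * real n powr (-2)" for n and p :: real
  proof -
    have "pr (all_edges n) p (cycle_ramsey l (r - r)) \<le> pr (all_edges n) p (\<lambda>F. \<exists>e\<in>all_edges n. {e} \<subseteq> F)"
    proof (rule pr_mono [OF p(1,2)])
      fix F assume "F \<subseteq> all_edges n" "cycle_ramsey l (r - r) F"
      \<comment> \<open>With zero colours a graph with an edge has no colouring at all and is
        vacuously Ramsey, whereas the empty graph is not.\<close>
      then show "\<exists>e\<in>all_edges n. {e} \<subseteq> F" unfolding cycle_ramsey_def by auto
    qed
    also have "\<dots> \<le> (\<Sum>e\<in>all_edges n. pr (all_edges n) p (\<lambda>F. {e} \<subseteq> F))"
      by (rule pr_Bex [OF p(1,2) finite_all_edges])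
    also have "\<dots> = (\<Sum>e\<in>all_edges n. p)"
    proof (rule sum.cong [OF refl])
      fix e assume "e \<in> all_edges n"
      then show "pr (all_edges n) p (\<lambda>F. {e} \<subseteq> F) = p" by (subst pr_subset) auto
    qed
    also have "\<dots> \<le> real n ^ 2 * p" using card_all_edges_le_square p by (simp add: mult_right_mono)
    also have "\<dots> \<le> real n ^ 2 * (\<epsilon> * real n powr (-2))" using p by (intro mult_left_mono) auto
    also have "\<dots> = \<epsilon>" using n by (simp add: powr_minus powr_numeral)
    finally show ?thesis .
  qed
  then show "\<exists>\<eta>::real. 0 < \<eta> \<and> (\<exists>n0. \<forall>n\<ge>n0. \<forall>p::real. 0 \<le> p \<longrightarrow> p \<le> 1 \<longrightarrow> p \<le> \<eta> * real n powr (-2) \<longrightarrow>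
      pr (all_edges n) p (cycle_ramsey l (r - r)) \<le> \<epsilon>)" using \<epsilon> by blast
qed simp

lemma card_cycles_le: "real (card (cycles l n)) \<le> real n ^ l"
proof -
  have "card (cycles l n) \<le> card (cycle_maps l n)" unfolding cycles_def by (rule card_image_le) simp
  also have "\<dots> \<le> card ({..<l} \<rightarrow>\<^sub>E {..<n})"
    by (rule card_mono) (auto simp: cycle_maps_def intro: finite_PiE)
  also have "\<dots> = n ^ l" by (subst card_PiE) auto
  finally show ?thesis by (metis of_nat_mono of_nat_power)
qed

text \<open>One colour is left, so the random graph only has to avoid \<open>C_l\<close>; the
  expected number of copies is at most \<open>(n * p) ^ l\<close>.\<close>

lemma pert_lower_acyclic:
  assumes l: "odd l" "3 \<le> l" and r: "1 \<le> r" and d: "d \<le> 1 - 1 / 2 ^ (r - 1)"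
  shows "pert_lower l r d (\<lambda>n. real n powr (-1))"
proof (rule pert_lowerI [OF l(1) _ d])
  fix \<epsilon> :: real assume \<epsilon>: "0 < \<epsilon>"
  define \<eta> where "\<eta> = min \<epsilon> 1"
  have \<eta>: "0 < \<eta>" "\<eta> \<le> 1" "\<eta> \<le> \<epsilon>" using \<epsilon> by (auto simp: \<eta>_def)
  have "pr (all_edges n) p (cycle_ramsey l (r - (r - 1))) \<le> \<epsilon>"
    if n: "1 \<le> n" and p: "0 \<le> p" "p \<le> 1" "p \<le> \<eta> * real n powr (-1)" for n and p :: real
  proof -
    have "pr (all_edges n) p (cycle_ramsey l (r - (r - 1))) \<le> pr (all_edges n) p (\<lambda>F. \<exists>C\<in>cycles l n. C \<subseteq> F)"
    proof (rule pr_mono [OF p(1,2)])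
      fix F assume F: "F \<subseteq> all_edges n" "cycle_ramsey l (r - (r - 1)) F"
      then have "has_cycle l {e\<in>F. (\<lambda>_. 0::nat) e = 0}" unfolding cycle_ramsey_def using r
        by (elim allE [of _ "\<lambda>_. 0"]) auto
      then obtain C where "C \<in> cycles l n" "C \<subseteq> {e\<in>F. (\<lambda>_. 0::nat) e = 0}"
        by (rule has_cycle_imp_cycles [of l _ n]) (use F in auto)
      then show "\<exists>C\<in>cycles l n. C \<subseteq> F" by blast
    qed
    also have "\<dots> \<le> (\<Sum>C\<in>cycles l n. pr (all_edges n) p (\<lambda>F. C \<subseteq> F))"
      by (rule pr_Bex [OF p(1,2)]) simp
    also have "\<dots> = (\<Sum>C\<in>cycles l n. p ^ l)"
    proof (rule sum.cong [OF refl])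
      fix C assume C: "C \<in> cycles l n"
      show "pr (all_edges n) p (\<lambda>F. C \<subseteq> F) = p ^ l"
        using cyclesD(1,2) [OF l(2) C] by (subst pr_subset) auto
    qed
    also have "\<dots> \<le> real n ^ l * p ^ l" using card_cycles_le p by (simp add: mult_right_mono)
    also have "\<dots> = (n * p) ^ l" by (simp add: power_mult_distrib)
    also have "\<dots> \<le> \<eta> ^ l"
    proof (rule power_mono)
      have "real n * p \<le> real n * (\<eta> * real n powr (-1))" using p by (intro mult_left_mono) auto
      also have "\<dots> = \<eta>" using n by (simp add: powr_minus)
      finally show "real n * p \<le> \<eta>" .
    qed (use p in simp)
    also have "\<dots> \<le> \<eta> ^ 1" using l \<eta> by (intro power_decreasing) auto
    finally show ?thesis using \<eta> by simp
  qed
  then show "\<exists>\<eta>::real. 0 < \<eta> \<and> (\<exists>n0. \<forall>n\<ge>n0. \<forall>p::real. 0 \<le> p \<longrightarrow> p \<le> 1 \<longrightarrow> p \<le> \<eta> * real n powr (-1) \<longrightarrow>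
      pr (all_edges n) p (cycle_ramsey l (r - (r - 1))) \<le> \<epsilon>)" using \<eta> by blast
qed auto

section \<open>Clusters of cycles below the threshold\<close>

lemma sum_UN_le:
  fixes w :: "'b \<Rightarrow> real"
  assumes "finite I" "\<And>i. i \<in> I \<Longrightarrow> finite (A i)" "\<And>x. 0 \<le> w x"
  shows "(\<Sum>x\<in>(\<Union>i\<in>I. A i). w x) \<le> (\<Sum>i\<in>I. \<Sum>x\<in>A i. w x)"
  using assms(1,2)
proof (induction I rule: finite_induct)
  case (insert i I)
  have "(\<Sum>x\<in>(\<Union>i\<in>insert i I. A i). w x) = (\<Sum>x\<in>A i \<union> (\<Union>i\<in>I. A i). w x)" by simp
  also have "\<dots> \<le> (\<Sum>x\<in>A i. w x) + (\<Sum>x\<in>(\<Union>i\<in>I. A i). w x)"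
  proof -
    have "(\<Sum>x\<in>A i \<union> (\<Union>i\<in>I. A i). w x) =
        (\<Sum>x\<in>A i. w x) + (\<Sum>x\<in>(\<Union>i\<in>I. A i). w x) - (\<Sum>x\<in>A i \<inter> (\<Union>i\<in>I. A i). w x)"
      by (rule sum_Un) (use insert in auto)
    then show ?thesis using sum_nonneg [of "A i \<inter> (\<Union>i\<in>I. A i)" w] assms(3) by simp
  qed
  also have "\<dots> \<le> (\<Sum>x\<in>A i. w x) + (\<Sum>i\<in>I. \<Sum>x\<in>A i. w x)" using insert by simp
  finally show ?case using insert by simp
qed simp

definition listing :: "'a set \<Rightarrow> 'a list" where
  "listing A = (SOME xs. set xs = A \<and> distinct xs)"

lemma listing:
  assumes "finite A"
  shows "set (listing A) = A" "distinct (listing A)" "length (listing A) = card A"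
proof -
  have "set (listing A) = A \<and> distinct (listing A)"
    unfolding listing_def by (rule someI_ex) (rule finite_distinct_list [OF assms])
  then show "set (listing A) = A" "distinct (listing A)" "length (listing A) = card A"
    using distinct_card by fastforce+
qed

text \<open>The exploration processes the edges of the list \<open>L\<close> in order, those before position \<open>i\<close> being done.
  At each step it either moves on or appends the new edges of a member of \<open>\<C>\<close> through \<open>L ! i\<close>.
  The result consists of all edge sets reached after exactly \<open>s\<close> extensions and at most \<open>m\<close> steps.\<close>

primrec explored :: "'a set set \<Rightarrow> nat \<Rightarrow> nat \<Rightarrow> 'a list \<Rightarrow> nat \<Rightarrow> 'a set set" where
  "explored \<C> 0 s L i = (if s = 0 then {set L} else {})"
| "explored \<C> (Suc m) s L i =
    (if s = 0 then {set L} else if length L \<le> i then {}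
     else explored \<C> m s L (Suc i) \<union>
       (\<Union>C\<in>{C\<in>\<C>. L ! i \<in> C \<and> \<not> C \<subseteq> set L}. explored \<C> m (s - 1) (L @ listing (C - set L)) i))"

lemma explored_subset:
  assumes "A \<in> explored \<C> m s L i" "set L \<subseteq> E" "\<And>C. C \<in> \<C> \<Longrightarrow> C \<subseteq> E \<and> finite C"
  shows "A \<subseteq> E"
  using assms(1,2)
proof (induction m arbitrary: s L i)
  case 0
  then show ?case by (auto split: if_splits)
next
  case (Suc m)
  show ?case
  proof (cases "s = 0")
    case True
    then show ?thesis using Suc.prems by simp
  next
    case False
    then consider "A \<in> explored \<C> m s L (Suc i)" |
      C where "C \<in> \<C>" "A \<in> explored \<C> m (s - 1) (L @ listing (C - set L)) i"
      using Suc.prems(1) by (auto split: if_splits)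
    then show ?thesis
    proof cases
      case 1
      then show ?thesis using Suc by blast
    next
      case 2
      then have "C \<subseteq> E" "finite (C - set L)" using assms(3) by auto
      then have "set (L @ listing (C - set L)) \<subseteq> E" using Suc.prems(2) by (auto simp: listing(1))
      then show ?thesis using Suc.IH 2 by blast
    qed
  qed
qed

lemma finite_explored: "finite \<C> \<Longrightarrow> finite (explored \<C> m s L i)"
  by (induction m arbitrary: s L i) auto

text \<open>A step either moves on or extends, and all extensions together cost a factor
  \<open>\<epsilon>\<close>. There are at most \<open>2 ^ m\<close> patterns of such decisions, each
  with \<open>s\<close> extensions. The length condition keeps every intermediate set within the
  size \<open>a\<close> for which \<open>step\<close> is available.\<close>

lemma explored_weight:
  fixes p \<epsilon> :: real
  assumes fin: "finite \<C>" and C: "\<And>C. C \<in> \<C> \<Longrightarrow> finite C \<and> card C \<le> l" and p: "0 \<le> p" and \<epsilon>: "0 \<le> \<epsilon>"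
    and step: "\<And>S e. \<lbrakk>finite S; card S \<le> a; e \<in> S; S \<subseteq> E\<rbrakk> \<Longrightarrow> (\<Sum>C\<in>{C\<in>\<C>. e \<in> C \<and> \<not> C \<subseteq> S}. p ^ card (C - S)) \<le> \<epsilon>"
    and CE: "\<And>C. C \<in> \<C> \<Longrightarrow> C \<subseteq> E"
    and L: "distinct L" "length L + s * l \<le> a" "set L \<subseteq> E"
  shows "(\<Sum>A\<in>explored \<C> m s L i. p ^ card A) \<le> 2 ^ m * \<epsilon> ^ s * p ^ length L"
  using L
proof (induction m arbitrary: s L i)
  case 0
  then show ?case using p \<epsilon> by (auto simp: distinct_card)
next
  case (Suc m)
  show ?case
  proof (cases "s = 0 \<or> length L \<le> i")
    case True
    have "1 \<le> (2::real) ^ Suc m" by (rule one_le_power) simp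
    then have "1 * p ^ length L \<le> 2 ^ Suc m * p ^ length L"
      using p by (intro mult_right_mono) auto
    then show ?thesis using True Suc.prems p \<epsilon> by (auto simp: distinct_card)
  next
    case False
    then obtain s' where s': "s = Suc s'" by (cases s) auto
    define I where "I = {C\<in>\<C>. L ! i \<in> C \<and> \<not> C \<subseteq> set L}"
    define N where "N = (\<lambda>C. L @ listing (C - set L))"
    have finI: "finite I" using fin by (simp add: I_def)
    have len: "length (N C) = length L + card (C - set L)" if "C \<in> I" for C
      using C [of C] that by (simp add: N_def I_def listing(3))
    have "(\<Sum>A\<in>explored \<C> (Suc m) s L i. p ^ card A) =
        (\<Sum>A\<in>explored \<C> m s L (Suc i) \<union> (\<Union>C\<in>I. explored \<C> m s' (N C) i). p ^ card A)"
      using False s' by (simp add: I_def N_def)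
    also have "\<dots> \<le> (\<Sum>A\<in>explored \<C> m s L (Suc i). p ^ card A) + (\<Sum>A\<in>(\<Union>C\<in>I. explored \<C> m s' (N C) i). p ^ card A)"
    proof -
      have "(\<Sum>A\<in>explored \<C> m s L (Suc i) \<union> (\<Union>C\<in>I. explored \<C> m s' (N C) i). p ^ card A) =
        (\<Sum>A\<in>explored \<C> m s L (Suc i). p ^ card A) + (\<Sum>A\<in>(\<Union>C\<in>I. explored \<C> m s' (N C) i). p ^ card A)
        - (\<Sum>A\<in>explored \<C> m s L (Suc i) \<inter> (\<Union>C\<in>I. explored \<C> m s' (N C) i). p ^ card A)"
        by (rule sum_Un) (use finI finite_explored [OF fin] in auto)
      then show ?thesis using p by (simp add: sum_nonneg)
    qed
    also have "(\<Sum>A\<in>explored \<C> m s L (Suc i). p ^ card A) \<le> 2 ^ m * \<epsilon> ^ s * p ^ length L"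
      using Suc.IH Suc.prems by blast
    also have "(\<Sum>A\<in>(\<Union>C\<in>I. explored \<C> m s' (N C) i). p ^ card A) \<le>
        (\<Sum>C\<in>I. \<Sum>A\<in>explored \<C> m s' (N C) i. p ^ card A)"
      by (rule sum_UN_le) (use finI finite_explored [OF fin] p in auto)
    also have "\<dots> \<le> (\<Sum>C\<in>I. 2 ^ m * \<epsilon> ^ s' * p ^ length (N C))"
    proof (rule sum_mono)
      fix C assume CI: "C \<in> I"
      then have C\<C>: "C \<in> \<C>" by (simp add: I_def)
      then have finC: "finite (C - set L)" using C by auto
      have "card (C - set L) \<le> card C" using C [OF C\<C>] by (intro card_mono) auto
      then have "length (N C) + s' * l \<le> a"
        using len [OF CI] C [OF C\<C>] Suc.prems(2) s' by simp
      moreover have "distinct (N C)" using Suc.prems(1) listing(1,2) [OF finC] by (auto simp: N_def)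
      moreover have "set (N C) \<subseteq> E" using Suc.prems(3) listing(1) [OF finC] CE [OF C\<C>] by (auto simp: N_def)
      ultimately show "(\<Sum>A\<in>explored \<C> m s' (N C) i. p ^ card A) \<le> 2 ^ m * \<epsilon> ^ s' * p ^ length (N C)"
        by (intro Suc.IH)
    qed
    also have "\<dots> = (\<Sum>C\<in>I. (2 ^ m * \<epsilon> ^ s' * p ^ length L) * p ^ card (C - set L))"
      by (rule sum.cong [OF refl]) (simp add: len power_add)
    also have "\<dots> = (2 ^ m * \<epsilon> ^ s' * p ^ length L) * (\<Sum>C\<in>I. p ^ card (C - set L))"
      by (simp only: sum_distrib_left)
    also have "\<dots> \<le> (2 ^ m * \<epsilon> ^ s' * p ^ length L) * \<epsilon>"
    proof (rule mult_left_mono)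
      have "L ! i \<in> set L" using False by simp
      moreover have "card (set L) \<le> a" using Suc.prems by (simp add: distinct_card)
      ultimately show "(\<Sum>C\<in>I. p ^ card (C - set L)) \<le> \<epsilon>"
        unfolding I_def using Suc.prems(3) by (intro step) auto
    qed (use p \<epsilon> in auto)
    finally show ?thesis by (simp add: s' mult_ac)
  qed
qed

text \<open>The smallest closed set containing an edge is its cluster: the edges reached from it
  through chains of intersecting members of \<open>\<C>\<close> inside \<open>F\<close>.\<close>

definition closed_in :: "'a set set \<Rightarrow> 'a set \<Rightarrow> 'a set \<Rightarrow> bool" where
  "closed_in \<C> F A \<longleftrightarrow> A \<subseteq> F \<and> (\<forall>C\<in>\<C>. C \<subseteq> F \<longrightarrow> C \<inter> A \<noteq> {} \<longrightarrow> C \<subseteq> A)"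

text \<open>Run the exploration inside \<open>F\<close>, extending whenever possible. The last
  hypothesis is its invariant, so a list processed to its end is closed. The budget
  \<open>s * (l + 1)\<close> counts each extension and the at most \<open>l\<close> positions that
  it appends.\<close>

lemma explored_or_closed:
  assumes C: "\<And>C. C \<in> \<C> \<Longrightarrow> finite C \<and> card C \<le> l"
    and "set L \<subseteq> F" "i \<le> length L" "(length L - i) + s * (l + 1) \<le> m"
    "\<And>j C. \<lbrakk>j < i; C \<in> \<C>; C \<subseteq> F; L ! j \<in> C\<rbrakk> \<Longrightarrow> C \<subseteq> set L"
  shows "(\<exists>A\<in>explored \<C> m s L i. A \<subseteq> F) \<or> (\<exists>A. set L \<subseteq> A \<and> closed_in \<C> F A \<and> card A \<le> length L + s * l)"
  using assms(2-)
proof (induction m arbitrary: s L i)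
  case 0
  then have "s = 0" by simp
  then show ?case using 0 by auto
next
  case (Suc m)
  consider "s = 0" | "s \<noteq> 0" "i = length L" |
    C where "s \<noteq> 0" "i < length L" "C \<in> \<C>" "C \<subseteq> F" "L ! i \<in> C" "\<not> C \<subseteq> set L" |
    "s \<noteq> 0" "i < length L" "\<And>C. \<lbrakk>C \<in> \<C>; C \<subseteq> F; L ! i \<in> C\<rbrakk> \<Longrightarrow> C \<subseteq> set L"
    using Suc.prems(2) by (metis le_neq_implies_less)
  then show ?case
  proof cases
    case 1
    then show ?thesis using Suc.prems(1) by auto
  next
    case 2
    have "closed_in \<C> F (set L)"
      unfolding closed_in_def
    proof (intro conjI ballI impI)
      fix C assume C: "C \<in> \<C>" "C \<subseteq> F" "C \<inter> set L \<noteq> {}"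
      then obtain j where "j < length L" "L ! j \<in> C" by (auto simp: in_set_conv_nth)
      then show "C \<subseteq> set L" using Suc.prems(4) [of j C] 2 C by blast
    qed (rule Suc.prems(1))
    moreover have "card (set L) \<le> length L + s * l" using card_length [of L] by simp
    ultimately show ?thesis by blast
  next
    case (3 C)
    define L' where "L' = L @ listing (C - set L)"
    obtain s' where s': "s = Suc s'" using 3 by (cases s) auto
    have finC: "finite (C - set L)" using assms(1) 3 by blast
    have cC: "card (C - set L) \<le> l"
      using assms(1) [OF 3(3)] card_mono [of C "C - set L"] by auto
    have len: "length L' = length L + card (C - set L)" using listing(3) [OF finC] by (simp add: L'_def)
    have setL': "set L' = set L \<union> C" using listing(1) [OF finC] by (auto simp: L'_def)
    have "(\<exists>A\<in>explored \<C> m s' L' i. A \<subseteq> F) \<or> (\<exists>A. set L' \<subseteq> A \<and> closed_in \<C> F A \<and> card A \<le> length L' + s' * l)"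
    proof (rule Suc.IH)
      show "set L' \<subseteq> F" using setL' Suc.prems(1) 3 by blast
      show "i \<le> length L'" using len 3 by simp
      show "length L' - i + s' * (l + 1) \<le> m" using Suc.prems(3) len cC s' 3(2) by simp
      show "D \<subseteq> set L'" if "j < i" "D \<in> \<C>" "D \<subseteq> F" "L' ! j \<in> D" for j D
      proof -
        have "L' ! j = L ! j" using that(1) 3(2) by (simp add: L'_def nth_append)
        then show ?thesis using Suc.prems(4) [of j D] that setL' by auto
      qed
    qed
    then show ?thesis
    proof
      assume "\<exists>A\<in>explored \<C> m s' L' i. A \<subseteq> F"
      moreover have "explored \<C> m s' L' i \<subseteq> explored \<C> (Suc m) s L i"
        using 3 s' by (auto simp: L'_def)
      ultimately show ?thesis by blast
    next
      assume "\<exists>A. set L' \<subseteq> A \<and> closed_in \<C> F A \<and> card A \<le> length L' + s' * l"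
      then obtain A where "set L' \<subseteq> A" "closed_in \<C> F A" "card A \<le> length L' + s' * l" by blast
      moreover have "length L' + s' * l \<le> length L + s * l" using len cC s' by simp
      ultimately show ?thesis using setL' by (metis le_sup_iff order_trans)
    qed
  next
    case 4
    have "(\<exists>A\<in>explored \<C> m s L (Suc i). A \<subseteq> F) \<or> (\<exists>A. set L \<subseteq> A \<and> closed_in \<C> F A \<and> card A \<le> length L + s * l)"
    proof (rule Suc.IH)
      show "Suc i \<le> length L" using 4 by simp
      show "length L - Suc i + s * (l + 1) \<le> m" using Suc.prems(3) 4(2) by simp
      show "C \<subseteq> set L" if "j < Suc i" "C \<in> \<C>" "C \<subseteq> F" "L ! j \<in> C" for j C
        using Suc.prems(4) [of j C] 4(3) [of C] that by (cases "j = i") auto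
    qed (rule Suc.prems(1))
    moreover have "explored \<C> m s L (Suc i) \<subseteq> explored \<C> (Suc m) s L i" using 4 by auto
    ultimately show ?thesis by blast
  qed
qed

text \<open>By the edge bound every set of vertices has one of degree at most 3 inside it; colour
  the rest by induction and give this vertex a free colour.\<close>

lemma four_colouring:
  assumes "finite X" and A: "\<And>e. e \<in> A \<Longrightarrow> card e = 2"
    and sparse: "\<And>Y. Y \<subseteq> X \<Longrightarrow> Y \<noteq> {} \<Longrightarrow> card {e\<in>A. e \<subseteq> Y} < 2 * card Y"
  shows "\<exists>\<kappa>::nat \<Rightarrow> nat. \<forall>a\<in>X. \<kappa> a < 4 \<and> (\<forall>b\<in>X. a \<noteq> b \<longrightarrow> {a, b} \<in> A \<longrightarrow> \<kappa> a \<noteq> \<kappa> b)"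
  using assms(1,3)
proof (induction "card X" arbitrary: X)
  case 0
  then show ?case by simp
next
  case (Suc n)
  define B where "B = {e\<in>A. e \<subseteq> X}"
  have finB: "finite B" by (rule finite_subset [of _ "Pow X"]) (use Suc.prems(1) in \<open>auto simp: B_def\<close>)
  have ne: "X \<noteq> {}" using Suc.hyps(2) by auto
  obtain v where v: "v \<in> X" "card {e\<in>B. v \<in> e} < 4"
  proof (rule ccontr)
    assume *: "\<not> thesis"
    have "4 * card X = (\<Sum>v\<in>X. 4)" by simp
    also have "\<dots> \<le> (\<Sum>v\<in>X. card {e\<in>B. v \<in> e})"
      using * that by (intro sum_mono) (meson not_le)
    also have "\<dots> = (\<Sum>v\<in>X. \<Sum>e\<in>B. if v \<in> e then 1 else 0)"
      using finB by (simp add: sum.If_cases Int_def)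
    also have "\<dots> = (\<Sum>e\<in>B. \<Sum>v\<in>X. if v \<in> e then 1 else 0)" by (rule sum.swap)
    also have "\<dots> = (\<Sum>e\<in>B. 2)"
    proof (rule sum.cong [OF refl])
      fix e assume "e \<in> B"
      then have "X \<inter> e = e" "card e = 2" using A by (auto simp: B_def)
      then show "(\<Sum>v\<in>X. if v \<in> e then 1 else 0) = (2::nat)" using Suc.prems(1) by (simp add: sum.If_cases)
    qed
    also have "\<dots> < 4 * card X" using Suc.prems(2) [OF order_refl ne] by (simp add: B_def)
    finally show False by simp
  qed
  have "\<exists>\<kappa>::nat \<Rightarrow> nat. \<forall>a\<in>X - {v}. \<kappa> a < 4 \<and> (\<forall>b\<in>X - {v}. a \<noteq> b \<longrightarrow> {a, b} \<in> A \<longrightarrow> \<kappa> a \<noteq> \<kappa> b)"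
  proof (rule Suc.hyps(1))
    show "n = card (X - {v})" using Suc.hyps(2) v(1) Suc.prems(1) by simp
    show "card {e \<in> A. e \<subseteq> Y} < 2 * card Y" if "Y \<subseteq> X - {v}" "Y \<noteq> {}" for Y
      using Suc.prems(2) that by blast
  qed (use Suc.prems in simp)
  then obtain \<kappa> :: "nat \<Rightarrow> nat" where \<kappa>: "\<And>a. a \<in> X - {v} \<Longrightarrow> \<kappa> a < 4"
    "\<And>a b. \<lbrakk>a \<in> X - {v}; b \<in> X - {v}; a \<noteq> b; {a, b} \<in> A\<rbrakk> \<Longrightarrow> \<kappa> a \<noteq> \<kappa> b" by blast
  define Nb where "Nb = {b\<in>X. b \<noteq> v \<and> {v, b} \<in> A}"
  have "card (\<kappa> ` Nb) \<le> card Nb" by (rule card_image_le) (use Suc.prems in \<open>simp add: Nb_def\<close>)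
  also have "card Nb \<le> card {e\<in>B. v \<in> e}"
  proof (rule card_inj_on_le [of "\<lambda>b. {v, b}"])
    show "inj_on (\<lambda>b. {v, b}) Nb" by (auto simp: inj_on_def doubleton_eq_iff)
    show "(\<lambda>b. {v, b}) ` Nb \<subseteq> {e \<in> B. v \<in> e}" using v(1) by (auto simp: Nb_def B_def)
  qed (use finB in simp)
  finally have "card (\<kappa> ` Nb) < card {..<4::nat}" using v(2) by simp
  then have "\<not> {..<4} \<subseteq> \<kappa> ` Nb"
    using card_mono [of "\<kappa> ` Nb" "{..<4}"] Suc.prems(1) by (force simp: Nb_def)
  then obtain q where q: "q < 4" "q \<notin> \<kappa> ` Nb" by blast
  show ?case
  proof (rule exI [of _ "\<kappa>(v := q)"], intro ballI conjI impI)
    fix a assume a: "a \<in> X"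
    then show "(\<kappa>(v := q)) a < 4" using q \<kappa>(1) by auto
    fix b assume b: "b \<in> X" "a \<noteq> b" "{a, b} \<in> A"
    consider "a = v" | "b = v" | "a \<noteq> v" "b \<noteq> v" by blast
    then show "(\<kappa>(v := q)) a \<noteq> (\<kappa>(v := q)) b"
    proof cases
      case 1
      then have "b \<in> Nb" using b by (auto simp: Nb_def)
      then show ?thesis using 1 b q by auto
    next
      case 2
      then have "a \<in> Nb" using a b by (auto simp: Nb_def insert_commute)
      then show ?thesis using 2 b q by auto
    next
      case 3
      then show ?thesis using \<kappa>(2) a b by auto
    qed
  qed
qed

text \<open>All edges of a copy of \<open>C_l\<close> have the same cluster, so it suffices to
  two-colour clusters independently. A proper 4-colouring of the vertices of a cluster splits its
  edges into two bipartite graphs.\<close>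

lemma closed_sparse_not_ramsey:
  assumes l: "odd l" "3 \<le> l" and F: "F \<subseteq> all_edges n"
    and closed: "\<And>e. e \<in> F \<Longrightarrow> \<exists>A. e \<in> A \<and> closed_in (cycles l n) F A \<and> card A \<le> a"
    and sparse: "\<And>Y D. \<lbrakk>Y \<subseteq> {..<n}; Y \<noteq> {}; card Y \<le> a; D \<subseteq> F; \<forall>e\<in>D. e \<subseteq> Y\<rbrakk> \<Longrightarrow> card D \<noteq> 2 * card Y"
  shows "\<not> cycle_ramsey l 2 F"
proof -
  define cl where "cl = (\<lambda>e. \<Inter>{A. e \<in> A \<and> closed_in (cycles l n) F A})"
  have finF: "finite F" using F finite_subset by fastforce
  have mem: "e \<in> cl e" for e by (simp add: cl_def)
  have least: "cl e \<subseteq> A" if "e \<in> A" "closed_in (cycles l n) F A" for e A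
    using that by (auto simp: cl_def)
  have clF: "cl e \<subseteq> F" "card (cl e) \<le> a" if e: "e \<in> F" for e
  proof -
    obtain A where A: "e \<in> A" "closed_in (cycles l n) F A" "card A \<le> a" using closed [OF e] by blast
    have "cl e \<subseteq> A" using least A by blast
    moreover have "A \<subseteq> F" using A by (simp add: closed_in_def)
    ultimately show "cl e \<subseteq> F" "card (cl e) \<le> a"
      using A(3) finF card_mono [of A "cl e"] finite_subset [of A F] by auto
  qed
  have closed_cl: "closed_in (cycles l n) F (cl e)" if e: "e \<in> F" for e
    unfolding closed_in_def
  proof (intro conjI ballI impI)
    fix C assume C: "C \<in> cycles l n" "C \<subseteq> F" "C \<inter> cl e \<noteq> {}"
    show "C \<subseteq> cl e" unfolding cl_def
    proof (rule Inter_greatest)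
      fix A assume "A \<in> {A. e \<in> A \<and> closed_in (cycles l n) F A}"
      then have A: "e \<in> A" "closed_in (cycles l n) F A" by auto
      then have "C \<inter> A \<noteq> {}" using C(3) least by blast
      then show "C \<subseteq> A" using A(2) C by (simp add: closed_in_def)
    qed
  qed (rule clF(1) [OF e])
  define good where "good = (\<lambda>A (\<kappa>::nat \<Rightarrow> nat). \<forall>x<n. \<kappa> x < 4 \<and> (\<forall>y<n. x \<noteq> y \<longrightarrow> {x, y} \<in> A \<longrightarrow> \<kappa> x \<noteq> \<kappa> y))"
  have ex_good: "\<exists>\<kappa>. good (cl e) \<kappa>" if e: "e \<in> F" for e
  proof -
    have "\<exists>\<kappa>::nat \<Rightarrow> nat. \<forall>x\<in>{..<n}. \<kappa> x < 4 \<and> (\<forall>y\<in>{..<n}. x \<noteq> y \<longrightarrow> {x, y} \<in> cl e \<longrightarrow> \<kappa> x \<noteq> \<kappa> y)"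
    proof (rule four_colouring)
      show "card e' = 2" if "e' \<in> cl e" for e' using that clF(1) [OF e] F by (auto simp: all_edges_eq)
      fix Y assume Y: "Y \<subseteq> {..<n}" "Y \<noteq> {}"
      show "card {e'\<in>cl e. e' \<subseteq> Y} < 2 * card Y"
      proof (rule ccontr)
        assume "\<not> card {e'\<in>cl e. e' \<subseteq> Y} < 2 * card Y"
        then have ge: "2 * card Y \<le> card {e'\<in>cl e. e' \<subseteq> Y}" by simp
        \<comment> \<open>Trimmed to exactly \<open>2 * card Y\<close> edges, the form in which
          dense spots are later counted. The bound \<open>card Y \<le> a\<close> follows because the
          cluster has at most \<open>a\<close> edges.\<close>
        obtain D where D: "D \<subseteq> {e'\<in>cl e. e' \<subseteq> Y}" "card D = 2 * card Y"
          by (rule obtain_subset_with_card_n [OF ge])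
        have "card {e'\<in>cl e. e' \<subseteq> Y} \<le> card (cl e)"
          using finite_subset [OF clF(1) [OF e] finF] by (intro card_mono) auto
        then have "card Y \<le> a" using ge clF(2) [OF e] by linarith
        then show False using sparse [OF Y, of D] D clF(1) [OF e] by blast
      qed
    qed simp
    then show ?thesis by (auto simp: good_def)
  qed
  \<comment> \<open>The choice depends on the cluster and not on the edge, so it is the same along a
    whole cycle.\<close>
  define \<kappa> where "\<kappa> = (\<lambda>A. SOME \<kappa>. good A \<kappa>)"
  have \<kappa>: "good (cl e) (\<kappa> (cl e))" if "e \<in> F" for e
    unfolding \<kappa>_def by (rule someI_ex [OF ex_good [OF that]])
  \<comment> \<open>Colour 0 marks edges whose end colours differ in parity. The end colours of the
    others are 0 and 2 or 1 and 3, which are separated by comparison with 2.\<close>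
  define c where "c = (\<lambda>e. if \<exists>x y. e = {x, y} \<and> (even (\<kappa> (cl e) x) \<noteq> even (\<kappa> (cl e) y)) then 0 else 1 :: nat)"
  have "\<not> has_cycle l {e\<in>F. c e = j}" for j
  proof
    assume hc: "has_cycle l {e\<in>F. c e = j}"
    have sub: "{e\<in>F. c e = j} \<subseteq> all_edges n" using F by auto
    obtain C where C: "C \<in> cycles l n" "C \<subseteq> {e\<in>F. c e = j}" by (rule has_cycle_imp_cycles [OF hc sub])
    then obtain f where f: "f \<in> cycle_maps l n" "C = cyc l f" by (auto simp: cycles_def)
    define e0 where "e0 = {f 0, f (Suc 0 mod l)}"
    have l0: "0 < l" using l by simp
    have eC: "{f i, f (Suc i mod l)} \<in> C" if "i < l" for i using that by (auto simp: f(2) cyc_def)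
    have CF: "C \<subseteq> F" using C by blast
    have e0: "e0 \<in> C" using eC [OF l0] by (simp add: e0_def)
    have same: "cl e = cl e0" if "e \<in> C" for e
    proof -
      have "C \<subseteq> cl e" if "e \<in> C" for e
        using closed_cl [of e] CF C(1) that mem [of e] unfolding closed_in_def by blast
      then have "e0 \<in> cl e" "e \<in> cl e0" using that e0 by blast+
      then show ?thesis using least closed_cl CF e0 that by (meson subset_antisym subsetD)
    qed
    have Csub: "C \<subseteq> cl e0" using same mem by blast
    define \<mu> where "\<mu> = \<kappa> (cl e0)"
    have g: "good (cl e0) \<mu>" unfolding \<mu>_def by (rule \<kappa>) (use e0 CF in blast)
    have fn: "f i < n" if "i < l" for i using f(1) that by (auto simp: cycle_maps_def)
    have fd: "f i \<noteq> f (Suc i mod l)" if "i < l" for i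
      using f(1) that l Suc_mod_neq [of l i] by (auto simp: cycle_maps_def inj_on_def)
    have neq: "\<mu> (f i) \<noteq> \<mu> (f (Suc i mod l))" "\<mu> (f i) < 4" if "i < l" for i
      using g fn [OF that] fn [of "Suc i mod l"] l0 fd [OF that] eC [OF that] Csub unfolding good_def by auto
    have ci: "c {f i, f (Suc i mod l)} = j" if "i < l" for i using eC [OF that] C(2) by blast
    have cval: "c {f i, f (Suc i mod l)} = (if even (\<mu> (f i)) \<noteq> even (\<mu> (f (Suc i mod l))) then 0 else 1)"
      if "i < l" for i
      using same [OF eC [OF that]] by (auto simp: c_def \<mu>_def doubleton_eq_iff)
    show False
    proof (cases "j = 0")
      case True
      then have "even (\<mu> (f i)) \<longleftrightarrow> \<not> even (\<mu> (f (Suc i mod l)))" if "i < l" for i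
        using ci [OF that] cval [OF that] by (auto split: if_splits)
      then show False using odd_cycle_not_alternating [OF l(1), of "\<lambda>i. even (\<mu> (f i))"] by blast
    next
      case False
      have "\<mu> (f i) < 2 \<longleftrightarrow> \<not> \<mu> (f (Suc i mod l)) < 2" if "i < l" for i
      proof -
        have par: "even (\<mu> (f i)) = even (\<mu> (f (Suc i mod l)))"
          using ci [OF that] cval [OF that] False by (auto split: if_splits)
        have "\<mu> (f (Suc i mod l)) < 4" using neq(2) l0 by simp
        then have "\<mu> (f i) \<in> {0, 1, 2, 3}" "\<mu> (f (Suc i mod l)) \<in> {0, 1, 2, 3}"
          using neq(2) [OF that] by auto
        then show ?thesis using neq(1) [OF that] par by auto
      qed
      then show False using odd_cycle_not_alternating [OF l(1), of "\<lambda>i. \<mu> (f i) < 2"] by blast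
    qed
  qed
  moreover have "c e < 2" for e by (simp add: c_def)
  ultimately show ?thesis unfolding cycle_ramsey_def by blast
qed

text \<open>The first summand comes from cycles meeting \<open>S\<close> in \<open>e\<close> only.  For every larger intersection the
  expected number of cycles is smaller by a power of \<open>n\<close>.\<close>

lemma attach_weight:
  fixes p \<eta> :: real
  assumes l: "3 \<le> l" and n: "0 < n" and \<eta>: "0 < \<eta>" "\<eta> \<le> 1" and p: "0 \<le> p" "p \<le> \<eta> * thr l n"
    and S: "finite S" "card S \<le> a" "e \<in> S" "S \<subseteq> all_edges n"
  shows "(\<Sum>C\<in>{C\<in>cycles l n. e \<in> C \<and> \<not> C \<subseteq> S}. p ^ card (C - S)) \<le>
    cyc_const l * \<eta> + real l * real a ^ l * (cyc_const l * real n powr (- 1 / (real l - 1)))"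
proof -
  \<comment> \<open>The possible intersections of a new cycle with \<open>S\<close>; each contains
    \<open>e\<close> and is a proper part of the cycle.\<close>
  define Js where "Js = {J. J \<subseteq> S \<and> e \<in> J \<and> card J < l}"
  define u where "u = real n powr (- 1 / (real l - 1))"
  define q where "q = thr l n"
  have q: "0 < q" using thr_pos [OF n] by (simp add: q_def)
  have "\<eta> * q \<le> 1 * q" using \<eta> q by (intro mult_right_mono) auto
  then have pq: "p \<le> q" using p(2) by (simp add: q_def)
  have finJs: "finite Js" by (rule finite_subset [of _ "Pow S"]) (use S in \<open>auto simp: Js_def\<close>)
  have a1: "1 \<le> a" using S by (metis card_gt_0_iff empty_iff le_trans less_one not_le)
  have "{C\<in>cycles l n. e \<in> C \<and> \<not> C \<subseteq> S} \<subseteq> (\<Union>J\<in>Js. {C\<in>cycles l n. C \<inter> S = J})"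
  proof
    fix C assume C: "C \<in> {C\<in>cycles l n. e \<in> C \<and> \<not> C \<subseteq> S}"
    then have cC: "card C = l" "finite C" using cyclesD(1,2) [OF l, of C n] finite_subset [OF _ finite_all_edges] by auto
    have "C \<inter> S \<subset> C" using C by blast
    then have "card (C \<inter> S) < l" using psubset_card_mono [OF cC(2)] cC(1) by metis
    then have "C \<inter> S \<in> Js" using C S(3) by (auto simp: Js_def)
    then show "C \<in> (\<Union>J\<in>Js. {C\<in>cycles l n. C \<inter> S = J})" using C by blast
  qed
  then have "(\<Sum>C\<in>{C\<in>cycles l n. e \<in> C \<and> \<not> C \<subseteq> S}. p ^ card (C - S)) \<le>
      (\<Sum>C\<in>(\<Union>J\<in>Js. {C\<in>cycles l n. C \<inter> S = J}). p ^ card (C - S))"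
    by (rule sum_mono2 [rotated]) (use finJs p in auto)
  also have "\<dots> \<le> (\<Sum>J\<in>Js. \<Sum>C\<in>{C\<in>cycles l n. C \<inter> S = J}. p ^ card (C - S))"
    by (rule sum_UN_le) (use finJs p in auto)
  also have "\<dots> \<le> (\<Sum>J\<in>Js. (if J = {e} then cyc_const l * \<eta> else 0) + cyc_const l * u)"
  proof (rule sum_mono)
    fix J assume J: "J \<in> Js"
    define j where "j = card J"
    have finJ: "finite J" using J S(1) finite_subset by (auto simp: Js_def)
    have jl: "j < l" and j1: "1 \<le> j"
      using J finJ by (auto simp: Js_def j_def Suc_le_eq card_gt_0_iff)
    have "(\<Sum>C\<in>{C\<in>cycles l n. C \<inter> S = J}. p ^ card (C - S)) = (\<Sum>C\<in>{C\<in>cycles l n. C \<inter> S = J}. p ^ (l - j))"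
    proof (rule sum.cong [OF refl])
      fix C assume C: "C \<in> {C\<in>cycles l n. C \<inter> S = J}"
      then have "card C = l" "finite C" using cyclesD(1,2) [OF l, of C n] finite_subset [OF _ finite_all_edges] by auto
      then have "card (C - S) = l - j" using C card_Diff_subset_Int [of C S] by (auto simp: j_def)
      then show "p ^ card (C - S) = p ^ (l - j)" by simp
    qed
    also have "\<dots> = real (card {C\<in>cycles l n. C \<inter> S = J}) * p ^ (l - j)" by simp
    also have "\<dots> \<le> (cyc_const l * real n ^ (l - Suc j)) * p ^ (l - j)"
    proof (rule mult_right_mono)
      have "card {C\<in>cycles l n. C \<inter> S = J} \<le> hdeg (cycles l n) J"
        unfolding hdeg_def by (rule card_mono) auto
      also have "\<dots> \<le> cyc_const l * n ^ (l - Suc j)"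
        unfolding j_def by (rule hdeg_cycles_le [OF l]) (use J S in \<open>auto simp: Js_def\<close>)
      finally show "real (card {C\<in>cycles l n. C \<inter> S = J}) \<le> cyc_const l * real n ^ (l - Suc j)"
        by (metis of_nat_mono of_nat_mult of_nat_power)
    qed (use p in simp)
    finally have le: "(\<Sum>C\<in>{C\<in>cycles l n. C \<inter> S = J}. p ^ card (C - S)) \<le> cyc_const l * (real n ^ (l - Suc j) * p ^ (l - j))"
      by (simp add: mult.assoc)
    show "(\<Sum>C\<in>{C\<in>cycles l n. C \<inter> S = J}. p ^ card (C - S)) \<le>
        (if J = {e} then cyc_const l * \<eta> else 0) + cyc_const l * u"
    proof (cases "J = {e}")
      case True
      then have j: "j = 1" by (simp add: j_def)
      have "p ^ (l - 1) \<le> (\<eta> * q) ^ (l - 1)" using p by (intro power_mono) (auto simp: q_def)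
      also have "\<dots> = \<eta> ^ (l - 1) * q ^ (l - 1)" by (rule power_mult_distrib)
      also have "\<dots> \<le> \<eta> ^ 1 * q ^ (l - 1)"
        using \<eta> q l by (intro mult_right_mono power_decreasing) auto
      \<comment> \<open>Only here is the smallness of \<open>\<eta>\<close> used: a cycle through a
        single old edge has \<open>l - 2\<close> new vertices and \<open>l - 1\<close> new edges,
        which balance exactly at the threshold.\<close>
      finally have "real n ^ (l - 2) * p ^ (l - 1) \<le> real n ^ (l - 2) * (\<eta> * q ^ (l - 1))"
        by (intro mult_left_mono) auto
      also have "\<dots> = \<eta> * (real n ^ (l - 2) * q ^ (l - 1))" by simp
      also have "real n ^ (l - 2) * q ^ (l - 1) = 1"
        using thr_power [OF l n] q by (simp add: q_def power_one_over field_simps)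
      finally have "real n ^ (l - Suc j) * p ^ (l - j) \<le> \<eta>" by (simp add: j numeral_2_eq_2)
      then have "cyc_const l * (real n ^ (l - Suc j) * p ^ (l - j)) \<le> cyc_const l * \<eta>"
        by (intro mult_left_mono) auto
      moreover have "0 \<le> cyc_const l * u" by (simp add: u_def)
      ultimately show ?thesis using le True by simp
    next
      case False
      have j2: "2 \<le> j"
      proof (rule ccontr)
        assume "\<not> 2 \<le> j"
        then have "card J = 1" using j1 by (simp add: j_def)
        then show False using J False by (auto simp: Js_def card_1_singleton_iff)
      qed
      have "real n ^ (l - Suc j) * p ^ (l - j) \<le> real n ^ (l - Suc j) * q ^ (l - j)"
        using p pq by (intro mult_left_mono power_mono) auto
      also have "\<dots> = real n powr (real (l - Suc j) + (-1 + 1 / (real l - 1)) * real (l - j))"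
        using n by (simp add: q_def thr_def powr_add powr_powr flip: powr_realpow)
      also have "\<dots> \<le> u"
        unfolding u_def
      proof (rule powr_mono)
        \<comment> \<open>Each old edge beyond the first gains a factor
          \<open>n powr (-1 / (l - 1))\<close>.\<close>
        have "real (l - Suc j) + (-1 + 1 / (real l - 1)) * real (l - j) = - (real j - 1) / (real l - 1)"
          using jl l by (simp add: of_nat_diff field_simps)
        also have "\<dots> \<le> - 1 / (real l - 1)" using j2 l by (intro divide_right_mono) auto
        finally show "real (l - Suc j) + (-1 + 1 / (real l - 1)) * real (l - j) \<le> - 1 / (real l - 1)" .
      qed (use n in simp)
      finally have "cyc_const l * (real n ^ (l - Suc j) * p ^ (l - j)) \<le> cyc_const l * u"
        by (intro mult_left_mono) auto
      then show ?thesis using le False by simp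
    qed
  qed
  also have "\<dots> = (\<Sum>J\<in>Js. if J = {e} then cyc_const l * \<eta> else 0) + card Js * (cyc_const l * u)"
    by (simp add: sum.distrib)
  also have "\<dots> \<le> cyc_const l * \<eta> + real l * real a ^ l * (cyc_const l * u)"
  proof (rule add_mono)
    show "(\<Sum>J\<in>Js. if J = {e} then cyc_const l * \<eta> else 0) \<le> cyc_const l * \<eta>"
      using finJs \<eta> by (simp add: sum.delta)
    have "Js \<subseteq> (\<Union>j<l. {J. J \<subseteq> S \<and> card J = j})" by (auto simp: Js_def)
    then have "card Js \<le> card (\<Union>j<l. {J. J \<subseteq> S \<and> card J = j})"
      by (rule card_mono [rotated]) (use S in auto)
    also have "\<dots> \<le> (\<Sum>j<l. card {J. J \<subseteq> S \<and> card J = j})" by (rule card_UN_le) simp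
    also have "\<dots> \<le> (\<Sum>j<l. a ^ l)"
    proof (rule sum_mono)
      fix j assume j: "j \<in> {..<l}"
      have "card {J. J \<subseteq> S \<and> card J = j} = card S choose j" by (rule n_subsets [OF S(1)])
      also have "\<dots> \<le> card S ^ j" by (cases "j \<le> card S") (auto intro: binomial_le_pow simp: binomial_eq_0)
      also have "\<dots> \<le> a ^ j" using S by (intro power_mono) auto
      also have "\<dots> \<le> a ^ l" using j a1 by (intro power_increasing) auto
      finally show "card {J. J \<subseteq> S \<and> card J = j} \<le> a ^ l" .
    qed
    finally have "real (card Js) \<le> real l * real a ^ l"
      by (simp flip: of_nat_power of_nat_mult)
    then show "card Js * (cyc_const l * u) \<le> real l * real a ^ l * (cyc_const l * u)"
      by (intro mult_right_mono) (auto simp: u_def)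
  qed
  finally show ?thesis by (simp add: u_def)
qed

text \<open>First moment over the starting edge and the explored sets. The step bound
  \<open>1 + s * (l + 1)\<close> is the budget of \<open>explored_or_closed\<close> for the list
  \<open>[e]\<close>; its power of 2 contributes \<open>2 ^ (l + 1)\<close> per extension.\<close>

lemma prob_explored_le:
  fixes p \<epsilon> :: real
  assumes l: "3 \<le> l" and p: "0 \<le> p" "p \<le> 1" and \<epsilon>: "0 \<le> \<epsilon>"
    and step: "\<And>S e. \<lbrakk>finite S; card S \<le> 1 + s * l; e \<in> S; S \<subseteq> all_edges n\<rbrakk> \<Longrightarrow>
      (\<Sum>C\<in>{C\<in>cycles l n. e \<in> C \<and> \<not> C \<subseteq> S}. p ^ card (C - S)) \<le> \<epsilon>"
  shows "pr (all_edges n) p (\<lambda>F. \<exists>e\<in>all_edges n. \<exists>A\<in>explored (cycles l n) (1 + s * (l + 1)) s [e] 0. A \<subseteq> F)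
    \<le> real n ^ 2 * (2 * (2 ^ (l + 1) * \<epsilon>) ^ s)"
proof -
  define m where "m = 1 + s * (l + 1)"
  have fc: "finite C \<and> card C \<le> l" if "C \<in> cycles l n" for C
    using cyclesD(1,2) [OF l that] finite_subset [OF _ finite_all_edges] by auto
  have "pr (all_edges n) p (\<lambda>F. \<exists>e\<in>all_edges n. \<exists>A\<in>explored (cycles l n) m s [e] 0. A \<subseteq> F) \<le>
      (\<Sum>e\<in>all_edges n. pr (all_edges n) p (\<lambda>F. \<exists>A\<in>explored (cycles l n) m s [e] 0. A \<subseteq> F))"
    by (rule pr_Bex [OF p finite_all_edges])
  also have "\<dots> \<le> (\<Sum>e\<in>all_edges n. 2 ^ m * \<epsilon> ^ s)"
  proof (rule sum_mono)
    fix e assume e: "e \<in> all_edges n"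
    have "pr (all_edges n) p (\<lambda>F. \<exists>A\<in>explored (cycles l n) m s [e] 0. A \<subseteq> F) \<le>
        (\<Sum>A\<in>explored (cycles l n) m s [e] 0. pr (all_edges n) p (\<lambda>F. A \<subseteq> F))"
      by (rule pr_Bex [OF p finite_explored]) simp
    also have "\<dots> = (\<Sum>A\<in>explored (cycles l n) m s [e] 0. p ^ card A)"
    proof (rule sum.cong [OF refl])
      fix A assume "A \<in> explored (cycles l n) m s [e] 0"
      then have "A \<subseteq> all_edges n"
        by (rule explored_subset) (use e fc cyclesD(1) [OF l] in auto)
      then show "pr (all_edges n) p (\<lambda>F. A \<subseteq> F) = p ^ card A" by (intro pr_subset) simp
    qed
    also have "\<dots> \<le> 2 ^ m * \<epsilon> ^ s * p ^ length [e]"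
      by (rule explored_weight [where a = "1 + s * l" and E = "all_edges n"])
        (use fc p \<epsilon> step cyclesD(1) [OF l] e in auto)
    also have "\<dots> \<le> 2 ^ m * \<epsilon> ^ s * 1" using p \<epsilon> by (intro mult_left_mono) auto
    finally show "pr (all_edges n) p (\<lambda>F. \<exists>A\<in>explored (cycles l n) m s [e] 0. A \<subseteq> F) \<le> 2 ^ m * \<epsilon> ^ s" by simp
  qed
  also have "\<dots> = card (all_edges n) * (2 ^ m * \<epsilon> ^ s)" by simp
  also have "\<dots> \<le> real n ^ 2 * (2 ^ m * \<epsilon> ^ s)"
    using card_all_edges_le_square \<epsilon> by (intro mult_right_mono) auto
  also have "(2::real) ^ m = 2 * (2 ^ (l + 1)) ^ s"
    unfolding m_def by (simp only: power_add [of _ 1] power_one_right mult.commute [of s] power_mult)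
  finally show ?thesis by (simp add: m_def power_mult_distrib mult.assoc)
qed

text \<open>A set \<open>Y\<close> has at most \<open>(a ^ 2) ^ (2 * card Y)\<close> choices of
  \<open>D\<close>, so it contributes \<open>y ^ card Y\<close> with
  \<open>y = a ^ 4 * p ^ 2\<close>. Over all nonempty \<open>Y\<close> this sums to
  \<open>(1 + y) ^ n - 1\<close>, which is of order \<open>n * y\<close>.\<close>

lemma prob_dense_spot_le:
  fixes p :: real
  assumes p: "0 \<le> p" "p \<le> 1" and x: "n * (real a ^ 4 * p ^ 2) \<le> 1"
  shows "pr (all_edges n) p (\<lambda>F. \<exists>Y\<in>{Y\<in>Pow {..<n}. Y \<noteq> {} \<and> card Y \<le> a}.
      \<exists>D\<in>{D. D \<subseteq> {e\<in>all_edges n. e \<subseteq> Y} \<and> card D = 2 * card Y}. D \<subseteq> F)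
    \<le> 2 * (n * (real a ^ 4 * p ^ 2))"
proof -
  define y where "y = real a ^ 4 * p ^ 2"
  have y0: "0 \<le> y" by (simp add: y_def)
  define Ys where "Ys = {Y\<in>Pow {..<n}. Y \<noteq> {} \<and> card Y \<le> a}"
  define Ds where "Ds = (\<lambda>Y. {D. D \<subseteq> {e\<in>all_edges n. e \<subseteq> Y} \<and> card D = 2 * card Y})"
  have finD: "finite (Ds Y)" for Y
    by (rule finite_subset [of _ "Pow (all_edges n)"]) (auto simp: Ds_def)
  have "pr (all_edges n) p (\<lambda>F. \<exists>Y\<in>Ys. \<exists>D\<in>Ds Y. D \<subseteq> F) \<le> (\<Sum>Y\<in>Ys. pr (all_edges n) p (\<lambda>F. \<exists>D\<in>Ds Y. D \<subseteq> F))"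
    by (rule pr_Bex [OF p]) (simp add: Ys_def)
  also have "\<dots> \<le> (\<Sum>Y\<in>Ys. y ^ card Y)"
  proof (rule sum_mono)
    fix Y assume Y: "Y \<in> Ys"
    then have finY: "finite Y" using finite_subset by (auto simp: Ys_def)
    define B where "B = {e\<in>all_edges n. e \<subseteq> Y}"
    have finB: "finite B" by (simp add: B_def)
    have "B \<subseteq> {e. e \<subseteq> Y \<and> card e = 2}" by (auto simp: B_def all_edges_eq)
    then have "card B \<le> card {e. e \<subseteq> Y \<and> card e = 2}" by (rule card_mono [rotated]) (use finY in simp)
    also have "\<dots> = card Y choose 2" by (rule n_subsets [OF finY])
    also have "\<dots> \<le> card Y ^ 2" by (cases "2 \<le> card Y") (auto intro: binomial_le_pow simp: binomial_eq_0)
    also have "\<dots> \<le> a ^ 2" using Y by (intro power_mono) (auto simp: Ys_def)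
    finally have cB: "card B \<le> a ^ 2" .
    have "card (Ds Y) = card B choose (2 * card Y)"
      unfolding Ds_def B_def [symmetric] by (rule n_subsets [OF finB])
    also have "\<dots> \<le> card B ^ (2 * card Y)"
      by (cases "2 * card Y \<le> card B") (auto intro: binomial_le_pow simp: binomial_eq_0)
    also have "\<dots> \<le> (a ^ 2) ^ (2 * card Y)" by (rule power_mono [OF cB]) simp
    finally have cD: "real (card (Ds Y)) \<le> (real a ^ 2) ^ (2 * card Y)"
      by (metis of_nat_mono of_nat_power)
    have "pr (all_edges n) p (\<lambda>F. \<exists>D\<in>Ds Y. D \<subseteq> F) \<le> (\<Sum>D\<in>Ds Y. pr (all_edges n) p (\<lambda>F. D \<subseteq> F))"
      by (rule pr_Bex [OF p finD])
    also have "\<dots> = (\<Sum>D\<in>Ds Y. p ^ (2 * card Y))"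
    proof (rule sum.cong [OF refl])
      fix D assume "D \<in> Ds Y"
      then have "D \<subseteq> all_edges n" "card D = 2 * card Y" by (auto simp: Ds_def)
      then show "pr (all_edges n) p (\<lambda>F. D \<subseteq> F) = p ^ (2 * card Y)" using pr_subset [of "all_edges n" D p] by simp
    qed
    also have "\<dots> = card (Ds Y) * p ^ (2 * card Y)" by simp
    also have "\<dots> \<le> (real a ^ 2) ^ (2 * card Y) * p ^ (2 * card Y)"
      using cD p by (intro mult_right_mono) auto
    also have "\<dots> = ((real a ^ 2) ^ 2 * p ^ 2) ^ card Y" by (simp add: power_mult power_mult_distrib)
    also have "(real a ^ 2) ^ 2 * p ^ 2 = y" by (simp add: y_def)
    finally show "pr (all_edges n) p (\<lambda>F. \<exists>D\<in>Ds Y. D \<subseteq> F) \<le> y ^ card Y" .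
  qed
  also have "\<dots> \<le> (\<Sum>Y\<in>Pow {..<n} - {{}}. y ^ card Y)"
    by (rule sum_mono2) (use y0 in \<open>auto simp: Ys_def\<close>)
  also have "\<dots> = (1 + y) ^ n - 1"
    using sum.remove [of "Pow {..<n}" "{}" "\<lambda>Y. y ^ card Y"] sum_Pow_power [of "{..<n}" y] by simp
  also have "\<dots> \<le> exp y ^ n - 1"
    using y0 exp_ge_add_one_self [of y] by (intro diff_mono power_mono) auto
  also have "\<dots> = exp (n * y) - 1" by (simp add: exp_of_nat_mult)
  also have "\<dots> \<le> 2 * (n * y)"
  proof -
    have z: "0 \<le> n * y" "n * y \<le> 1" using y0 x by (auto simp: y_def)
    then have "exp (n * y) \<le> 1 + n * y + (n * y) ^ 2" by (rule exp_bound)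
    moreover have "(n * y) ^ 2 \<le> n * y" using z by (simp add: power2_eq_square mult_left_le)
    ultimately show ?thesis by linarith
  qed
  finally show ?thesis by (simp add: y_def Ys_def Ds_def)
qed

text \<open>Bound the logarithm by a multiple of \<open>n powr \<beta>\<close>, with
  \<open>\<beta>\<close> so small that the \<open>k\<close>-th power uses up at most half of the
  decay.\<close>

lemma polylog_negligible:
  fixes \<gamma> b :: real
  assumes "0 < \<gamma>" "0 \<le> b"
  shows "((\<lambda>n. (1 + (4 * ln (real n) + 1) * b) ^ k * real n powr (-\<gamma>)) \<longlongrightarrow> 0) at_top"
proof -
  define \<beta> where "\<beta> = \<gamma> / (2 * real (Suc k))"
  have \<beta>: "0 < \<beta>" using assms by (simp add: \<beta>_def)
  define c where "c = 1 + (4 / \<beta> + 1) * b"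
  have c: "0 \<le> c" using assms \<beta> by (simp add: c_def)
  have le: "(1 + (4 * ln (real n) + 1) * b) ^ k * real n powr (-\<gamma>) \<le> c ^ k * real n powr (-(\<gamma> / 2))"
    "0 \<le> (1 + (4 * ln (real n) + 1) * b) ^ k * real n powr (-\<gamma>)" if n: "1 \<le> n" for n
  proof -
    have n1: "1 \<le> real n" using n by simp
    have l0: "0 \<le> ln (real n)" using n by simp
    have "ln (real n) \<le> real n powr \<beta> / \<beta>" by (rule ln_powr_bound [OF n1 \<beta>])
    moreover have nb: "1 \<le> real n powr \<beta>" using n1 \<beta> by (simp add: ge_one_powr_ge_zero)
    ultimately have "4 * ln (real n) + 1 \<le> (4 / \<beta> + 1) * real n powr \<beta>" by (simp add: distrib_right)
    then have "(4 * ln (real n) + 1) * b \<le> ((4 / \<beta> + 1) * real n powr \<beta>) * b"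
      using assms by (intro mult_right_mono) auto
    then have "1 + (4 * ln (real n) + 1) * b \<le> c * real n powr \<beta>"
      using nb by (simp add: c_def algebra_simps)
    moreover have pos: "0 \<le> 1 + (4 * ln (real n) + 1) * b" using l0 assms by simp
    ultimately have "(1 + (4 * ln (real n) + 1) * b) ^ k \<le> (c * real n powr \<beta>) ^ k"
      by (rule power_mono)
    also have "\<dots> = c ^ k * real n powr (\<beta> * k)" using n by (simp add: power_mult_distrib powr_powr flip: powr_realpow)
    also have "\<dots> \<le> c ^ k * real n powr (\<gamma> / 2)"
    proof (intro mult_left_mono powr_mono n1)
      have "\<beta> * k \<le> \<beta> * Suc k" using \<beta> by (intro mult_left_mono) auto
      also have "\<dots> = \<gamma> / 2" by (simp add: \<beta>_def del: of_nat_Suc)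
      finally show "\<beta> * k \<le> \<gamma> / 2" .
    qed (use c in simp)
    finally have "(1 + (4 * ln (real n) + 1) * b) ^ k * real n powr (-\<gamma>) \<le> c ^ k * real n powr (\<gamma> / 2) * real n powr (-\<gamma>)"
      by (rule mult_right_mono) simp
    also have "\<dots> = c ^ k * real n powr (-(\<gamma> / 2))" by (simp add: mult.assoc flip: powr_add)
    finally show "(1 + (4 * ln (real n) + 1) * b) ^ k * real n powr (-\<gamma>) \<le> c ^ k * real n powr (-(\<gamma> / 2))" .
    show "0 \<le> (1 + (4 * ln (real n) + 1) * b) ^ k * real n powr (-\<gamma>)" using pos by simp
  qed
  have "((\<lambda>n. c ^ k * real n powr (-(\<gamma> / 2))) \<longlongrightarrow> c ^ k * 0) at_top"
    using assms by (intro tendsto_mult_left tendsto_neg_powr filterlim_real_sequentially) auto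
  then have "((\<lambda>n. c ^ k * real n powr (-(\<gamma> / 2))) \<longlongrightarrow> 0) at_top" by simp
  then show ?thesis
  proof (rule tendsto_sandwich [OF _ _ tendsto_const, rotated 2])
    show "eventually (\<lambda>n. 0 \<le> (1 + (4 * ln (real n) + 1) * b) ^ k * real n powr (-\<gamma>)) at_top"
      using eventually_ge_at_top [of 1] by eventually_elim (rule le)
    show "eventually (\<lambda>n. (1 + (4 * ln (real n) + 1) * b) ^ k * real n powr (-\<gamma>) \<le> c ^ k * real n powr (-(\<gamma> / 2))) at_top"
      using eventually_ge_at_top [of 1] by eventually_elim (rule le)
  qed
qed

text \<open>If no exploration reaches \<open>s n\<close> extensions, every edge has a closed set of
  at most \<open>a n\<close> edges around it; if there is also no dense spot of that size, two
  colours suffice. Both exceptional events are unlikely.\<close>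

lemma pert_lower_thr:
  assumes l: "odd l" "9 \<le> l" and r: "2 \<le> r" and d: "d \<le> 1 - 1 / 2 ^ (r - 2)"
  shows "pert_lower l r d (thr l)"
proof (rule pert_lowerI [OF l(1) _ d])
  fix \<epsilon> :: real assume \<epsilon>: "0 < \<epsilon>"
  have l3: "3 \<le> l" using l by simp
  have rr: "r - (r - 2) = 2" using r by simp
  define K where "K = real (cyc_const l)"
  \<comment> \<open>Makes the cost \<open>2 ^ (l + 1) * \<epsilon>'\<close> of one extension equal
    to \<open>exp (-1)\<close>.\<close>
  define \<epsilon>' where "\<epsilon>' = exp (-1) / (2::real) ^ (l + 1)"
  have \<epsilon>': "0 < \<epsilon>'" by (simp add: \<epsilon>'_def)
  have K: "0 < K" using l by (simp add: K_def cyc_const_def)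
  \<comment> \<open>Half of \<open>\<epsilon>'\<close> is reserved for cycles attached at one edge;
    the other half covers larger intersections, which are negligible for large
    \<open>n\<close>.\<close>
  define \<eta> where "\<eta> = min 1 (\<epsilon>' / (2 * K))"
  have \<eta>: "0 < \<eta>" "\<eta> \<le> 1" using \<epsilon>' K by (auto simp: \<eta>_def)
  have K\<eta>: "K * \<eta> \<le> \<epsilon>' / 2"
  proof -
    have "K * \<eta> \<le> K * (\<epsilon>' / (2 * K))" using K by (intro mult_left_mono) (auto simp: \<eta>_def)
    then show ?thesis using K by simp
  qed
  \<comment> \<open>With this many extensions the factor \<open>exp (- s n)\<close> is at most
    \<open>n ^ (-4)\<close>, which beats the \<open>n ^ 2\<close> starting edges.\<close>
  define s where "s = (\<lambda>n. nat \<lceil>4 * ln (real n)\<rceil>)"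
  define a where "a = (\<lambda>n. 1 + s n * l)"
  define A where "A = (\<lambda>n. 1 + (4 * ln (real n) + 1) * real l)"
  have lp: "0 < 1 / (real l - 1)" using l by simp
  have "eventually (\<lambda>n. A n ^ l * real n powr (-(1 / (real l - 1))) < \<epsilon>' / (2 * (real l * K))) at_top"
    unfolding A_def by (rule order_tendstoD(2) [OF polylog_negligible [OF lp]]) (use \<epsilon>' K l in auto)
  moreover have "eventually (\<lambda>n. A n ^ 4 * real n powr (-(3 / 4)) < min 1 (\<epsilon> / 4)) at_top"
    unfolding A_def by (rule order_tendstoD(2) [OF polylog_negligible]) (use \<epsilon> in auto)
  moreover have "eventually (\<lambda>n. max 1 (nat \<lceil>4 / \<epsilon>\<rceil>) \<le> n) at_top" by (rule eventually_ge_at_top)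
  ultimately have "eventually (\<lambda>n. \<forall>p::real. 0 \<le> p \<longrightarrow> p \<le> 1 \<longrightarrow> p \<le> \<eta> * thr l n \<longrightarrow>
      pr (all_edges n) p (cycle_ramsey l (r - (r - 2))) \<le> \<epsilon>) at_top"
  proof eventually_elim
    case (elim n)
    have n: "1 \<le> n" and n\<epsilon>: "4 / \<epsilon> \<le> n" using elim(3) by linarith+
    have n0: "0 < n" using n by simp
    have l0: "0 \<le> ln (real n)" using n by simp
    have s1: "4 * ln (real n) \<le> s n" and s2: "s n \<le> 4 * ln (real n) + 1"
      using l0 unfolding s_def by linarith+
    have "real (s n) * real l \<le> (4 * ln (real n) + 1) * real l" using s2 by (intro mult_right_mono) auto
    then have aA: "real (a n) \<le> A n" by (simp add: a_def A_def)
    show ?case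
    proof (intro allI impI)
      fix p :: real assume p: "0 \<le> p" "p \<le> 1" "p \<le> \<eta> * thr l n"
      define B1 where "B1 = (\<lambda>F. \<exists>e\<in>all_edges n. \<exists>A\<in>explored (cycles l n) (1 + s n * (l + 1)) (s n) [e] 0. A \<subseteq> F)"
      define B2 where "B2 = (\<lambda>F. \<exists>Y\<in>{Y\<in>Pow {..<n}. Y \<noteq> {} \<and> card Y \<le> a n}.
        \<exists>D\<in>{D. D \<subseteq> {e\<in>all_edges n. e \<subseteq> Y} \<and> card D = 2 * card Y}. D \<subseteq> F)"
      have imp: "B1 F \<or> B2 F" if F: "F \<subseteq> all_edges n" and ram: "cycle_ramsey l (r - (r - 2)) F" for F
      proof (rule ccontr)
        assume no: "\<not> (B1 F \<or> B2 F)"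
        have "\<not> cycle_ramsey l 2 F"
        proof (rule closed_sparse_not_ramsey [OF l(1) l3 F, of "a n"])
          fix e assume e: "e \<in> F"
          have "(\<exists>A\<in>explored (cycles l n) (1 + s n * (l + 1)) (s n) [e] 0. A \<subseteq> F) \<or>
            (\<exists>A. set [e] \<subseteq> A \<and> closed_in (cycles l n) F A \<and> card A \<le> length [e] + s n * l)"
          proof (rule explored_or_closed)
            fix C assume "C \<in> cycles l n"
            then show "finite C \<and> card C \<le> l" using cyclesD(1,2) [OF l3] finite_subset by fastforce
          qed (use e in auto)
          moreover have "e \<in> all_edges n" using e F by blast
          ultimately show "\<exists>A. e \<in> A \<and> closed_in (cycles l n) F A \<and> card A \<le> a n"
            using no by (auto simp: B1_def a_def)
        next
          fix Y D assume Y: "Y \<subseteq> {..<n}" "Y \<noteq> {}" "card Y \<le> a n" and D: "D \<subseteq> F" "\<forall>e\<in>D. e \<subseteq> Y"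
          show "card D \<noteq> 2 * card Y"
          proof
            assume "card D = 2 * card Y"
            moreover have "D \<subseteq> {e\<in>all_edges n. e \<subseteq> Y}" using D F by blast
            ultimately have "B2 F" unfolding B2_def using Y D(1) by blast
            then show False using no by blast
          qed
        qed
        then show False using ram rr by simp
      qed
      have "pr (all_edges n) p B1 \<le> real n ^ 2 * (2 * (2 ^ (l + 1) * \<epsilon>') ^ s n)"
        unfolding B1_def
      proof (rule prob_explored_le [OF l3 p(1,2)])
        fix S e assume S: "finite S" "card S \<le> 1 + s n * l" "e \<in> S" "S \<subseteq> all_edges n"
        have "(\<Sum>C\<in>{C\<in>cycles l n. e \<in> C \<and> \<not> C \<subseteq> S}. p ^ card (C - S)) \<le>
          K * \<eta> + real l * real (a n) ^ l * (K * real n powr (- 1 / (real l - 1)))"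
          unfolding K_def by (rule attach_weight [OF l3 n0 \<eta> p(1,3) S(1) _ S(3,4)]) (use S(2) in \<open>simp add: a_def\<close>)
        also have "real l * real (a n) ^ l * (K * real n powr (- 1 / (real l - 1))) \<le> \<epsilon>' / 2"
        proof -
          have "real (a n) ^ l * real n powr (- 1 / (real l - 1)) \<le> A n ^ l * real n powr (-(1 / (real l - 1)))"
            using aA by (intro mult_mono power_mono) auto
          then have "real (a n) ^ l * real n powr (- 1 / (real l - 1)) \<le> \<epsilon>' / (2 * (real l * K))"
            using elim(1) by linarith
          then have "(real l * K) * (real (a n) ^ l * real n powr (- 1 / (real l - 1))) \<le> (real l * K) * (\<epsilon>' / (2 * (real l * K)))"
            using K by (intro mult_left_mono) auto
          also have "\<dots> = \<epsilon>' / 2" using K l by simp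
          finally show ?thesis by (simp add: mult_ac)
        qed
        finally show "(\<Sum>C\<in>{C\<in>cycles l n. e \<in> C \<and> \<not> C \<subseteq> S}. p ^ card (C - S)) \<le> \<epsilon>'"
          using K\<eta> by linarith
      qed (use \<epsilon>' in simp)
      also have "2 ^ (l + 1) * \<epsilon>' = exp (-1)" by (simp add: \<epsilon>'_def)
      also have "exp (-1) ^ s n = exp (- real (s n))" by (simp add: mult.commute flip: exp_of_nat_mult)
      also have "real n ^ 2 * (2 * exp (- real (s n))) \<le> real n ^ 2 * (2 * exp (- (4 * ln (real n))))"
        using s1 by (intro mult_left_mono) auto
      also have "exp (- (4 * ln (real n))) = 1 / real n ^ 4"
      proof -
        have "exp (4 * ln (real n)) = real n ^ 4"
          using n0 exp_of_nat_mult [of 4 "ln (real n)"] by simp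
        then show ?thesis by (simp add: exp_minus inverse_eq_divide)
      qed
      also have "real n ^ 2 * (2 * (1 / real n ^ 4)) = 2 / real n ^ 2"
        using n0 by (simp add: field_simps flip: power_add)
      also have "\<dots> \<le> 2 / real n"
        using n by (intro divide_left_mono) (auto simp: self_le_power)
      also have "\<dots> \<le> \<epsilon> / 2" using n\<epsilon> \<epsilon> n0 by (simp add: field_simps)
      finally have P1: "pr (all_edges n) p B1 \<le> \<epsilon> / 2" .
      have small: "n * (real (a n) ^ 4 * p ^ 2) \<le> A n ^ 4 * real n powr (-(3 / 4))"
      proof -
        have "p \<le> 1 * thr l n" using p(3) \<eta> thr_pos [OF n0, of l] by (meson less_imp_le mult_right_mono order_trans)
        also have "1 * thr l n \<le> real n powr (-(7 / 8))"
        proof -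
          \<comment> \<open>From \<open>l \<ge> 9\<close>: then
            \<open>p \<le> n powr (-7/8)\<close>, so \<open>n * p ^ 2\<close> decays polynomially
            and outweighs the logarithmic factor \<open>a n ^ 4\<close>.\<close>
          have "1 / (real l - 1) \<le> 1 / 8" using l by (intro divide_left_mono) auto
          then show ?thesis unfolding thr_def mult_1_left using n by (intro powr_mono) auto
        qed
        finally have "p ^ 2 \<le> (real n powr (-(7 / 8))) ^ 2" using p by (intro power_mono) auto
        also have "\<dots> = real n powr (-(7 / 4))" using n0 by (simp add: powr_powr flip: powr_realpow)
        finally have "real (a n) ^ 4 * p ^ 2 \<le> A n ^ 4 * real n powr (-(7 / 4))"
          using aA by (intro mult_mono power_mono) auto
        then have "n * (real (a n) ^ 4 * p ^ 2) \<le> n * (A n ^ 4 * real n powr (-(7 / 4)))"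
          by (intro mult_left_mono) auto
        also have "\<dots> = A n ^ 4 * (real n powr 1 * real n powr (-(7 / 4)))"
          using n0 by (simp only: powr_one of_nat_0_le_iff mult.left_commute)
        also have "real n powr 1 * real n powr (-(7 / 4)) = real n powr (-(3 / 4))" by (subst powr_add [symmetric]) simp
        finally show ?thesis .
      qed
      have "n * (real (a n) ^ 4 * p ^ 2) \<le> 1" using small elim(2) by simp
      then have "pr (all_edges n) p B2 \<le> 2 * (n * (real (a n) ^ 4 * p ^ 2))"
        unfolding B2_def by (rule prob_dense_spot_le [OF p(1,2)])
      then have P2: "pr (all_edges n) p B2 \<le> \<epsilon> / 2" using small elim(2) by simp
      have "pr (all_edges n) p (cycle_ramsey l (r - (r - 2))) \<le> pr (all_edges n) p (\<lambda>F. B1 F \<or> B2 F)"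
        by (rule pr_mono [OF p(1,2) imp])
      also have "\<dots> \<le> pr (all_edges n) p B1 + pr (all_edges n) p B2" by (rule pr_disj [OF p(1,2)])
      also have "\<dots> \<le> \<epsilon>" using P1 P2 by linarith
      finally show "pr (all_edges n) p (cycle_ramsey l (r - (r - 2))) \<le> \<epsilon>" .
    qed
  qed
  then show "\<exists>\<eta>::real. 0 < \<eta> \<and> (\<exists>n0. \<forall>n\<ge>n0. \<forall>p::real. 0 \<le> p \<longrightarrow> p \<le> 1 \<longrightarrow> p \<le> \<eta> * thr l n \<longrightarrow>
      pr (all_edges n) p (cycle_ramsey l (r - (r - 2))) \<le> \<epsilon>)"
    unfolding eventually_at_top_linorder using \<eta>(1) by blast
qed (auto simp: thr_def)

theorem theorem1p11:
  fixes r l :: nat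
  assumes "r \<ge> 3" and "odd l" and "l \<ge> 2 ^ r + 1"
  shows "(\<forall>d::real. 0 \<le> d \<and> d \<le> 1 - 2 powr (2 - real r) \<longrightarrow>
            pert_upper l r d (\<lambda>n. real n powr (-1 + 1 / (real l - 1))) \<and>
            pert_lower l r d (\<lambda>n. real n powr (-1 + 1 / (real l - 1))))
       \<and> (\<forall>d::real. 1 - 2 powr (2 - real r) < d \<and> d \<le> 1 - 2 powr (1 - real r) \<longrightarrow>
            pert_upper l r d (\<lambda>n. real n powr (-1 + 1 / (real l - 1))) \<and>
            pert_lower l r d (\<lambda>n. real n powr (-1)))
       \<and> (\<forall>d::real. 1 - 2 powr (1 - real r) < d \<and> d \<le> 1 - 2 powr (- real r) \<longrightarrow>
            pert_upper l r d (\<lambda>n. real n powr (-2)) \<and>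
            pert_lower l r d (\<lambda>n. real n powr (-2)))
       \<and> (\<forall>d::real. 1 - 2 powr (- real r) < d \<and> d \<le> 1 \<longrightarrow> pert_zero l r d)"
proof -
  have pw: "2 powr (real k - real r) = 1 / 2 ^ (r - k)" if "k \<le> r" for k
  proof -
    have "2 powr (real k - real r) = 2 powr (- real (r - k))" using that by (simp add: of_nat_diff)
    then show ?thesis by (simp add: powr_minus powr_realpow inverse_eq_divide)
  qed
  have p2: "2 powr (2 - real r) = 1 / 2 ^ (r - 2)" and p1: "2 powr (1 - real r) = 1 / 2 ^ (r - 1)"
    and p0: "2 powr (- real r) = 1 / 2 ^ r"
    using pw [of 2] pw [of 1] pw [of 0] assms(1) by simp_all
  \<comment> \<open>This is where \<open>r \<ge> 3\<close> provides the cycle length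
    \<open>l \<ge> 9\<close> required by \<open>pert_lower_thr\<close>.\<close>
  have "(2::nat) ^ 3 \<le> 2 ^ r" using assms(1) by (intro power_increasing) auto
  then have l9: "9 \<le> l" using assms(3) by simp
  have r0: "0 < r" and l3: "3 \<le> l" using assms(1) l9 by simp_all
  have thr: "thr l = (\<lambda>n. real n powr (-1 + 1 / (real l - 1)))" by (rule ext) (simp add: thr_def)
  note up = pert_upper_thr [OF assms(2,3) l3 r0, unfolded thr]
  show ?thesis
    unfolding p2 p1 p0
  proof (intro conjI allI impI; elim conjE)
    fix d :: real assume "d \<le> 1 - 1 / 2 ^ (r - 2)"
    then show "pert_lower l r d (\<lambda>n. real n powr (-1 + 1 / (real l - 1)))"
      using pert_lower_thr [OF assms(2) l9, of r d] assms(1) thr by simp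
  next
    fix d :: real assume "d \<le> 1 - 1 / 2 ^ (r - 1)"
    then show "pert_lower l r d (\<lambda>n. real n powr (-1))"
      using pert_lower_acyclic [OF assms(2) l3, of r d] r0 by simp
  next
    fix d :: real assume "1 - 1 / 2 ^ (r - 1) < d"
    then show "pert_upper l r d (\<lambda>n. real n powr (-2))"
      by (rule pert_upper_few_edges [OF assms(2,3) r0])
  next
    fix d :: real assume "d \<le> 1 - 1 / 2 ^ r"
    then show "pert_lower l r d (\<lambda>n. real n powr (-2))"
      by (rule pert_lower_empty [OF assms(2)])
  next
    fix d :: real assume "1 - 1 / 2 ^ r < d"
    then show "pert_zero l r d" by (rule pert_zero_dense [OF assms(2,3) r0])
  qed (rule up)+
qed

end
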